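(* Let $A\in C^1(\mathbb{R}^* )\cap L^2(\mathbb{R}^*,dx)$ be a real-valued function whose support is the whole of $\mathbb{R}^*$, and put $A^\pm=A\chi_{\mathbb{R}_\pm}$. Assume that the kernel $$L(x,y)=\frac{A^+(x)A^-(y)+A^-(x)A^+(y)}{x-y},\qquad x,y\in\mathbb{R}^*,$$ defines a bounded operator $L$ on $L^2(\mathbb{R}^*,dx)$, and let $\mu_L$ be the determinantal point process on $\mathbb{R}^*$ with correlation kernel $K_L=L(1+L)^{-1}$. Let $n\ge1$ and let $\mathfrak{p}=(p_1^+,\dots,p_n^+;p_1^-,\dots,p_n^-)\in\mathbb{R}_+^n\times\mathbb{R}_-^n$ be a $2n$-tuple of distinct points. For $\delta>0$ and $X\in\mathrm{Conf}(\mathbb{R}^* )$ put $$D_\delta(X)=\sum_{i=1}^n\Big(\sum_{x\in X\cap(\delta,\infty)}\log\Big|\frac{x/p_i^+-1}{x/p_i^--1}\Big|^2+\sum_{x\in X\cap(-\infty,-\delta)}\log\Big|\frac{x/p_i^--1}{x/p_i^+-1}\Big|^2\Big).$$ Then the limit $\overline{S}_{\mathfrak{p}}(X):=\lim_{\delta\to0^+}\{D_\delta(X)-\mathbb{E}_{\mu_L}D_\delta\}$ exists for $\mu_L$-almost every $X\in\mathrm{Conf}(\mathbb{R}^* )$. Moreover, $\exp(\overline{S}_{\mathfrak{p}})\in L^1(\mathrm{Conf}(\mathbb{R}^* ),\mu_L)$.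
   Context: $\mathbb{R}^*=\mathbb{R}\setminus\{0\}=\mathbb{R}_+\sqcup\mathbb{R}_-$ (open positive and negative semi-axes). The operator $L$ is anti-self-adjoint, of the block form $\begin{bmatrix}0&V\\-V^*&0\end{bmatrix}$ with respect to $L^2(\mathbb{R}_+)\oplus L^2(\mathbb{R}_-)$, so $1+L$ is invertible, and $K_L=L(1+L)^{-1}$ is the correlation kernel of a determinantal point process $\mu_L$ on $\mathbb{R}^*$. $\mathrm{Conf}(\mathbb{R}^* )$ is the set of locally finite subsets of $\mathbb{R}^*$ (finite intersection with every compact subset of $\mathbb{R}^*$) with its usual Borel structure generated by counting maps. A probability measure on it is determinantal with correlation kernel $K$ if for all $k\ge1$ and disjoint relatively compact Borel $D_1,\dots,D_k\subset\mathbb{R}^*$, $\mathbb{E}\prod_{i=1}^k\#(X\cap D_i)=\int_{D_1\times\cdots\times D_k}\det(K(x_i,x_j))_{1\le i,j\le k}\,dx_1\cdots dx_k$. *)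

theory Defs
  imports
    "HOL-Probability.Probability"
    "Jordan_Normal_Form.Determinant"
begin

abbreviation Rstar :: "real set" where
  "Rstar \<equiv> - {0}"

abbreviation lborel_star :: "real measure" where
  "lborel_star \<equiv> restrict_space lborel Rstar"


section \<open>Operators on the complex Hilbert space of square-integrable functions\<close>

text \<open>
  Elements of $L^2(\mathbb{R}^*,dx)$ are handled through representatives. Operators map
  representatives to representatives, and equality of elements is equality almost everywhere.
\<close>

definition L2_star :: "(real \<Rightarrow> complex) set" where
  "L2_star = {f. f \<in> borel_measurable lborel_star \<and>
                 integrable lborel_star (\<lambda>x. (cmod (f x))\<^sup>2)}"

definition L2_star_norm :: "(real \<Rightarrow> complex) \<Rightarrow> real" where
  "L2_star_norm f = sqrt (LINT x|lborel_star. (cmod (f x))\<^sup>2)"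

definition integral_op :: "(real \<Rightarrow> real \<Rightarrow> complex) \<Rightarrow> (real \<Rightarrow> complex) \<Rightarrow> real \<Rightarrow> complex" where
  "integral_op k f x = (LINT y|lborel_star. k x y * f y)"

definition bounded_op :: "((real \<Rightarrow> complex) \<Rightarrow> real \<Rightarrow> complex) \<Rightarrow> bool" where
  "bounded_op T \<longleftrightarrow>
     (\<exists>C. \<forall>f\<in>L2_star. T f \<in> L2_star \<and> L2_star_norm (T f) \<le> C * L2_star_norm f)"

text \<open>The integrability clause excludes the default value 0 of a divergent integral.\<close>

definition has_kernel ::
    "((real \<Rightarrow> complex) \<Rightarrow> real \<Rightarrow> complex) \<Rightarrow> (real \<Rightarrow> real \<Rightarrow> complex) \<Rightarrow> bool" where
  "has_kernel T k \<longleftrightarrow>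
     (\<forall>f\<in>L2_star. AE x in lborel_star.
        integrable lborel_star (\<lambda>y. k x y * f y) \<and> T f x = integral_op k f x)"

text \<open>
  For an operator that is bijective on $L^2(\mathbb{R}^*,dx)$ the choice below is unique up to
  equality almost everywhere.
\<close>

definition op_inverse ::
    "((real \<Rightarrow> complex) \<Rightarrow> real \<Rightarrow> complex) \<Rightarrow> (real \<Rightarrow> complex) \<Rightarrow> real \<Rightarrow> complex" where
  "op_inverse T f = (SOME g. g \<in> L2_star \<and> (AE x in lborel_star. T g x = f x))"


section \<open>The operators $L$ and $L(1+L)^{-1}$\<close>

definition A_plus :: "(real \<Rightarrow> real) \<Rightarrow> real \<Rightarrow> real" where
  "A_plus A x = A x * indicator {0<..} x"

definition A_minus :: "(real \<Rightarrow> real) \<Rightarrow> real \<Rightarrow> real" where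
  "A_minus A x = A x * indicator {..<0} x"

text \<open>
  The numerator vanishes when \<open>x\<close> and \<open>y\<close> have the same sign, so the value of the
  quotient on the diagonal is 0.
\<close>

definition L_kernel :: "(real \<Rightarrow> real) \<Rightarrow> real \<Rightarrow> real \<Rightarrow> complex" where
  "L_kernel A x y = complex_of_real
     ((A_plus A x * A_minus A y + A_minus A x * A_plus A y) / (x - y))"

abbreviation L_op :: "(real \<Rightarrow> real) \<Rightarrow> (real \<Rightarrow> complex) \<Rightarrow> real \<Rightarrow> complex" where
  "L_op A \<equiv> integral_op (L_kernel A)"

definition K_op :: "(real \<Rightarrow> real) \<Rightarrow> (real \<Rightarrow> complex) \<Rightarrow> real \<Rightarrow> complex" where
  "K_op A f = L_op A (op_inverse (\<lambda>g x. g x + L_op A g x) f)"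

text \<open>
  An operator determines its kernel only almost everywhere, whereas correlation functions involve
  the values on the diagonal. The kernel of $L(1+L)^{-1}$ is therefore taken to be the continuous
  one, which is unique on $\mathbb{R}^*\times\mathbb{R}^*$; for continuous \<open>A\<close> it is
  $L(x,y) - \int L(x,u)\,((1+L)^{-1}L(\cdot,y))(u)\,du$.
\<close>

definition is_K_kernel :: "(real \<Rightarrow> real) \<Rightarrow> (real \<Rightarrow> real \<Rightarrow> complex) \<Rightarrow> bool" where
  "is_K_kernel A K \<longleftrightarrow>
     continuous_on (Rstar \<times> Rstar) (\<lambda>(x, y). K x y) \<and> has_kernel (K_op A) K"


section \<open>Determinantal point processes on the punctured line\<close>

definition Conf :: "real set set" where
  "Conf = {X. X \<subseteq> Rstar \<and> (\<forall>C. compact C \<and> C \<subseteq> Rstar \<longrightarrow> finite (X \<inter> C))}"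

definition rel_compact_borel :: "real set \<Rightarrow> bool" where
  "rel_compact_borel D \<longleftrightarrow> D \<in> sets borel \<and> (\<exists>C. compact C \<and> C \<subseteq> Rstar \<and> D \<subseteq> C)"

definition Conf_algebra :: "real set measure" where
  "Conf_algebra = sigma Conf {{X \<in> Conf. card (X \<inter> D) = m} | D m. rel_compact_borel D}"

definition determinantal :: "real set measure \<Rightarrow> (real \<Rightarrow> real \<Rightarrow> complex) \<Rightarrow> bool" where
  "determinantal \<mu> K \<longleftrightarrow>
     prob_space \<mu> \<and> sets \<mu> = sets Conf_algebra \<and>
     (\<forall>k\<ge>1. \<forall>D :: nat \<Rightarrow> real set.
        (\<forall>i<k. rel_compact_borel (D i)) \<and> disjoint_family_on D {..<k} \<longrightarrow>
        integrable \<mu> (\<lambda>X. \<Prod>i<k. real (card (X \<inter> D i))) \<and>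
        set_integrable (Pi\<^sub>M {..<k} (\<lambda>_. lborel)) (Pi\<^sub>E {..<k} D)
          (\<lambda>x. Determinant.det (Matrix.mat k k (\<lambda>(i, j). K (x i) (x j)))) \<and>
        complex_of_real (LINT X|\<mu>. (\<Prod>i<k. real (card (X \<inter> D i)))) =
          (LINT x:Pi\<^sub>E {..<k} D|Pi\<^sub>M {..<k} (\<lambda>_. lborel).
             Determinant.det (Matrix.mat k k (\<lambda>(i, j). K (x i) (x j)))))"


section \<open>The regularized additive functional\<close>

text \<open>
  A configuration may be infinite near infinity, hence the infinite sums. For the process under
  consideration the sets \<open>X \<inter> {\<delta><..}\<close> and \<open>X \<inter> {..< - \<delta>}\<close> are almost surely
  finite. The convention \<open>ln 0 = 0\<close> only matters when \<open>X\<close> contains one of the points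
  \<open>pp i\<close>, \<open>pm i\<close>, which is a null event.
\<close>

definition D_sum ::
    "nat \<Rightarrow> (nat \<Rightarrow> real) \<Rightarrow> (nat \<Rightarrow> real) \<Rightarrow> real \<Rightarrow> real set \<Rightarrow> real" where
  "D_sum n pp pm \<delta> X =
     (\<Sum>i=1..n.
        (\<Sum>\<^sub>\<infinity>x\<in>X \<inter> {\<delta><..}. ln (\<bar>(x / pp i - 1) / (x / pm i - 1)\<bar>\<^sup>2)) +
        (\<Sum>\<^sub>\<infinity>x\<in>X \<inter> {..< - \<delta>}. ln (\<bar>(x / pm i - 1) / (x / pp i - 1)\<bar>\<^sup>2)))"

definition centered_D_sum ::
    "real set measure \<Rightarrow> nat \<Rightarrow> (nat \<Rightarrow> real) \<Rightarrow> (nat \<Rightarrow> real) \<Rightarrow> real set \<Rightarrow> real \<Rightarrow> real" where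
  "centered_D_sum \<mu> n pp pm X \<delta> =
     D_sum n pp pm \<delta> X - (LINT Y|\<mu>. D_sum n pp pm \<delta> Y)"

definition S_bar ::
    "real set measure \<Rightarrow> nat \<Rightarrow> (nat \<Rightarrow> real) \<Rightarrow> (nat \<Rightarrow> real) \<Rightarrow> real set \<Rightarrow> real" where
  "S_bar \<mu> n pp pm X = Lim (at_right 0) (centered_D_sum \<mu> n pp pm X)"

end

theory Submission
  imports Defs "Jordan_Normal_Form.Schur_Decomposition"
begin

text \<open>
  The boundedness of $L$ makes the points of the process so scarce near the origin that the sum of
  logarithms converges absolutely, almost surely and in mean, and centering only subtracts a convergent
  expectation.

  Let $r(x)^2 = \int |L(x,y)|^2\,dy$. Since $L$ is skew, $(1+L)^{-1}$ is a contraction, and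
  $K_L = L - L(1+L)^{-1}L$ gives $|K_L(x,y) - L(x,y)| \le r(x)\,r(y)$ (lemma \<open>K_near_L\<close>). Together
  with $|L(x,y)| \le |A(x)A(y)|/(|x|+|y|)$ this yields $|K_L(x,y)| \le w(x)\,w(y)$ for the weight
  $w(x)^2 = A(x)^2/(2|x|) + r(x)^2$. The weight satisfies $\int |x|\,w(x)^2\,dx < \infty$: as
  $|x|\,|L(x,y)| \le |A(x)A(y)|$, the integral of $|x|\,r(x)^2$ is at most
  $\iint |A(x)|\,|L(x,y)|\,|A(y)|\,dx\,dy$, and this is finite because the kernel $|L|$ differs from
  $L$ only by multiplication with signs on either side and is therefore bounded too (lemmas
  \<open>abs_kernel_twist\<close>, \<open>row_moment\<close>, \<open>weight_moment\<close>).

  By Hadamard's determinant inequality the correlation integral over $D_1\times\dots\times D_k$ is at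
  most $k^{k/2}\prod_i \int_{D_i} w^2$. The case $k = 1$ bounds expectations of additive
  functionals by integrals against $w^2$ (\<open>campbell_bound\<close>). The growth $k^{k/2}$ is beaten by
  $k!$, so the number of points outside a neighbourhood of the origin, a set of finite
  $w^2$-mass, has all exponential moments (\<open>exponential_moment\<close>).

  Each logarithm is $O(|x|)$ apart from an integrable singularity, so its $w^2$-integral converges
  absolutely (\<open>log_ratio_integrable\<close>). Hence the sums over $|x| > \delta$ converge almost surely and in
  mean. The logarithms are bounded above and are negative for small $|x|$, so the exponential of the
  limit is at most a constant times $M^N$ with $N$ the number of points outside a fixed
  neighbourhood of the origin, which is integrable.

  Negativity near the origin also makes the truncated sums monotone in $\delta$. Therefore the limit
  over all real $\delta$ can be taken along a sequence for every configuration, which gives a Borel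
  function even where the limit does not exist (\<open>centered_sequentially\<close>).
\<close>

section \<open>Resolvents of skew integral operators\<close>

definition L2 :: "'a measure \<Rightarrow> ('a \<Rightarrow> complex) set" where
  "L2 M = {f \<in> borel_measurable M. integrable M (\<lambda>x. (cmod (f x))\<^sup>2)}"

definition sqnorm :: "'a measure \<Rightarrow> ('a \<Rightarrow> complex) \<Rightarrow> real" where
  "sqnorm M f = (LINT x|M. (cmod (f x))\<^sup>2)"

lemma L2_measurable: "f \<in> L2 M \<Longrightarrow> f \<in> borel_measurable M"
  by (simp add: L2_def)

lemma L2_integrable: "f \<in> L2 M \<Longrightarrow> integrable M (\<lambda>x. (cmod (f x))\<^sup>2)"
  by (simp add: L2_def)

lemma sqnorm_nonneg [simp]: "0 \<le> sqnorm M f"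
  by (simp add: sqnorm_def)

lemma nn_integral_L2:
  assumes "f \<in> L2 M"
  shows "(\<integral>\<^sup>+x. ennreal ((cmod (f x))\<^sup>2) \<partial>M) = ennreal (sqnorm M f)"
  unfolding sqnorm_def by (rule nn_integral_eq_integral[OF L2_integrable[OF assms]]) simp

lemma L2_I:
  assumes [measurable]: "f \<in> borel_measurable M"
    and "(\<integral>\<^sup>+x. ennreal ((cmod (f x))\<^sup>2) \<partial>M) \<le> ennreal c" "0 \<le> c"
  shows "f \<in> L2 M" "sqnorm M f \<le> c"
proof -
  have "(\<integral>\<^sup>+x. ennreal ((cmod (f x))\<^sup>2) \<partial>M) < \<infinity>"
    using assms(2) by (metis ennreal_less_top infinity_ennreal_def le_less_trans)
  then show f: "f \<in> L2 M"
    unfolding L2_def by (auto intro!: integrableI_nonneg)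
  show "sqnorm M f \<le> c"
    using assms(2,3) nn_integral_L2[OF f] by simp
qed

lemma L2_mono:
  assumes g: "g \<in> L2 M" and [measurable]: "f \<in> borel_measurable M"
    and le: "AE x in M. cmod (f x) \<le> cmod (g x)"
  shows "f \<in> L2 M" "sqnorm M f \<le> sqnorm M g"
proof -
  have "(\<integral>\<^sup>+x. ennreal ((cmod (f x))\<^sup>2) \<partial>M) \<le> (\<integral>\<^sup>+x. ennreal ((cmod (g x))\<^sup>2) \<partial>M)"
    by (rule nn_integral_mono_AE) (use le in eventually_elim, simp add: ennreal_leI power_mono)
  then have "(\<integral>\<^sup>+x. ennreal ((cmod (f x))\<^sup>2) \<partial>M) \<le> ennreal (sqnorm M g)"
    using nn_integral_L2[OF g] by simp
  from L2_I[OF _ this] show "f \<in> L2 M" "sqnorm M f \<le> sqnorm M g" by auto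
qed

lemma L2_cmult:
  assumes f: "f \<in> L2 M"
  shows "(\<lambda>x. c * f x) \<in> L2 M" "sqnorm M (\<lambda>x. c * f x) = (cmod c)\<^sup>2 * sqnorm M f"
  using f by (auto simp: L2_def sqnorm_def norm_mult power_mult_distrib)

lemma L2_prod_integrable:
  assumes f: "f \<in> L2 M" and g: "g \<in> L2 M"
  shows "integrable M (\<lambda>x. cmod (f x) * cmod (g x))"
proof -
  have [measurable]: "f \<in> borel_measurable M" "g \<in> borel_measurable M"
    using f g by (simp_all add: L2_def)
  have i: "integrable M (\<lambda>x. (cmod (f x))\<^sup>2 + (cmod (g x))\<^sup>2)"
    using L2_integrable[OF f] L2_integrable[OF g] by simp
  show ?thesis
  proof (rule Bochner_Integration.integrable_bound[OF i])
    have "cmod (f x) * cmod (g x) \<le> (cmod (f x))\<^sup>2 + (cmod (g x))\<^sup>2" for x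
    proof -
      have "0 \<le> cmod (f x) * cmod (g x)" by simp
      then show ?thesis using sum_squares_bound[of "cmod (f x)" "cmod (g x)"] by linarith
    qed
    then show "AE x in M. norm (cmod (f x) * cmod (g x)) \<le> norm ((cmod (f x))\<^sup>2 + (cmod (g x))\<^sup>2)"
      by simp
  qed simp
qed

lemma L2_add:
  assumes f: "f \<in> L2 M" and g: "g \<in> L2 M"
  shows "(\<lambda>x. f x + g x) \<in> L2 M"
proof -
  have [measurable]: "f \<in> borel_measurable M" "g \<in> borel_measurable M"
    using f g by (simp_all add: L2_def)
  have i: "integrable M (\<lambda>x. (cmod (f x))\<^sup>2 + 2 * (cmod (f x) * cmod (g x)) + (cmod (g x))\<^sup>2)"
    using L2_integrable[OF f] L2_integrable[OF g] L2_prod_integrable[OF f g] by simp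
  have "integrable M (\<lambda>x. (cmod (f x + g x))\<^sup>2)"
  proof (rule Bochner_Integration.integrable_bound[OF i])
    have "(cmod (f x + g x))\<^sup>2 \<le> (cmod (f x) + cmod (g x))\<^sup>2" for x
      by (intro power_mono norm_triangle_ineq) simp
    then have "(cmod (f x + g x))\<^sup>2 \<le> (cmod (f x))\<^sup>2 + 2 * (cmod (f x) * cmod (g x)) + (cmod (g x))\<^sup>2" for x
      by (simp add: power2_sum mult.assoc add.commute add.left_commute)
    then show "AE x in M. norm ((cmod (f x + g x))\<^sup>2)
        \<le> norm ((cmod (f x))\<^sup>2 + 2 * (cmod (f x) * cmod (g x)) + (cmod (g x))\<^sup>2)"
      by simp
  qed simp
  then show ?thesis by (simp add: L2_def)
qed


lemma L2_Cauchy_Schwarz: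
  assumes f: "f \<in> L2 M" and g: "g \<in> L2 M"
  shows "(LINT x|M. cmod (f x) * cmod (g x))\<^sup>2 \<le> sqnorm M f * sqnorm M g"
proof -
  define I where "I = (LINT x|M. cmod (f x) * cmod (g x))"
  define a where "a = sqnorm M f"
  define b where "b = sqnorm M g"
  note int = L2_integrable[OF f] L2_integrable[OF g] L2_prod_integrable[OF f g]
  have q: "0 \<le> a - 2 * s * I + s\<^sup>2 * b" for s :: real
  proof -
    have "0 \<le> (LINT x|M. (cmod (f x) - s * cmod (g x))\<^sup>2)" by simp
    also have "\<dots> = (LINT x|M. (cmod (f x))\<^sup>2 - 2 * s * (cmod (f x) * cmod (g x)) + s\<^sup>2 * (cmod (g x))\<^sup>2)"
      by (intro Bochner_Integration.integral_cong) (auto simp: power2_eq_square algebra_simps)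
    also have "\<dots> = a - 2 * s * I + s\<^sup>2 * b"
      using int by (simp add: a_def b_def I_def sqnorm_def)
    finally show ?thesis .
  qed
  have I0: "0 \<le> I" unfolding I_def by simp
  have b0: "0 \<le> b" unfolding b_def by simp
  have "I\<^sup>2 \<le> a * b"
  proof (cases "b = 0")
    case True
    have "I = 0"
    proof (rule ccontr)
      assume "I \<noteq> 0"
      with q[of "(a + 1) / (2 * I)"] True show False by simp
    qed
    then show ?thesis using True by simp
  next
    case False
    then have "b > 0" using b0 by simp
    moreover have "a - 2 * (I / b) * I + (I / b)\<^sup>2 * b = a - I\<^sup>2 / b"
      using False by (simp add: power2_eq_square field_simps)
    ultimately have "I\<^sup>2 / b \<le> a" using q[of "I / b"] by simp
    then show ?thesis using \<open>b > 0\<close> by (simp add: pos_divide_le_eq)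
  qed
  then show ?thesis by (simp add: I_def a_def b_def)
qed

lemma L2_Cauchy_Schwarz_complex:
  assumes f: "f \<in> L2 M" and g: "g \<in> L2 M"
  shows "integrable M (\<lambda>x. f x * g x)"
    "cmod (LINT x|M. f x * g x) \<le> sqrt (sqnorm M f) * sqrt (sqnorm M g)"
proof -
  have [measurable]: "f \<in> borel_measurable M" "g \<in> borel_measurable M"
    using f g by (simp_all add: L2_def)
  show "integrable M (\<lambda>x. f x * g x)"
    by (rule Bochner_Integration.integrable_bound[OF L2_prod_integrable[OF f g]])
       (auto simp: norm_mult)
  have "cmod (LINT x|M. f x * g x) \<le> (LINT x|M. cmod (f x * g x))"
    by (rule integral_norm_bound)
  also have "\<dots> = (LINT x|M. cmod (f x) * cmod (g x))"
    by (simp add: norm_mult)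
  also have "\<dots> \<le> sqrt (sqnorm M f * sqnorm M g)"
    by (rule real_le_rsqrt[OF L2_Cauchy_Schwarz[OF f g]])
  finally show "cmod (LINT x|M. f x * g x) \<le> sqrt (sqnorm M f) * sqrt (sqnorm M g)"
    by (simp add: real_sqrt_mult)
qed

lemma L2_cnj:
  assumes f: "f \<in> L2 M"
  shows "(\<lambda>x. cnj (f x)) \<in> L2 M"
proof -
  have "(\<lambda>x. cnj (f x)) \<in> borel_measurable M"
    by (rule measurable_compose[OF L2_measurable[OF f]])
       (intro borel_measurable_continuous_onI continuous_intros)
  then show ?thesis using f by (simp add: L2_def)
qed

lemma indicator_L2:
  assumes B: "B \<in> sets M" "emeasure M B < \<infinity>"
  shows "(indicator B :: 'a \<Rightarrow> complex) \<in> L2 M"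
proof -
  have "(\<lambda>x. (cmod (indicator B x))\<^sup>2) = indicat_real B"
    by (auto simp: indicator_def)
  then show ?thesis using B by (simp add: L2_def integrable_indicator_iff)
qed

text \<open>
  A skew-Hermitian kernel all of whose rows are square-integrable, so that \<open>T f\<close> is defined at every
  point. The bound is imposed on the absolute value of the kernel: it makes the quadratic form
  absolutely integrable, which the bound on \<open>T\<close> alone would not.
\<close>

locale skew_kernel = sigma_finite_measure M for M :: "'a measure" +
  fixes k :: "'a \<Rightarrow> 'a \<Rightarrow> complex" and C :: real
  assumes k_measurable [measurable]: "(\<lambda>(x, y). k x y) \<in> borel_measurable (M \<Otimes>\<^sub>M M)"
    and k_skew: "\<And>x y. x \<in> space M \<Longrightarrow> y \<in> space M \<Longrightarrow> k y x = - cnj (k x y)"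
    and k_row: "\<And>x. x \<in> space M \<Longrightarrow> k x \<in> L2 M"
    and abs_L2: "\<And>f. f \<in> L2 M \<Longrightarrow>
      (\<lambda>x. complex_of_real (LINT y|M. cmod (k x y) * cmod (f y))) \<in> L2 M"
    and abs_bound: "\<And>f. f \<in> L2 M \<Longrightarrow>
      sqnorm M (\<lambda>x. complex_of_real (LINT y|M. cmod (k x y) * cmod (f y))) \<le> C * sqnorm M f"
begin

definition T :: "('a \<Rightarrow> complex) \<Rightarrow> 'a \<Rightarrow> complex" where
  "T f x = (LINT y|M. k x y * f y)"

definition row :: "'a \<Rightarrow> real" where
  "row x = sqrt (sqnorm M (k x))"

lemma row_nonneg: "0 \<le> row x"
  by (simp add: row_def)

lemma T_bound:
  assumes "f \<in> L2 M" "x \<in> space M"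
  shows "cmod (T f x) \<le> row x * sqrt (sqnorm M f)"
  unfolding T_def row_def by (rule L2_Cauchy_Schwarz_complex(2)[OF k_row[OF assms(2)] assms(1)])

lemma k_integrable:
  assumes "f \<in> L2 M" "x \<in> space M"
  shows "integrable M (\<lambda>y. k x y * f y)"
  by (rule L2_Cauchy_Schwarz_complex(1)[OF k_row[OF assms(2)] assms(1)])

lemma T_measurable [measurable]:
  assumes f: "f \<in> borel_measurable M"
  shows "T f \<in> borel_measurable M"
proof -
  have "(\<lambda>p. f (snd p)) \<in> borel_measurable (M \<Otimes>\<^sub>M M)"
    by (rule measurable_compose[OF measurable_snd f])
  from borel_measurable_times[OF k_measurable this]
  have "(\<lambda>(x, y). k x y * f y) \<in> borel_measurable (M \<Otimes>\<^sub>M M)"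
    by (simp add: case_prod_unfold)
  then show ?thesis unfolding T_def by (rule borel_measurable_lebesgue_integral)
qed

lemma T_cong_AE:
  assumes fg: "AE x in M. f x = g x" "f \<in> borel_measurable M" "g \<in> borel_measurable M"
    and x: "x \<in> space M"
  shows "T f x = T g x"
proof -
  have [measurable]: "k x \<in> borel_measurable M" using k_row[OF x] by (simp add: L2_def)
  note [measurable] = fg(2,3)
  show ?thesis unfolding T_def
  proof (rule integral_cong_AE)
    show "AE y in M. k x y * f y = k x y * g y"
      using fg(1) by eventually_elim simp
  qed simp_all
qed

lemma T_L2:
  assumes f: "f \<in> L2 M"
  shows "T f \<in> L2 M" "sqnorm M (T f) \<le> C * sqnorm M f"
proof -
  have [measurable]: "f \<in> borel_measurable M" using f by (simp add: L2_def)
  have "cmod (T f x) \<le> cmod (complex_of_real (LINT y|M. cmod (k x y) * cmod (f y)))" for x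
    unfolding T_def using integral_norm_bound[of M "\<lambda>y. k x y * f y"] by (simp add: norm_mult)
  then have le: "AE x in M. cmod (T f x) \<le> cmod (complex_of_real (LINT y|M. cmod (k x y) * cmod (f y)))"
    by (intro always_eventually) blast
  note * = L2_mono[OF abs_L2[OF f] _ le]
  show "T f \<in> L2 M" by (rule *) simp
  show "sqnorm M (T f) \<le> C * sqnorm M f"
    by (rule order_trans[OF *(2) abs_bound[OF f]]) simp
qed

lemma T_add:
  assumes "f \<in> L2 M" "g \<in> L2 M" "x \<in> space M"
  shows "T (\<lambda>x. f x + g x) x = T f x + T g x"
  using Bochner_Integration.integral_add[OF k_integrable[OF assms(1,3)] k_integrable[OF assms(2,3)]]
  by (simp only: T_def distrib_left)

lemma T_cmult: "T (\<lambda>x. c * f x) x = c * T f x"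
proof -
  have "T (\<lambda>x. c * f x) x = (LINT y|M. c * (k x y * f y))"
    unfolding T_def by (rule Bochner_Integration.integral_cong) (rule refl, rule mult.left_commute)
  also have "\<dots> = c * T f x" unfolding T_def by (rule integral_mult_right_zero)
  finally show ?thesis .
qed

lemma form_integrable:
  assumes f: "f \<in> L2 M"
  shows "integrable (M \<Otimes>\<^sub>M M) (\<lambda>(x, y). k x y * f y * cnj (f x))"
proof -
  have [measurable]: "f \<in> borel_measurable M" using f by (simp add: L2_def)
  interpret P: pair_sigma_finite M M ..
  define G where "G x = complex_of_real (LINT y|M. cmod (k x y) * cmod (f y))" for x
  have G: "G \<in> L2 M" unfolding G_def by (rule abs_L2[OF f])
  have GG: "integrable M (\<lambda>x. cmod (f x) * cmod (G x))"
    by (rule L2_prod_integrable[OF f G])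
  show ?thesis
  proof (rule P.Fubini_integrable)
    show "AE x in M. integrable M (\<lambda>y. case (x, y) of (x, y) \<Rightarrow> k x y * f y * cnj (f x))"
      using k_integrable[OF f] by (intro AE_I2) (auto intro!: integrable_mult_left)
    have "(LINT y|M. norm (k x y * f y * cnj (f x))) = cmod (f x) * cmod (G x)" for x
    proof -
      have "(LINT y|M. norm (k x y * f y * cnj (f x))) = (LINT y|M. cmod (f x) * (cmod (k x y) * cmod (f y)))"
        by (intro Bochner_Integration.integral_cong) (auto simp: norm_mult)
      also have "\<dots> = cmod (f x) * (LINT y|M. cmod (k x y) * cmod (f y))" by simp
      finally show ?thesis by (simp add: G_def)
    qed
    then show "integrable M (\<lambda>x. LINT y|M. norm (case (x, y) of (x, y) \<Rightarrow> k x y * f y * cnj (f x)))"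
      using GG by simp
    have "(\<lambda>p. f (snd p)) \<in> borel_measurable (M \<Otimes>\<^sub>M M)"
      "(\<lambda>p. cnj (f (fst p))) \<in> borel_measurable (M \<Otimes>\<^sub>M M)"
      by (rule measurable_compose[OF measurable_snd L2_measurable[OF f]],
          rule measurable_compose[OF measurable_fst L2_measurable[OF L2_cnj[OF f]]])
    from borel_measurable_times[OF borel_measurable_times[OF k_measurable this(1)] this(2)]
    show "(\<lambda>(x, y). k x y * f y * cnj (f x)) \<in> borel_measurable (M \<Otimes>\<^sub>M M)"
      by (simp add: case_prod_unfold)
  qed
qed

text \<open>
  Exchanging the two variables in the double integral turns the quadratic form into minus its
  conjugate.
\<close>

lemma form_skew:
  assumes f: "f \<in> L2 M"
  shows "integrable M (\<lambda>x. T f x * cnj (f x))" "Re (LINT x|M. T f x * cnj (f x)) = 0"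
proof -
  have [measurable]: "f \<in> borel_measurable M" using f by (simp add: L2_def)
  interpret P: pair_sigma_finite M M ..
  from L2_Cauchy_Schwarz_complex(1)[OF T_L2(1)[OF f] L2_cnj[OF f]]
  show int: "integrable M (\<lambda>x. T f x * cnj (f x))" .
  have int2: "integrable (M \<Otimes>\<^sub>M M) (\<lambda>(x, y). k x y * f y * cnj (f x))"
    by (rule form_integrable[OF f])
  have 1: "(LINT x|M. T f x * cnj (f x)) = (LINT x|M. LINT y|M. k x y * f y * cnj (f x))"
    unfolding T_def by (intro Bochner_Integration.integral_cong) auto
  also have "\<dots> = (LINT y|M. LINT x|M. k x y * f y * cnj (f x))"
    using P.Fubini_integral[OF int2] by simp
  also have "\<dots> = (LINT y|M. LINT x|M. - cnj (k y x * f x * cnj (f y)))"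
  proof (intro Bochner_Integration.integral_cong refl)
    fix y x assume "y \<in> space M" "x \<in> space M"
    then show "k x y * f y * cnj (f x) = - cnj (k y x * f x * cnj (f y))"
      using k_skew[of x y] by simp
  qed
  also have "\<dots> = - cnj (LINT y|M. LINT x|M. k y x * f x * cnj (f y))"
    by (simp only: Bochner_Integration.integral_minus Bochner_Integration.integral_cnj)
  also have "(LINT y|M. LINT x|M. k y x * f x * cnj (f y)) = (LINT x|M. T f x * cnj (f x))"
    by (rule 1[symmetric])
  finally have "(LINT x|M. T f x * cnj (f x)) = - cnj (LINT x|M. T f x * cnj (f x))" .
  moreover have "z = - cnj z \<Longrightarrow> Re z = 0" for z
    by (cases z) (auto simp: complex_eq_iff)
  ultimately show "Re (LINT x|M. T f x * cnj (f x)) = 0" by blast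
qed

text \<open>
  By \<open>form_skew\<close> the cross term vanishes. With \<open>a = b = 1\<close> this makes $(1+T)^{-1}$ a contraction.
\<close>

lemma pythagoras:
  assumes f: "f \<in> L2 M"
  shows "sqnorm M (\<lambda>x. complex_of_real a * f x + complex_of_real b * T f x)
    = a\<^sup>2 * sqnorm M f + b\<^sup>2 * sqnorm M (T f)"
proof -
  note int = L2_integrable[OF f] L2_integrable[OF T_L2(1)[OF f]] form_skew(1)[OF f]
  have eq: "(cmod (complex_of_real a * u + complex_of_real b * v))\<^sup>2
    = a\<^sup>2 * (cmod u)\<^sup>2 + b\<^sup>2 * (cmod v)\<^sup>2 + 2 * a * b * Re (v * cnj u)" for u v
    by (simp add: cmod_power2) (simp add: power2_eq_square algebra_simps)
  have "sqnorm M (\<lambda>x. complex_of_real a * f x + complex_of_real b * T f x)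
    = a\<^sup>2 * sqnorm M f + b\<^sup>2 * sqnorm M (T f) + 2 * a * b * (LINT x|M. Re (T f x * cnj (f x)))"
  proof -
    have "integrable M (\<lambda>x. Re (T f x * cnj (f x)))" using int(3) by (rule integrable_Re)
    then show ?thesis unfolding sqnorm_def eq using int(1,2)
      by (simp del: times_complex.sel complex_cnj)
  qed
  also have "(LINT x|M. Re (T f x * cnj (f x))) = 0"
    using integral_Re[OF int(3)] form_skew(2)[OF f] by simp
  finally show ?thesis by simp
qed

lemma resolvent_contraction:
  assumes f: "f \<in> L2 M" and sol: "AE x in M. f x = g x + T g x" and g: "g \<in> L2 M"
  shows "sqnorm M g \<le> sqnorm M f"
proof -
  have "sqnorm M f = sqnorm M (\<lambda>x. complex_of_real 1 * g x + complex_of_real 1 * T g x)"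
    unfolding sqnorm_def
  proof (rule integral_cong_AE)
    show "(\<lambda>x. (cmod (f x))\<^sup>2) \<in> borel_measurable M"
      using L2_integrable[OF f] by simp
    show "(\<lambda>x. (cmod (complex_of_real 1 * g x + complex_of_real 1 * T g x))\<^sup>2) \<in> borel_measurable M"
      using L2_integrable[OF L2_add[OF g T_L2(1)[OF g]]] by simp
    show "AE x in M. (cmod (f x))\<^sup>2 = (cmod (complex_of_real 1 * g x + complex_of_real 1 * T g x))\<^sup>2"
      using sol by eventually_elim simp
  qed
  also have "\<dots> = sqnorm M g + sqnorm M (T g)"
    unfolding pythagoras[OF g] by simp
  finally show ?thesis by simp
qed

text \<open>
  If $f = (1+T)g$ then $Tf = (1+T)Tg$, so $\|Tg\| \le \|Tf\|$, while $Tf - Tg = T(Tg)$ is controlled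
  pointwise by the row norm.
\<close>

lemma resolvent_kernel_bound:
  assumes f: "f \<in> L2 M" and sol: "AE x in M. f x = g x + T g x" and g: "g \<in> L2 M"
    and x: "x \<in> space M"
  shows "cmod (T g x - T f x) \<le> row x * sqrt (sqnorm M (T f))"
proof -
  note Tg = T_L2(1)[OF g]
  \<comment> \<open>Under the integral sign the equation for \<open>g\<close> is only needed almost everywhere.\<close>
  have Tf: "T f z = T g z + T (T g) z" if "z \<in> space M" for z
    using T_cong_AE[OF sol L2_measurable[OF f] L2_measurable[OF L2_add[OF g Tg]] that]
      T_add[OF g Tg that] by simp
  have "sqnorm M (T g) \<le> sqnorm M (T f)"
    by (rule resolvent_contraction[OF T_L2(1)[OF f] _ Tg]) (auto intro: AE_I2 Tf)
  then have "row x * sqrt (sqnorm M (T g)) \<le> row x * sqrt (sqnorm M (T f))"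
    by (intro mult_left_mono row_nonneg) simp
  moreover have "cmod (T g x - T f x) = cmod (T (T g) x)"
    by (simp add: Tf[OF x])
  ultimately show ?thesis using T_bound[OF Tg x] by simp
qed

text \<open>
  The Cauchy-Schwarz inequality in the integral over \<open>B\<close>, followed by Fubini; by skewness the columns
  of the kernel have the same norms as its rows.
\<close>

lemma T_indicator_bound:
  assumes B: "B \<in> sets M" "emeasure M B < \<infinity>"
    and H: "\<And>y. y \<in> B \<Longrightarrow> row y \<le> H"
  shows "sqnorm M (T (indicator B)) \<le> (measure M B * H)\<^sup>2"
proof -
  interpret P: pair_sigma_finite M M ..
  have meas: "(\<lambda>p. k (fst p) (snd p)) \<in> borel_measurable (M \<Otimes>\<^sub>M M)"
    using k_measurable by (simp add: case_prod_unfold)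
  note [measurable] = meas B(1)
  have ind: "(indicator B :: 'a \<Rightarrow> complex) \<in> L2 M"
    by (rule indicator_L2[OF B])
  have sqB: "sqnorm M (indicator B :: 'a \<Rightarrow> complex) = measure M B"
  proof -
    have "sqnorm M (indicator B :: 'a \<Rightarrow> complex) = (LINT x|M. indicator B x)"
      unfolding sqnorm_def by (intro Bochner_Integration.integral_cong) (auto simp: indicator_def)
    then show ?thesis using B sets.sets_into_space[OF B(1)] by (simp add: Int_absorb2)
  qed
  have pt: "ennreal ((cmod (T (indicator B) x))\<^sup>2)
      \<le> ennreal (measure M B) * (\<integral>\<^sup>+y. indicator B y * ennreal ((cmod (k x y))\<^sup>2) \<partial>M)"
    if x: "x \<in> space M" for x
  proof -
    have kx: "k x \<in> L2 M" by (rule k_row[OF x])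
    note [measurable] = L2_measurable[OF kx]
    have kB: "(\<lambda>y. k x y * indicator B y) \<in> L2 M"
      by (rule L2_mono[OF kx]) (auto simp: norm_mult indicator_def)
    have "T (indicator B) x = (LINT y|M. (k x y * indicator B y) * indicator B y)"
      unfolding T_def by (intro Bochner_Integration.integral_cong) (auto simp: indicator_def)
    then have "cmod (T (indicator B) x)
        \<le> sqrt (sqnorm M (\<lambda>y. k x y * indicator B y)) * sqrt (measure M B)"
      using L2_Cauchy_Schwarz_complex(2)[OF kB ind] sqB by simp
    then have "(cmod (T (indicator B) x))\<^sup>2
        \<le> (sqrt (sqnorm M (\<lambda>y. k x y * indicator B y)) * sqrt (measure M B))\<^sup>2"
      by (intro power_mono) auto
    also have "\<dots> = measure M B * sqnorm M (\<lambda>y. k x y * indicator B y)"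
      by (simp add: power_mult_distrib)
    finally have "ennreal ((cmod (T (indicator B) x))\<^sup>2)
        \<le> ennreal (measure M B) * ennreal (sqnorm M (\<lambda>y. k x y * indicator B y))"
      by (simp add: ennreal_mult[symmetric] ennreal_leI)
    also have "ennreal (sqnorm M (\<lambda>y. k x y * indicator B y))
        = (\<integral>\<^sup>+y. indicator B y * ennreal ((cmod (k x y))\<^sup>2) \<partial>M)"
      unfolding nn_integral_L2[OF kB, symmetric]
      by (intro nn_integral_cong) (auto simp: indicator_def)
    finally show ?thesis .
  qed
  have "(\<integral>\<^sup>+x. (\<integral>\<^sup>+y. indicator B y * ennreal ((cmod (k x y))\<^sup>2) \<partial>M) \<partial>M)
      = (\<integral>\<^sup>+y. (\<integral>\<^sup>+x. indicator B y * ennreal ((cmod (k x y))\<^sup>2) \<partial>M) \<partial>M)"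
    by (rule P.Fubini'[symmetric]) measurable
  also have "\<dots> \<le> (\<integral>\<^sup>+y. ennreal (H\<^sup>2) * indicator B y \<partial>M)"
  proof (rule nn_integral_mono)
    fix y assume y: "y \<in> space M"
    show "(\<integral>\<^sup>+x. indicator B y * ennreal ((cmod (k x y))\<^sup>2) \<partial>M) \<le> ennreal (H\<^sup>2) * indicator B y"
    proof (cases "y \<in> B")
      case True
      have "(\<integral>\<^sup>+x. indicator B y * ennreal ((cmod (k x y))\<^sup>2) \<partial>M) = (\<integral>\<^sup>+x. ennreal ((cmod (k y x))\<^sup>2) \<partial>M)"
        using True k_skew[OF _ y] by (intro nn_integral_cong) (simp add: k_skew[OF _ y] y)
      also have "\<dots> = ennreal ((row y)\<^sup>2)"
        using nn_integral_L2[OF k_row[OF y]] by (simp add: row_def)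
      also have "\<dots> \<le> ennreal (H\<^sup>2)"
        by (intro ennreal_leI power_mono H True row_nonneg)
      finally show ?thesis using True by simp
    qed simp
  qed
  also have "(\<integral>\<^sup>+y. ennreal (H\<^sup>2) * indicator B y \<partial>M) = ennreal (H\<^sup>2) * ennreal (measure M B)"
    using B by (simp add: nn_integral_cmult_indicator emeasure_eq_ennreal_measure)
  finally have J: "(\<integral>\<^sup>+x. (\<integral>\<^sup>+y. indicator B y * ennreal ((cmod (k x y))\<^sup>2) \<partial>M) \<partial>M)
      \<le> ennreal (H\<^sup>2) * ennreal (measure M B)" .
  have "(\<integral>\<^sup>+x. ennreal ((cmod (T (indicator B) x))\<^sup>2) \<partial>M)
      \<le> (\<integral>\<^sup>+x. ennreal (measure M B) * (\<integral>\<^sup>+y. indicator B y * ennreal ((cmod (k x y))\<^sup>2) \<partial>M) \<partial>M)"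
    by (intro nn_integral_mono pt)
  also have "\<dots> = ennreal (measure M B) * (\<integral>\<^sup>+x. (\<integral>\<^sup>+y. indicator B y * ennreal ((cmod (k x y))\<^sup>2) \<partial>M) \<partial>M)"
    by (intro nn_integral_cmult) measurable
  also have "\<dots> \<le> ennreal (measure M B) * (ennreal (H\<^sup>2) * ennreal (measure M B))"
    by (rule mult_left_mono[OF J]) simp
  also have "\<dots> = ennreal (measure M B * (H\<^sup>2 * measure M B))"
    by (simp add: ennreal_mult)
  also have "measure M B * (H\<^sup>2 * measure M B) = (measure M B * H)\<^sup>2"
    by (simp add: power2_eq_square)
  finally have "(\<integral>\<^sup>+x. ennreal ((cmod (T (indicator B) x))\<^sup>2) \<partial>M) \<le> ennreal ((measure M B * H)\<^sup>2)" .
  from L2_I(2)[OF T_measurable[OF L2_measurable[OF ind]] this] show ?thesis by simp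
qed

text \<open>
  The Neumann series of $(1+T)^{-1}$ converges only for small \<open>T\<close>. The damped iteration
  $u \mapsto u - t(u + Tu)$ contracts for every bounded skew \<open>T\<close>: by \<open>pythagoras\<close> its squared norm is at
  most $(1-t)^2 + t^2c$, which for $t = 1/(1+c)$ equals $c/(1+c) < 1$. The iterates sum to a solution.
\<close>

lemma resolvent_exists:
  assumes f: "f \<in> L2 M"
  shows "\<exists>g\<in>L2 M. AE x in M. g x + T g x = f x"
proof -
  define c where "c = max 0 C"
  define t where "t = 1 / (1 + c)"
  define q where "q = c / (1 + c)"
  \<comment> \<open>\<open>r\<close> lies strictly above \<open>sqrt q\<close>, so that it is positive even if \<open>q = 0\<close> and may be divided by.\<close>
  define r where "r = sqrt ((1 + q) / 2)"
  have c: "0 \<le> c" by (simp add: c_def)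
  have q: "0 \<le> q" "q < 1" using c by (auto simp: q_def)
  have r2: "r\<^sup>2 = (1 + q) / 2" using q by (simp add: r_def)
  have r: "0 < r" "r < 1" "q \<le> r\<^sup>2" using q unfolding r2 by (auto simp: r_def)
  have t: "0 < t" "t * (1 + c) = 1" using c by (auto simp: t_def)
  define S where "S u x = complex_of_real (1 - t) * u x + complex_of_real (- t) * T u x" for u x
  have S: "S u \<in> L2 M" "sqnorm M (S u) \<le> r\<^sup>2 * sqnorm M u" if u: "u \<in> L2 M" for u
  proof -
    show "S u \<in> L2 M" unfolding S_def by (intro L2_add L2_cmult u T_L2(1))
    have "sqnorm M (S u) = (1 - t)\<^sup>2 * sqnorm M u + t\<^sup>2 * sqnorm M (T u)"
      unfolding S_def pythagoras[OF u] by simp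
    also have "sqnorm M (T u) \<le> c * sqnorm M u"
      by (rule order_trans[OF T_L2(2)[OF u]]) (simp add: c_def mult_right_mono)
    also have "(1 - t)\<^sup>2 * sqnorm M u + t\<^sup>2 * (c * sqnorm M u) = ((1 - t)\<^sup>2 + t\<^sup>2 * c) * sqnorm M u"
      by (simp add: algebra_simps)
    also have "(1 - t)\<^sup>2 + t\<^sup>2 * c = q"
    proof -
      have "(1 - t)\<^sup>2 + t\<^sup>2 * c = 1 - 2 * t + t * (t * (1 + c))"
        by (simp add: power2_eq_square algebra_simps)
      also have "\<dots> = 1 - t" using t(2) by simp
      also have "\<dots> = q" using c by (simp add: t_def q_def field_simps)
      finally show ?thesis .
    qed
    also have "q * sqnorm M u \<le> r\<^sup>2 * sqnorm M u" by (intro mult_right_mono r) simp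
    finally show "sqnorm M (S u) \<le> r\<^sup>2 * sqnorm M u" by (simp add: mult_left_mono)
  qed
  define u where "u n = (S ^^ n) f" for n
  have u0: "u 0 = f" and uS: "u (Suc n) = S (u n)" for n by (simp_all add: u_def)
  have u: "u n \<in> L2 M" and un: "sqnorm M (u n) \<le> (r\<^sup>2) ^ n * sqnorm M f" for n
  proof (induction n)
    case 0 show "u 0 \<in> L2 M" "sqnorm M (u 0) \<le> (r\<^sup>2) ^ 0 * sqnorm M f" using f by (simp_all add: u0)
  next
    case (Suc n)
    show "u (Suc n) \<in> L2 M" using S(1)[OF Suc(1)] by (simp add: uS)
    have "sqnorm M (u (Suc n)) \<le> r\<^sup>2 * sqnorm M (u n)" using S(2)[OF Suc(1)] by (simp add: uS)
    also have "\<dots> \<le> r\<^sup>2 * ((r\<^sup>2) ^ n * sqnorm M f)" by (intro mult_left_mono Suc) simp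
    finally show "sqnorm M (u (Suc n)) \<le> (r\<^sup>2) ^ Suc n * sqnorm M f" by (simp add: mult.assoc)
  qed
  note [measurable] = L2_measurable[OF u] L2_measurable[OF f]
  \<comment> \<open>Weighting by \<open>r ^ n\<close> turns summability of norms into a.e. summability of values by the
    Cauchy-Schwarz inequality, which takes the place of completeness of \<open>L2\<close>.\<close>
  define E where "E x = (\<Sum>n. ennreal ((cmod (u n x))\<^sup>2 / r ^ n))" for x
  have [measurable]: "E \<in> borel_measurable M" unfolding E_def by measurable
  have E_int: "(\<integral>\<^sup>+x. E x \<partial>M) \<le> ennreal (sqnorm M f / (1 - r))"
  proof -
    have "(\<integral>\<^sup>+x. E x \<partial>M) = (\<Sum>n. \<integral>\<^sup>+x. ennreal ((cmod (u n x))\<^sup>2 / r ^ n) \<partial>M)"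
      unfolding E_def by (intro nn_integral_suminf) measurable
    also have "\<dots> \<le> (\<Sum>n. ennreal (sqnorm M f * r ^ n))"
    proof (intro suminf_le summableI)
      fix n
      have "(\<integral>\<^sup>+x. ennreal ((cmod (u n x))\<^sup>2 / r ^ n) \<partial>M)
          = (\<integral>\<^sup>+x. ennreal (1 / r ^ n) * ennreal ((cmod (u n x))\<^sup>2) \<partial>M)"
        using r by (intro nn_integral_cong) (simp add: ennreal_mult[symmetric])
      also have "\<dots> = ennreal (1 / r ^ n) * ennreal (sqnorm M (u n))"
        by (subst nn_integral_cmult) (simp_all add: nn_integral_L2[OF u])
      also have "\<dots> = ennreal (sqnorm M (u n) / r ^ n)"
        using r by (simp add: ennreal_mult[symmetric])
      also have "\<dots> \<le> ennreal (sqnorm M f * r ^ n)"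
      proof (rule ennreal_leI)
        have "sqnorm M (u n) / r ^ n \<le> (r\<^sup>2) ^ n * sqnorm M f / r ^ n"
          using un r by (intro divide_right_mono) auto
        also have "\<dots> = sqnorm M f * r ^ n"
          using r by (simp add: power2_eq_square power_mult_distrib)
        finally show "sqnorm M (u n) / r ^ n \<le> sqnorm M f * r ^ n" .
      qed
      finally show "(\<integral>\<^sup>+x. ennreal ((cmod (u n x))\<^sup>2 / r ^ n) \<partial>M) \<le> ennreal (sqnorm M f * r ^ n)" .
    qed
    also have "\<dots> = ennreal (sqnorm M f / (1 - r))"
    proof -
      have "(\<lambda>n. sqnorm M f * r ^ n) sums (sqnorm M f * (1 / (1 - r)))"
        using r by (intro sums_mult geometric_sums) simp
      then show ?thesis using r by (intro suminf_ennreal_eq) auto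
    qed
    finally show ?thesis .
  qed
  have "AE x in M. E x \<noteq> \<infinity>"
    by (rule nn_integral_noteq_infinite) (use E_int in \<open>auto simp: top_unique\<close>)
  then have fin: "AE x in M. E x < \<infinity>" by eventually_elim (simp add: less_top)
  have summ: "summable (\<lambda>n. (cmod (u n x))\<^sup>2 / r ^ n)" if "E x < \<infinity>" for x
    by (rule summable_suminf_not_top) (use that r in \<open>auto simp: E_def\<close>)
  have summ1: "summable (\<lambda>n. cmod (u n x))" if "E x < \<infinity>" for x
  proof (rule summable_comparison_test)
    show "summable (\<lambda>n. (cmod (u n x))\<^sup>2 / r ^ n + r ^ n)"
      using r by (intro summable_add summ[OF that] summable_geometric) simp
    have "cmod (u n x) \<le> (cmod (u n x))\<^sup>2 / r ^ n + r ^ n" for n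
    proof -
      have p: "0 < r ^ n" using r by simp
      have "2 * cmod (u n x) * r ^ n \<le> (cmod (u n x))\<^sup>2 + (r ^ n)\<^sup>2" by (rule sum_squares_bound)
      moreover have "0 \<le> cmod (u n x) * r ^ n" using p by simp
      ultimately have "cmod (u n x) * r ^ n \<le> (cmod (u n x))\<^sup>2 + (r ^ n)\<^sup>2" by linarith
      then have "cmod (u n x) \<le> ((cmod (u n x))\<^sup>2 + (r ^ n)\<^sup>2) / r ^ n"
        using p by (simp add: pos_le_divide_eq)
      also have "\<dots> = (cmod (u n x))\<^sup>2 / r ^ n + r ^ n"
        using p by (simp add: add_divide_distrib power2_eq_square)
      finally show ?thesis .
    qed
    then show "\<exists>N. \<forall>n\<ge>N. norm (cmod (u n x)) \<le> (cmod (u n x))\<^sup>2 / r ^ n + r ^ n" by simp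
  qed
  define g where "g x = (\<Sum>n. complex_of_real t * u n x)" for x
  have g_meas [measurable]: "g \<in> borel_measurable M" unfolding g_def by measurable
  have g_le: "ennreal ((cmod (g x))\<^sup>2) \<le> ennreal (t\<^sup>2 / (1 - r)) * E x" if fx: "E x < \<infinity>" for x
  proof -
    have s1: "summable (\<lambda>n. complex_of_real t * u n x)"
      by (intro summable_mult summable_norm_cancel[OF summ1[OF fx]])
    have part: "(cmod (\<Sum>n<N. complex_of_real t * u n x))\<^sup>2
        \<le> t\<^sup>2 / (1 - r) * (\<Sum>n. (cmod (u n x))\<^sup>2 / r ^ n)" for N
    proof -
      have "cmod (\<Sum>n<N. complex_of_real t * u n x) \<le> (\<Sum>n<N. t * cmod (u n x))"
        using t by (intro order_trans[OF norm_sum]) (simp add: norm_mult)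
      also have "\<dots> = t * (\<Sum>n<N. sqrt (r ^ n) * (cmod (u n x) / sqrt (r ^ n)))"
        using r by (simp add: sum_distrib_left)
      finally have "(cmod (\<Sum>n<N. complex_of_real t * u n x))\<^sup>2
          \<le> (t * (\<Sum>n<N. sqrt (r ^ n) * (cmod (u n x) / sqrt (r ^ n))))\<^sup>2"
        by (intro power_mono) auto
      also have "\<dots> = t\<^sup>2 * (\<Sum>n<N. sqrt (r ^ n) * (cmod (u n x) / sqrt (r ^ n)))\<^sup>2"
        by (rule power_mult_distrib)
      also have "\<dots> \<le> t\<^sup>2 * ((\<Sum>n<N. (sqrt (r ^ n))\<^sup>2) * (\<Sum>n<N. (cmod (u n x) / sqrt (r ^ n))\<^sup>2))"
        by (intro mult_left_mono Cauchy_Schwarz_ineq_sum) simp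
      also have "\<dots> = t\<^sup>2 * ((\<Sum>n<N. r ^ n) * (\<Sum>n<N. (cmod (u n x))\<^sup>2 / r ^ n))"
        using r by (simp add: power_divide)
      also have "\<dots> \<le> t\<^sup>2 * (1 / (1 - r) * (\<Sum>n. (cmod (u n x))\<^sup>2 / r ^ n))"
      proof (intro mult_left_mono mult_mono)
        show "(\<Sum>n<N. r ^ n) \<le> 1 / (1 - r)"
          using r sum_le_suminf[OF summable_geometric, of r "{..<N}"] suminf_geometric[of r] by simp
        show "(\<Sum>n<N. (cmod (u n x))\<^sup>2 / r ^ n) \<le> (\<Sum>n. (cmod (u n x))\<^sup>2 / r ^ n)"
          using r by (intro sum_le_suminf summ[OF fx]) auto
      qed (use r in \<open>auto intro!: sum_nonneg\<close>)
      finally show ?thesis by simp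
    qed
    have "(cmod (g x))\<^sup>2 \<le> t\<^sup>2 / (1 - r) * (\<Sum>n. (cmod (u n x))\<^sup>2 / r ^ n)"
    proof (rule LIMSEQ_le_const2)
      show "(\<lambda>N. (cmod (\<Sum>n<N. complex_of_real t * u n x))\<^sup>2) \<longlonglongrightarrow> (cmod (g x))\<^sup>2"
        unfolding g_def by (intro tendsto_intros summable_LIMSEQ s1)
    qed (use part in blast)
    moreover have "E x = ennreal (\<Sum>n. (cmod (u n x))\<^sup>2 / r ^ n)"
      unfolding E_def using r by (intro suminf_ennreal2 summ[OF fx]) auto
    ultimately show ?thesis
      using r by (simp add: ennreal_mult'[symmetric] ennreal_leI)
  qed
  have g: "g \<in> L2 M"
  proof (rule L2_I(1)[OF g_meas])
    have "(\<integral>\<^sup>+x. ennreal ((cmod (g x))\<^sup>2) \<partial>M) \<le> (\<integral>\<^sup>+x. ennreal (t\<^sup>2 / (1 - r)) * E x \<partial>M)"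
    proof (rule nn_integral_mono_AE)
      show "AE x in M. ennreal ((cmod (g x))\<^sup>2) \<le> ennreal (t\<^sup>2 / (1 - r)) * E x"
        using fin by eventually_elim (rule g_le)
    qed
    also have "\<dots> = ennreal (t\<^sup>2 / (1 - r)) * (\<integral>\<^sup>+x. E x \<partial>M)"
      by (rule nn_integral_cmult) measurable
    also have "\<dots> \<le> ennreal (t\<^sup>2 / (1 - r)) * ennreal (sqnorm M f / (1 - r))"
      by (intro mult_left_mono E_int) simp
    also have "\<dots> = ennreal (t\<^sup>2 / (1 - r) * (sqnorm M f / (1 - r)))"
      using r by (intro ennreal_mult[symmetric]) auto
    finally show "(\<integral>\<^sup>+x. ennreal ((cmod (g x))\<^sup>2) \<partial>M) \<le> ennreal (t\<^sup>2 / (1 - r) * (sqnorm M f / (1 - r)))" .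
    show "0 \<le> t\<^sup>2 / (1 - r) * (sqnorm M f / (1 - r))" using r by simp
  qed
  have Tg: "(\<lambda>n. complex_of_real t * T (u n) x) sums T g x" if x: "x \<in> space M" for x
  proof -
    note [measurable] = L2_measurable[OF k_row[OF x]]
    have int: "integrable M (\<lambda>y. k x y * (complex_of_real t * u n y))" for n
      by (rule k_integrable[OF L2_cmult(1)[OF u] x])
    have "(\<lambda>n. LINT y|M. k x y * (complex_of_real t * u n y))
        sums (LINT y|M. (\<Sum>n. k x y * (complex_of_real t * u n y)))"
    proof (rule sums_integral[OF int])
      show "AE y in M. summable (\<lambda>n. norm (k x y * (complex_of_real t * u n y)))"
        using fin
      proof eventually_elim
        case (elim y)
        then show ?case by (auto simp: norm_mult intro!: summable_mult summ1)
      qed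
      show "summable (\<lambda>n. LINT y|M. norm (k x y * (complex_of_real t * u n y)))"
      proof (rule summable_comparison_test)
        show "summable (\<lambda>n. t * (row x * (r ^ n * sqrt (sqnorm M f))))"
          using r by (intro summable_mult summable_mult2 summable_geometric) simp
        have "norm (LINT y|M. norm (k x y * (complex_of_real t * u n y)))
            \<le> t * (row x * (r ^ n * sqrt (sqnorm M f)))" for n
        proof -
          have "(LINT y|M. norm (k x y * (complex_of_real t * u n y)))
              = (LINT y|M. t * (cmod (k x y) * cmod (u n y)))"
            using t by (intro Bochner_Integration.integral_cong) (auto simp: norm_mult)
          also have "\<dots> = t * (LINT y|M. cmod (k x y) * cmod (u n y))" by simp
          also have "(LINT y|M. cmod (k x y) * cmod (u n y)) \<le> sqrt (sqnorm M (k x) * sqnorm M (u n))"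
            by (rule real_le_rsqrt[OF L2_Cauchy_Schwarz[OF k_row[OF x] u]])
          also have "\<dots> = row x * sqrt (sqnorm M (u n))" by (simp add: row_def real_sqrt_mult)
          also have "sqrt (sqnorm M (u n)) \<le> sqrt ((r\<^sup>2) ^ n * sqnorm M f)"
            using un by simp
          also have "\<dots> = r ^ n * sqrt (sqnorm M f)"
            using r by (simp add: real_sqrt_mult real_sqrt_power)
          finally show ?thesis using t row_nonneg[of x] by (simp add: mult_left_mono)
        qed
        then show "\<exists>N. \<forall>n\<ge>N. norm (LINT y|M. norm (k x y * (complex_of_real t * u n y)))
            \<le> t * (row x * (r ^ n * sqrt (sqnorm M f)))" by blast
      qed
    qed
    also have "(LINT y|M. (\<Sum>n. k x y * (complex_of_real t * u n y))) = T g x"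
      unfolding T_def
    proof (rule integral_cong_AE)
      show "AE y in M. (\<Sum>n. k x y * (complex_of_real t * u n y)) = k x y * g y"
        using fin
      proof eventually_elim
        case (elim y)
        then have "summable (\<lambda>n. complex_of_real t * u n y)"
          by (intro summable_mult summable_norm_cancel[OF summ1])
        then show ?case unfolding g_def by (rule suminf_mult)
      qed
    qed measurable
    finally have "(\<lambda>n. T (\<lambda>y. complex_of_real t * u n y) x) sums T g x"
      by (simp add: T_def)
    then show ?thesis by (simp add: T_cmult)
  qed
  have "AE x in M. g x + T g x = f x"
    using fin AE_space
  proof eventually_elim
    case (elim x)
    have s: "summable (\<lambda>n. u n x)" by (rule summable_norm_cancel[OF summ1[OF elim(1)]])
    have "(\<lambda>n. complex_of_real t * u n x) sums g x"
      unfolding g_def by (intro summable_sums summable_mult s)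
    from sums_add[OF this Tg[OF elim(2)]]
    have "(\<lambda>n. complex_of_real t * u n x + complex_of_real t * T (u n) x) sums (g x + T g x)" .
    moreover have "complex_of_real t * u n x + complex_of_real t * T (u n) x = u n x - u (Suc n) x" for n
      unfolding uS S_def by (simp add: algebra_simps)
    ultimately have "(\<lambda>n. u n x - u (Suc n) x) sums (g x + T g x)" by simp
    moreover have "(\<lambda>n. u n x - u (Suc n) x) sums (u 0 x - 0)"
      by (rule telescope_sums'[OF summable_LIMSEQ_zero[OF s]])
    ultimately show ?case by (simp add: sums_unique2 u0)
  qed
  then show ?thesis using g by blast
qed

text \<open>
  This is the form in which the resolvent is tested: indicators of short intervals replace the
  delta functions that would give kernel values.
\<close>

lemma resolvent_indicator:
  assumes B: "B \<in> sets M" "emeasure M B < \<infinity>"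
    and H: "\<And>y. y \<in> B \<Longrightarrow> row y \<le> H" "0 \<le> H"
    and g: "g \<in> L2 M" "AE x in M. g x + T g x = indicator B x"
    and x: "x \<in> space M"
  shows "cmod (T g x - T (indicator B) x) \<le> row x * (measure M B * H)"
proof -
  have ind: "(indicator B :: 'a \<Rightarrow> complex) \<in> L2 M"
    by (rule indicator_L2[OF B])
  have "AE x in M. indicator B x = g x + T g x" using g(2) by eventually_elim simp
  from resolvent_kernel_bound[OF ind this g(1) x]
  have "cmod (T g x - T (indicator B) x) \<le> row x * sqrt (sqnorm M (T (indicator B)))" .
  also have "sqrt (sqnorm M (T (indicator B))) \<le> measure M B * H"
    using T_indicator_bound[OF B H(1)] H(2) by (intro real_le_lsqrt) auto
  finally show ?thesis using row_nonneg[of x] by (simp add: mult_left_mono)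
qed

end

section \<open>Hadamard's determinant inequality\<close>

lemma trace_mult_commute:
  fixes X Y :: "'a::comm_ring_1 mat"
  assumes X: "X \<in> carrier_mat n n" and Y: "Y \<in> carrier_mat n n"
  shows "(\<Sum>i<n. (X * Y) $$ (i, i)) = (\<Sum>i<n. (Y * X) $$ (i, i))"
proof -
  have m: "(U * V) $$ (i, i) = (\<Sum>j<n. U $$ (i, j) * V $$ (j, i))"
    if "U \<in> carrier_mat n n" "V \<in> carrier_mat n n" "i < n" for U V :: "'a mat" and i
    using that by (simp add: scalar_prod_def lessThan_atLeast0)
  have "(\<Sum>i<n. (X * Y) $$ (i, i)) = (\<Sum>i<n. \<Sum>j<n. X $$ (i, j) * Y $$ (j, i))"
    using m[OF X Y] by simp
  also have "\<dots> = (\<Sum>j<n. \<Sum>i<n. Y $$ (j, i) * X $$ (i, j))"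
    by (subst sum.swap) (simp add: mult.commute)
  also have "\<dots> = (\<Sum>j<n. (Y * X) $$ (j, j))"
    using m[OF Y X] by simp
  finally show ?thesis .
qed

text \<open>
  The inequality of arithmetic and geometric means, from $x \le e^{x-1}$ applied to each quotient of
  an entry by the length.
\<close>

lemma prod_list_le_power:
  fixes es :: "real list"
  assumes nn: "\<And>e. e \<in> set es \<Longrightarrow> 0 \<le> e" and sum: "sum_list es \<le> (real (length es))\<^sup>2"
  shows "prod_list es \<le> real (length es) ^ length es"
proof (cases "es = []")
  case False
  define k where "k = real (length es)"
  have k: "k > 0" using False by (simp add: k_def)
  have "prod_list (map (\<lambda>e. e / k) xs) \<le> exp (sum_list xs / k - length xs)"
    if "set xs \<subseteq> set es" for xs
    using that
  proof (induction xs)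
    case (Cons e xs)
    have "e / k \<le> exp (e / k - 1)" using exp_ge_add_one_self[of "e / k - 1"] by simp
    then have "e / k * prod_list (map (\<lambda>e. e / k) xs)
        \<le> exp (e / k - 1) * exp (sum_list xs / k - length xs)"
      using Cons nn k by (intro mult_mono prod_list_nonneg) auto
    also have "\<dots> = exp (sum_list (e # xs) / k - length (e # xs))"
      by (simp add: exp_add[symmetric] add_divide_distrib algebra_simps)
    finally show ?case by simp
  qed simp
  from this[of es] have "prod_list (map (\<lambda>e. e / k) es) \<le> exp (sum_list es / k - k)"
    by (simp add: k_def)
  also have "\<dots> \<le> exp 0"
    using sum k by (simp add: k_def[symmetric] pos_divide_le_eq power2_eq_square)
  also have "prod_list (map (\<lambda>e. e / k) es) = prod_list es / k ^ length es"
    using k by (induction es) (auto simp: field_simps)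
  finally show ?thesis using k by (simp add: k_def pos_divide_le_eq)
qed simp

text \<open>
  The eigenvalues of $AA^*$ are nonnegative, their sum is the trace, at most $n^2$, and their product
  is $|\det A|^2$. A triangular form of $AA^*$ gives the trace and the determinant, and the inequality
  of means concludes.
\<close>

lemma hadamard_unit_entries:
  fixes A :: "complex mat"
  assumes A: "A \<in> carrier_mat n n" and le: "\<And>i j. i < n \<Longrightarrow> j < n \<Longrightarrow> cmod (A $$ (i, j)) \<le> 1"
  shows "cmod (Determinant.det A) \<le> sqrt n ^ n"
proof -
  define Ad where "Ad = map_mat cnj (transpose_mat A)"
  define B where "B = A * Ad"
  have Ad: "Ad \<in> carrier_mat n n" using A by (simp add: Ad_def)
  have B: "B \<in> carrier_mat n n" using A Ad by (simp add: B_def)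
  have Bij: "B $$ (i, j) = (\<Sum>l<n. A $$ (i, l) * cnj (A $$ (j, l)))" if "i < n" "j < n" for i j
    using that A by (simp add: B_def Ad_def scalar_prod_def lessThan_atLeast0)
  interpret cnj: comm_ring_hom cnj by unfold_locales auto
  have detB: "Determinant.det B = complex_of_real ((cmod (Determinant.det A))\<^sup>2)"
  proof -
    have "Determinant.det Ad = cnj (Determinant.det A)"
      unfolding Ad_def using cnj.hom_det[of "transpose_mat A"] det_transpose[OF A] by simp
    then show ?thesis unfolding B_def det_mult[OF A Ad]
      by (simp add: complex_norm_square[symmetric])
  qed
  obtain as where cp: "char_poly B = (\<Prod>a\<leftarrow>as. [:- a, 1:])" and len: "length as = n"
    using char_poly_factorized[OF B] by blast
  obtain C P Q where sd: "schur_decomposition B as = (C, P, Q)" by (cases "schur_decomposition B as")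
  note sch = schur_decomposition[OF B cp sd]
  have sim: "similar_mat_wit B C P Q" and ut: "upper_triangular C" and diag: "diag_mat C = as"
    using sch by auto
  note w = similar_mat_witD2[OF B sim]
  have detC: "Determinant.det B = prod_list as"
    using det_similar[of B C] sim det_upper_triangular[OF ut w(5)] diag
    by (auto simp: similar_mat_def)
  have tr: "(\<Sum>i<n. B $$ (i, i)) = sum_list as"
  proof -
    have "(\<Sum>i<n. B $$ (i, i)) = (\<Sum>i<n. (P * (C * Q)) $$ (i, i))"
      using w by (simp add: assoc_mult_mat[of P n n C n Q n])
    also have "\<dots> = (\<Sum>i<n. ((C * Q) * P) $$ (i, i))"
      using w by (intro trace_mult_commute) auto
    also have "(C * Q) * P = C"
      using w by (simp add: assoc_mult_mat[of C n n Q n P n])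
    also have "(\<Sum>i<n. C $$ (i, i)) = sum_list (diag_mat C)"
      using w(5) by (simp add: diag_mat_def interv_sum_list_conv_sum_set_nat lessThan_atLeast0)
    finally show ?thesis by (simp add: diag)
  qed
  have nn: "\<exists>r\<ge>0. a = complex_of_real r" if a: "a \<in> set as" for a
  proof -
    have "poly (char_poly B) a = 0"
      unfolding cp poly_prod_list using a by (induction as) auto
    then have "eigenvalue B a" using eigenvalue_root_char_poly[OF B] by simp
    then obtain v where v: "v \<in> carrier_vec n" "v \<noteq> 0\<^sub>v n" and ev: "B *\<^sub>v v = a \<cdot>\<^sub>v v"
      unfolding eigenvalue_def eigenvector_def using B by auto
    define V where "V i = vec_index v i" for i
    have evi: "(\<Sum>j<n. B $$ (i, j) * V j) = a * V i" if "i < n" for i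
    proof -
      have "vec_index (B *\<^sub>v v) i = (\<Sum>j<n. B $$ (i, j) * V j)"
        using that B v by (simp add: V_def scalar_prod_def lessThan_atLeast0)
      then show ?thesis using that v ev by (simp add: V_def)
    qed
    define R where "R = (\<Sum>l<n. (cmod (\<Sum>i<n. cnj (V i) * A $$ (i, l)))\<^sup>2)"
    define N where "N = (\<Sum>i<n. (cmod (V i))\<^sup>2)"
    have "\<exists>i<n. V i \<noteq> 0"
    proof (rule ccontr)
      assume "\<not> (\<exists>i<n. V i \<noteq> 0)"
      then have "v = 0\<^sub>v n" using v by (intro eq_vecI) (auto simp: V_def)
      then show False using v by simp
    qed
    then obtain i where i: "i < n" "V i \<noteq> 0" by blast
    have N: "0 < N"
      unfolding N_def by (rule sum_pos2[of _ i]) (use i in auto)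
    have "a * complex_of_real N = (\<Sum>i<n. cnj (V i) * (a * V i))"
      unfolding N_def of_real_sum sum_distrib_left
      by (intro sum.cong refl) (simp only: complex_norm_square mult_ac)
    also have "\<dots> = (\<Sum>i<n. cnj (V i) * (\<Sum>j<n. (\<Sum>l<n. A $$ (i, l) * cnj (A $$ (j, l))) * V j))"
      by (intro sum.cong refl) (simp add: evi[symmetric] Bij)
    also have "\<dots> = (\<Sum>l<n. (\<Sum>i<n. cnj (V i) * A $$ (i, l)) * (\<Sum>j<n. cnj (A $$ (j, l)) * V j))"
    proof -
      have "(\<Sum>i<n. cnj (V i) * (\<Sum>j<n. (\<Sum>l<n. A $$ (i, l) * cnj (A $$ (j, l))) * V j))
          = (\<Sum>i<n. \<Sum>j<n. \<Sum>l<n. cnj (V i) * A $$ (i, l) * (cnj (A $$ (j, l)) * V j))"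
        by (simp add: sum_distrib_left sum_distrib_right mult_ac)
      also have "\<dots> = (\<Sum>i<n. \<Sum>l<n. \<Sum>j<n. cnj (V i) * A $$ (i, l) * (cnj (A $$ (j, l)) * V j))"
        by (intro sum.cong refl sum.swap)
      also have "\<dots> = (\<Sum>l<n. \<Sum>i<n. \<Sum>j<n. cnj (V i) * A $$ (i, l) * (cnj (A $$ (j, l)) * V j))"
        by (rule sum.swap)
      also have "\<dots> = (\<Sum>l<n. (\<Sum>i<n. cnj (V i) * A $$ (i, l)) * (\<Sum>j<n. cnj (A $$ (j, l)) * V j))"
        by (simp only: sum_product)
      finally show ?thesis .
    qed
    also have "\<dots> = complex_of_real R"
      unfolding R_def of_real_sum
    proof (intro sum.cong refl)
      fix l
      have "(\<Sum>j<n. cnj (A $$ (j, l)) * V j) = cnj (\<Sum>i<n. cnj (V i) * A $$ (i, l))"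
        by (simp add: mult.commute)
      then show "(\<Sum>i<n. cnj (V i) * A $$ (i, l)) * (\<Sum>j<n. cnj (A $$ (j, l)) * V j)
          = complex_of_real ((cmod (\<Sum>i<n. cnj (V i) * A $$ (i, l)))\<^sup>2)"
        by (simp only: complex_norm_square)
    qed
    finally have "a = complex_of_real (R / N)" using N by (simp add: field_simps)
    moreover have "0 \<le> R / N" using N by (simp add: R_def sum_nonneg)
    ultimately show ?thesis by blast
  qed
  define es where "es = map Re as"
  have as: "as = map complex_of_real es"
  proof -
    have "map (\<lambda>a. complex_of_real (Re a)) as = as"
      by (rule map_idI) (use nn in force)
    then show ?thesis by (simp add: es_def comp_def)
  qed
  have "sum_list es \<le> (real (length es))\<^sup>2"
  proof -
    have "complex_of_real (sum_list es) = (\<Sum>i<n. B $$ (i, i))"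
      unfolding tr as by (induction es) auto
    also have "\<dots> = (\<Sum>i<n. \<Sum>l<n. complex_of_real ((cmod (A $$ (i, l)))\<^sup>2))"
      by (intro sum.cong refl) (simp only: lessThan_iff Bij complex_norm_square)
    also have "\<dots> = complex_of_real (\<Sum>i<n. \<Sum>l<n. (cmod (A $$ (i, l)))\<^sup>2)" by simp
    finally have "sum_list es = (\<Sum>i<n. \<Sum>l<n. (cmod (A $$ (i, l)))\<^sup>2)"
      by (simp only: of_real_eq_iff)
    also have "\<dots> \<le> (\<Sum>i<n. \<Sum>l<n. 1)"
      by (intro sum_mono power_le_one le) auto
    finally show ?thesis by (simp add: es_def len power2_eq_square)
  qed
  moreover have "\<And>e. e \<in> set es \<Longrightarrow> 0 \<le> e" using nn by (force simp: es_def)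
  ultimately have "prod_list es \<le> real n ^ n"
    using prod_list_le_power[of es] by (simp add: es_def len)
  moreover have "complex_of_real (prod_list es) = complex_of_real ((cmod (Determinant.det A))\<^sup>2)"
    unfolding detB[symmetric] detC as by (induction es) auto
  then have "prod_list es = (cmod (Determinant.det A))\<^sup>2" by (simp only: of_real_eq_iff)
  ultimately have "(cmod (Determinant.det A))\<^sup>2 \<le> (sqrt n ^ n)\<^sup>2"
    by (simp add: power_mult[symmetric] mult.commute[of n 2]) (simp add: power_mult)
  then show ?thesis by (rule power2_le_imp_le) simp
qed

text \<open>
  Dividing row \<open>i\<close> and column \<open>i\<close> by \<open>w i\<close> reduces to entries of modulus at most 1. Where a weight
  vanishes the entry vanishes as well, so an arbitrary quotient is harmless there.
\<close>

lemma hadamard_weighted: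
  fixes k :: "nat \<Rightarrow> nat \<Rightarrow> complex" and w :: "nat \<Rightarrow> real"
  assumes w: "\<And>i. i < n \<Longrightarrow> 0 \<le> w i"
    and le: "\<And>i j. i < n \<Longrightarrow> j < n \<Longrightarrow> cmod (k i j) \<le> w i * w j"
  shows "cmod (Determinant.det (Matrix.mat n n (\<lambda>(i, j). k i j))) \<le> sqrt n ^ n * (\<Prod>i<n. (w i)\<^sup>2)"
proof -
  define E where "E = Matrix.mat n n (\<lambda>(i, j). if w i * w j = 0 then 0 else k i j / complex_of_real (w i * w j))"
  have k_eq: "k i j = complex_of_real (w i) * complex_of_real (w j) * E $$ (i, j)" if "i < n" "j < n" for i j
    using that le[OF that] by (auto simp: E_def)
  have E1: "cmod (E $$ (i, j)) \<le> 1" if "i < n" "j < n" for i j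
    using that le[OF that] w[OF that(1)] w[OF that(2)] by (auto simp: E_def norm_divide norm_mult divide_le_eq)
  have "Determinant.det (Matrix.mat n n (\<lambda>(i, j). k i j))
      = (\<Sum>p | p permutes {0..<n}. signof p * (\<Prod>i = 0..<n. k i (p i)))"
    by (subst det_def'[of _ n]) (auto intro!: sum.cong prod.cong arg_cong2[of _ _ _ _ "(*)"]
        simp: permutes_in_image[of _ "{0..<n}", simplified])
  also have "\<dots> = (\<Sum>p | p permutes {0..<n}. (\<Prod>i<n. (complex_of_real (w i))\<^sup>2) * (signof p * (\<Prod>i = 0..<n. E $$ (i, p i))))"
  proof (intro sum.cong refl)
    fix p assume "p \<in> {p. p permutes {0..<n}}"
    then have p: "p permutes {0..<n}" by simp
    have "(\<Prod>i = 0..<n. k i (p i)) = (\<Prod>i = 0..<n. complex_of_real (w i) * complex_of_real (w (p i)) * E $$ (i, p i))"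
      using permutes_in_image[OF p] by (intro prod.cong refl k_eq) auto
    also have "\<dots> = (\<Prod>i = 0..<n. complex_of_real (w i)) * (\<Prod>i = 0..<n. complex_of_real (w (p i)))
        * (\<Prod>i = 0..<n. E $$ (i, p i))"
      by (simp add: prod.distrib)
    also have "(\<Prod>i = 0..<n. complex_of_real (w (p i))) = (\<Prod>i = 0..<n. complex_of_real (w i))"
      using prod.permute[OF p, of "\<lambda>i. complex_of_real (w i)"] by (simp add: comp_def)
    finally show "signof p * (\<Prod>i = 0..<n. k i (p i))
        = (\<Prod>i<n. (complex_of_real (w i))\<^sup>2) * (signof p * (\<Prod>i = 0..<n. E $$ (i, p i)))"
      by (simp add: prod.distrib power2_eq_square lessThan_atLeast0 mult_ac)
  qed
  also have "\<dots> = (\<Prod>i<n. (complex_of_real (w i))\<^sup>2) * Determinant.det E"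
    by (subst det_def'[of E n]) (auto simp: E_def sum_distrib_left)
  finally have "cmod (Determinant.det (Matrix.mat n n (\<lambda>(i, j). k i j)))
      = (\<Prod>i<n. (w i)\<^sup>2) * cmod (Determinant.det E)"
    by (simp add: norm_mult prod_norm[symmetric] norm_power)
  also have "\<dots> \<le> (\<Prod>i<n. (w i)\<^sup>2) * sqrt n ^ n"
    by (intro mult_left_mono hadamard_unit_entries E1 prod_nonneg) (auto simp: E_def)
  finally show ?thesis by (simp add: mult.commute)
qed

section \<open>Moments of a determinantal process with dominated kernel\<close>

text \<open>
  The terms with \<open>card S = k\<close> are a coefficient of $\prod_j (1 + s a_j) \le e^{s\sum_j a_j}$. The choice
  $s = k$ recovers enough of the $1/k!$ that a crude count of subsets would lose, with a bound that
  depends on \<open>a\<close> only through its sum.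
\<close>

lemma subset_sum_bound:
  fixes a :: "'a \<Rightarrow> real" and c :: "nat \<Rightarrow> real"
  assumes J: "finite J" and a: "\<And>j. j \<in> J \<Longrightarrow> 0 \<le> a j" and c: "\<And>k. 0 \<le> c k"
  shows "(\<Sum>S\<in>Pow J. c (card S) * (\<Prod>j\<in>S. a j))
    \<le> (\<Sum>k\<le>card J. c k / real k ^ k * exp (real k * (\<Sum>j\<in>J. a j)))"
proof -
  have "(\<Sum>S\<in>Pow J. c (card S) * (\<Prod>j\<in>S. a j))
      \<le> (\<Sum>S\<in>Pow J. \<Sum>k\<le>card J. c k / real k ^ k * (\<Prod>j\<in>S. real k * a j))"
  proof (rule sum_mono)
    fix S assume S: "S \<in> Pow J"
    then have cS: "card S \<le> card J" using J by (auto intro: card_mono)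
    have fS: "finite S" using S J by (auto intro: finite_subset)
    have "c (card S) * (\<Prod>j\<in>S. a j) = c (card S) / real (card S) ^ card S * (\<Prod>j\<in>S. real (card S) * a j)"
      by (cases "S = {}") (use fS in \<open>auto simp: prod.distrib\<close>)
    also have "\<dots> \<le> (\<Sum>k\<le>card J. c k / real k ^ k * (\<Prod>j\<in>S. real k * a j))"
    proof (rule member_le_sum[of "card S" "{..card J}" "\<lambda>k. c k / real k ^ k * (\<Prod>j\<in>S. real k * a j)"])
      fix k
      have "0 \<le> (\<Prod>j\<in>S. real k * a j)" using S a by (intro prod_nonneg) auto
      moreover have "0 \<le> c k / real k ^ k" using c by simp
      ultimately show "0 \<le> c k / real k ^ k * (\<Prod>j\<in>S. real k * a j)" by (rule mult_nonneg_nonneg[rotated])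
    qed (use cS in auto)
    finally show "c (card S) * (\<Prod>j\<in>S. a j)
      \<le> (\<Sum>k\<le>card J. c k / real k ^ k * (\<Prod>j\<in>S. real k * a j))" .
  qed
  also have "\<dots> = (\<Sum>k\<le>card J. c k / real k ^ k * (\<Sum>S\<in>Pow J. \<Prod>j\<in>S. real k * a j))"
    by (subst sum.swap) (simp add: sum_distrib_left)
  also have "\<dots> \<le> (\<Sum>k\<le>card J. c k / real k ^ k * exp (real k * (\<Sum>j\<in>J. a j)))"
  proof (intro sum_mono mult_left_mono)
    fix k
    have "(\<Sum>S\<in>Pow J. \<Prod>j\<in>S. real k * a j) = (\<Prod>j\<in>J. real k * a j + 1)"
      using prod_add[OF J, of "\<lambda>j. real k * a j" "\<lambda>_. 1"] by simp
    also have "\<dots> \<le> (\<Prod>j\<in>J. exp (real k * a j))"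
      using a by (intro prod_mono) (auto simp: add.commute[of _ 1] intro!: exp_ge_add_one_self add_nonneg_nonneg)
    also have "\<dots> = exp (real k * (\<Sum>j\<in>J. a j))"
      by (simp add: exp_sum[OF J] sum_distrib_left)
    finally show "(\<Sum>S\<in>Pow J. \<Prod>j\<in>S. real k * a j) \<le> exp (real k * (\<Sum>j\<in>J. a j))" .
  qed (use c in auto)
  finally show ?thesis .
qed

text \<open>
  The \<open>k\<close>-th root of the term is $t e^v/\sqrt k$, which tends to zero.
\<close>

lemma superexponential_summable:
  fixes t v :: real
  assumes t: "0 \<le> t"
  shows "summable (\<lambda>k. (t * sqrt (real k)) ^ k / real k ^ k * exp (real k * v))"
proof (rule summable_comparison_test_ev)
  show "summable (\<lambda>k. (1 / 2 :: real) ^ k)" by simp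
  have "eventually (\<lambda>k. real k \<ge> (2 * t * exp v)\<^sup>2 + 1) sequentially"
    using filterlim_real_sequentially unfolding filterlim_at_top by blast
  then show "eventually (\<lambda>k. norm ((t * sqrt (real k)) ^ k / real k ^ k * exp (real k * v)) \<le> (1 / 2) ^ k) sequentially"
  proof eventually_elim
    case (elim k)
    then have k: "real k > 0" using zero_le_power2[of "2 * t * exp v"] by linarith
    have "2 * t * exp v \<le> sqrt (real k)"
      using elim by (intro real_le_rsqrt) linarith
    then have *: "t * exp v / sqrt (real k) \<le> 1 / 2"
      using k by (simp add: pos_divide_le_eq)
    have "(t * sqrt (real k)) ^ k / real k ^ k * exp (real k * v) = (t * sqrt (real k) / real k * exp v) ^ k"
      by (simp add: power_divide power_mult_distrib exp_of_nat_mult)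
    also have "t * sqrt (real k) / real k * exp v = t * exp v / sqrt (real k)"
      using k by (simp add: field_simps flip: power2_eq_square)
    finally show ?case using * t
      by (simp add: power_abs[symmetric] abs_mult del: power_abs) (intro power_mono, auto)
  qed
qed

text \<open>
  A partition of $\delta < |x|$, $-q \le x < q$ into cells of length $1/q$. The shift by $q^2$ numbers the
  cells by $0, \dots, 2q^2 - 1$.
\<close>

definition mesh_cell :: "real \<Rightarrow> nat \<Rightarrow> nat \<Rightarrow> real set" where
  "mesh_cell \<delta> q j = {x. \<delta> < \<bar>x\<bar> \<and> \<lfloor>x * real q\<rfloor> = int j - (int q)\<^sup>2}"

text \<open>
  Once the mesh is fine enough to separate the points of \<open>Y\<close>, every factor is \<open>1\<close> or \<open>1 + t\<close>.
\<close>

lemma mesh_separates: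
  fixes Y :: "real set" and t :: real
  assumes Y: "finite Y" "\<And>x. x \<in> Y \<Longrightarrow> \<delta> < \<bar>x\<bar>"
  shows "eventually (\<lambda>q. (\<Prod>j<2 * q\<^sup>2. 1 + t * real (card (Y \<inter> mesh_cell \<delta> q j))) = (1 + t) ^ card Y) sequentially"
proof -
  have 1: "eventually (\<lambda>q. \<forall>x\<in>Y. \<bar>x\<bar> < real q) sequentially"
    unfolding eventually_ball_finite_distrib[OF Y(1)]
    using filterlim_real_sequentially unfolding filterlim_at_top_dense by blast
  have 2: "eventually (\<lambda>q. \<forall>x\<in>Y. \<forall>y\<in>Y. x \<noteq> y \<longrightarrow> 1 < \<bar>x - y\<bar> * real q) sequentially"
    unfolding eventually_ball_finite_distrib[OF Y(1)]
  proof (intro ballI)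
    fix x y
    have "eventually (\<lambda>q. 1 / \<bar>x - y\<bar> < real q) sequentially"
      using filterlim_real_sequentially unfolding filterlim_at_top_dense by blast
    then show "eventually (\<lambda>q. x \<noteq> y \<longrightarrow> 1 < \<bar>x - y\<bar> * real q) sequentially"
      by eventually_elim (auto simp: pos_divide_less_eq mult.commute)
  qed
  from 1 2 show ?thesis
  proof eventually_elim
    case (elim q)
    define \<phi> where "\<phi> x = nat (\<lfloor>x * real q\<rfloor> + (int q)\<^sup>2)" for x :: real
    have bd: "0 \<le> \<lfloor>x * real q\<rfloor> + (int q)\<^sup>2" "\<lfloor>x * real q\<rfloor> + (int q)\<^sup>2 < 2 * (int q)\<^sup>2" if "x \<in> Y" for x
    proof -
      have x: "- real q < x" "x < real q" "0 < real q" using elim(1) that by force+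
      have "- real q * real q \<le> x * real q" using x by (intro mult_right_mono) auto
      then have "- (int q)\<^sup>2 \<le> \<lfloor>x * real q\<rfloor>"
        by (simp add: le_floor_iff power2_eq_square)
      then show "0 \<le> \<lfloor>x * real q\<rfloor> + (int q)\<^sup>2" by linarith
      have "x * real q < real q * real q" using x by (intro mult_strict_right_mono) auto
      then have "\<lfloor>x * real q\<rfloor> < (int q)\<^sup>2"
        by (simp add: floor_less_iff power2_eq_square)
      then show "\<lfloor>x * real q\<rfloor> + (int q)\<^sup>2 < 2 * (int q)\<^sup>2" by linarith
    qed
    have cell: "Y \<inter> mesh_cell \<delta> q j = {x \<in> Y. \<phi> x = j}" for j
      using bd Y(2) by (auto simp: mesh_cell_def \<phi>_def)
    have inj: "inj_on \<phi> Y"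
    proof (rule inj_onI, rule ccontr)
      fix x y assume xy: "x \<in> Y" "y \<in> Y" "\<phi> x = \<phi> y" "x \<noteq> y"
      then have "\<lfloor>x * real q\<rfloor> = \<lfloor>y * real q\<rfloor>" using bd by (simp add: \<phi>_def eq_nat_nat_iff)
      then have "\<bar>x * real q - y * real q\<bar> < 1" by linarith
      moreover have "\<bar>x * real q - y * real q\<bar> = \<bar>x - y\<bar> * real q"
        by (simp add: left_diff_distrib[symmetric] abs_mult)
      ultimately show False using elim(2) xy by force
    qed
    have sub: "\<phi> ` Y \<subseteq> {..<2 * q\<^sup>2}"
    proof safe
      fix x assume "x \<in> Y"
      from bd[OF this] show "\<phi> x < 2 * q\<^sup>2" unfolding \<phi>_def
        by (simp add: nat_less_iff)
    qed
    have "(\<Prod>j<2 * q\<^sup>2. 1 + t * real (card (Y \<inter> mesh_cell \<delta> q j)))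
        = (\<Prod>j\<in>\<phi> ` Y. 1 + t * real (card (Y \<inter> mesh_cell \<delta> q j)))"
      using sub by (intro prod.mono_neutral_right) (auto simp: cell card_eq_0_iff)
    also have "\<dots> = (\<Prod>x\<in>Y. 1 + t * real (card (Y \<inter> mesh_cell \<delta> q (\<phi> x))))"
      by (simp add: prod.reindex[OF inj])
    also have "\<dots> = (\<Prod>x\<in>Y. 1 + t)"
    proof (intro prod.cong refl)
      fix x assume "x \<in> Y"
      then have "Y \<inter> mesh_cell \<delta> q (\<phi> x) = {x}" using inj by (auto simp: cell inj_on_def)
      then show "1 + t * real (card (Y \<inter> mesh_cell \<delta> q (\<phi> x))) = 1 + t" by simp
    qed
    finally show ?case by simp
  qed
qed

lemma mesh_cell_rel_compact:
  assumes "0 < \<delta>" "0 < q" "j < 2 * q\<^sup>2"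
  shows "rel_compact_borel (mesh_cell \<delta> q j)"
proof -
  have "mesh_cell \<delta> q j \<subseteq> {-real q..real q} - {-\<delta><..<\<delta>}"
  proof
    fix x assume x: "x \<in> mesh_cell \<delta> q j"
    then have f: "\<lfloor>x * real q\<rfloor> = int j - (int q)\<^sup>2" by (simp add: mesh_cell_def)
    have "int j < 2 * (int q)\<^sup>2" using assms(3) by (metis of_nat_less_iff of_nat_mult of_nat_numeral of_nat_power)
    then have "- (int q)\<^sup>2 \<le> \<lfloor>x * real q\<rfloor>" "\<lfloor>x * real q\<rfloor> < (int q)\<^sup>2" using f by linarith+
    then have "- real q * real q \<le> x * real q" "x * real q \<le> real q * real q"
      by (simp_all add: le_floor_iff floor_less_iff power2_eq_square)
    then have "- real q \<le> x" "x \<le> real q"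
      using assms(2) by (auto intro: mult_right_le_imp_le[of _ "real q"] simp del: mult_minus_left)
    then show "x \<in> {-real q..real q} - {-\<delta><..<\<delta>}" using x by (auto simp: mesh_cell_def)
  qed
  moreover have "compact ({-real q..real q} - {-\<delta><..<\<delta>})" by (rule compact_diff) auto
  moreover have "{-real q..real q} - {-\<delta><..<\<delta>} \<subseteq> Rstar" using assms by auto
  moreover have "mesh_cell \<delta> q j \<in> sets borel" unfolding mesh_cell_def by measurable
  ultimately show ?thesis unfolding rel_compact_borel_def by blast
qed

lemma mesh_cell_disjoint: "disjoint_family_on (mesh_cell \<delta> q) J"
  by (auto simp: disjoint_family_on_def mesh_cell_def)

definition config_sum :: "(real \<Rightarrow> ennreal) \<Rightarrow> real set \<Rightarrow> ennreal" where
  "config_sum F X = (\<integral>\<^sup>+x. F x \<partial>count_space X)"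

text \<open>
  Domination by a product is what Hadamard's inequality asks for: dividing rows and columns by \<open>w\<close>
  leaves entries of modulus at most 1, and \<open>w\<^sup>2\<close> takes over the role of the intensity of the process.
\<close>

locale dominated_process =
  fixes \<mu> :: "real set measure" and K :: "real \<Rightarrow> real \<Rightarrow> complex" and w :: "real \<Rightarrow> real"
  assumes det: "determinantal \<mu> K"
    and w_measurable [measurable]: "w \<in> borel_measurable borel"
    and w_nonneg: "\<And>x. 0 \<le> w x"
    and K_le: "\<And>x y. x \<noteq> 0 \<Longrightarrow> y \<noteq> 0 \<Longrightarrow> cmod (K x y) \<le> w x * w y"
begin

definition \<nu> :: "real measure" where
  "\<nu> = density lborel (\<lambda>x. ennreal ((w x)\<^sup>2))"

sublocale prob_space \<mu> using det by (simp add: determinantal_def)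

lemma sets_nu [simp, measurable_cong]: "sets \<nu> = sets borel"
  by (simp add: \<nu>_def)

lemma sets_mu: "sets \<mu> = sets Conf_algebra" using det by (simp add: determinantal_def)

lemma space_mu: "space \<mu> = Conf"
  using sets_eq_imp_space_eq[OF sets_mu] unfolding Conf_algebra_def
  by (simp add: space_measure_of_conv)

lemma card_measurable:
  assumes "rel_compact_borel D"
  shows "(\<lambda>X. card (X \<inter> D)) \<in> measurable \<mu> (count_space UNIV)"
proof -
  have "(\<lambda>X. card (X \<inter> D)) -` {m} \<inter> space \<mu> \<in> sets \<mu>" for m
  proof -
    have "{X \<in> Conf. card (X \<inter> D) = m} \<in> sets Conf_algebra"
      unfolding Conf_algebra_def using assms
      by (subst sets_measure_of) (auto intro!: sigma_sets.Basic)
    moreover have "(\<lambda>X. card (X \<inter> D)) -` {m} \<inter> space \<mu> = {X \<in> Conf. card (X \<inter> D) = m}"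
      by (auto simp: space_mu)
    ultimately show ?thesis by (simp add: sets_mu)
  qed
  then show ?thesis by (subst measurable_count_space_eq2_countable) auto
qed

text \<open>
  Hadamard's inequality turns the integral of the determinant into a product of one-dimensional
  integrals.
\<close>

lemma correlation_bound_nat:
  assumes D: "\<And>i. i < k \<Longrightarrow> rel_compact_borel (D i)" and disj: "disjoint_family_on D {..<k}"
  shows "(\<integral>\<^sup>+X. ennreal (\<Prod>i<k. real (card (X \<inter> D i))) \<partial>\<mu>)
    \<le> ennreal (sqrt k ^ k) * (\<Prod>i<k. emeasure \<nu> (D i))"
proof (cases "k = 0")
  case True
  then show ?thesis by (simp add: emeasure_space_1)
next
  case False
  define P where "P = Pi\<^sub>M {..<k} (\<lambda>_. lborel :: real measure)"
  define d where "d x = Determinant.det (Matrix.mat k k (\<lambda>(i, j). K (x i) (x j)))" for x :: "nat \<Rightarrow> real"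
  interpret product_sigma_finite "\<lambda>_::nat. lborel :: real measure" ..
  have Db: "D i \<in> sets borel" "D i \<subseteq> Rstar" if "i < k" for i
    using D[OF that] by (auto simp: rel_compact_borel_def)
  have int: "integrable \<mu> (\<lambda>X. \<Prod>i<k. real (card (X \<inter> D i)))"
    and sint: "set_integrable P (Pi\<^sub>E {..<k} D) d"
    and eq: "complex_of_real (LINT X|\<mu>. (\<Prod>i<k. real (card (X \<inter> D i)))) = (LINT x:Pi\<^sub>E {..<k} D|P. d x)"
    using det D disj False unfolding determinantal_def P_def d_def by auto
  have "(\<integral>\<^sup>+X. ennreal (\<Prod>i<k. real (card (X \<inter> D i))) \<partial>\<mu>) = ennreal (LINT X|\<mu>. (\<Prod>i<k. real (card (X \<inter> D i))))"
    by (rule nn_integral_eq_integral[OF int]) (auto intro!: prod_nonneg)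
  also have "\<dots> \<le> ennreal (norm (LINT x:Pi\<^sub>E {..<k} D|P. d x))"
    unfolding eq[symmetric] by (intro ennreal_leI) simp
  also have "\<dots> \<le> (\<integral>\<^sup>+x. ennreal (norm (indicator (Pi\<^sub>E {..<k} D) x *\<^sub>R d x)) \<partial>P)"
    unfolding set_lebesgue_integral_def
    by (rule integral_norm_bound_ennreal) (use sint in \<open>simp add: set_integrable_def\<close>)
  also have "\<dots> \<le> (\<integral>\<^sup>+x. ennreal (sqrt k ^ k) * (\<Prod>i<k. indicator (D i) (x i) * ennreal ((w (x i))\<^sup>2)) \<partial>P)"
  proof (rule nn_integral_mono)
    fix x :: "nat \<Rightarrow> real"
    show "ennreal (norm (indicator (Pi\<^sub>E {..<k} D) x *\<^sub>R d x))
      \<le> ennreal (sqrt k ^ k) * (\<Prod>i<k. indicator (D i) (x i) * ennreal ((w (x i))\<^sup>2))"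
    proof (cases "x \<in> Pi\<^sub>E {..<k} D")
      case True
      then have xi: "x i \<in> D i" if "i < k" for i using that by auto
      have "x i \<noteq> 0" if "i < k" for i using xi[OF that] Db(2)[OF that] by auto
      then have "norm (d x) \<le> sqrt k ^ k * (\<Prod>i<k. (w (x i))\<^sup>2)"
        unfolding d_def by (intro hadamard_weighted K_le) (auto simp: w_nonneg)
      then have "ennreal (norm (d x)) \<le> ennreal (sqrt k ^ k * (\<Prod>i<k. (w (x i))\<^sup>2))"
        by (rule ennreal_leI)
      also have "\<dots> = ennreal (sqrt k ^ k) * (\<Prod>i<k. ennreal ((w (x i))\<^sup>2))"
        by (simp add: ennreal_mult prod_ennreal prod_nonneg)
      finally show ?thesis using True xi by simp
    qed simp
  qed
  also have "\<dots> = ennreal (sqrt k ^ k) * (\<integral>\<^sup>+x. (\<Prod>i<k. indicator (D i) (x i) * ennreal ((w (x i))\<^sup>2)) \<partial>P)"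
  proof (rule nn_integral_cmult)
    have "(\<lambda>x. indicator (D i) (x i) * ennreal ((w (x i))\<^sup>2)) \<in> borel_measurable P" if "i < k" for i
    proof -
      have [measurable]: "D i \<in> sets borel" by (rule Db(1)[OF that])
      have "(\<lambda>y. indicator (D i) y * ennreal ((w y)\<^sup>2)) \<in> borel_measurable lborel" by measurable
      moreover have "(\<lambda>x. x i) \<in> measurable P lborel"
        unfolding P_def using that
        by (intro measurable_component_singleton[of i "{..<k}" "\<lambda>_. lborel"]) simp
      ultimately show ?thesis by (rule measurable_compose[rotated])
    qed
    then show "(\<lambda>x. \<Prod>i<k. indicator (D i) (x i) * ennreal ((w (x i))\<^sup>2)) \<in> borel_measurable P"
      by (intro borel_measurable_prod_ennreal) auto
  qed
  also have "(\<integral>\<^sup>+x. (\<Prod>i<k. indicator (D i) (x i) * ennreal ((w (x i))\<^sup>2)) \<partial>P)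
      = (\<Prod>i<k. \<integral>\<^sup>+x. indicator (D i) x * ennreal ((w x)\<^sup>2) \<partial>lborel)"
    unfolding P_def using Db(1)
    by (intro product_nn_integral_prod[of "{..<k}" "\<lambda>i x. indicator (D i) x * ennreal ((w x)\<^sup>2)"]) auto
  also have "\<dots> = (\<Prod>i<k. emeasure \<nu> (D i))"
    unfolding \<nu>_def using Db(1) by (intro prod.cong refl) (simp add: emeasure_density mult.commute)
  finally show ?thesis .
qed

lemma correlation_bound:
  assumes S: "finite S" and D: "\<And>i. i \<in> S \<Longrightarrow> rel_compact_borel (D i)" and disj: "disjoint_family_on D S"
  shows "(\<integral>\<^sup>+X. ennreal (\<Prod>i\<in>S. real (card (X \<inter> D i))) \<partial>\<mu>)
    \<le> ennreal (sqrt (card S) ^ card S) * (\<Prod>i\<in>S. emeasure \<nu> (D i))"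
proof -
  obtain h where h: "bij_betw h {..<card S} S"
    using ex_bij_betw_nat_finite[OF S] by (auto simp: lessThan_atLeast0)
  have hS: "h i \<in> S" if "i < card S" for i using bij_betwE[OF h] that by auto
  have "disjoint_family_on (\<lambda>i. D (h i)) {..<card S}"
    using disj hS bij_betw_imp_inj_on[OF h] unfolding disjoint_family_on_def
    by (metis inj_on_def lessThan_iff)
  from correlation_bound_nat[of "card S" "\<lambda>i. D (h i)", OF D[OF hS] this]
  show ?thesis
    using prod.reindex_bij_betw[OF h, of "\<lambda>i. real (card (_ \<inter> D i))"]
      prod.reindex_bij_betw[OF h, of "\<lambda>i. emeasure \<nu> (D i)"] by simp
qed

lemma config_sum_indicator:
  assumes X: "X \<in> Conf" and D: "rel_compact_borel D"
  shows "config_sum (indicator D) X = of_nat (card (X \<inter> D))"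
proof -
  obtain C where "compact C" "C \<subseteq> Rstar" "D \<subseteq> C" using D by (auto simp: rel_compact_borel_def)
  then have "finite (X \<inter> D)" using X unfolding Conf_def
    by (auto intro: finite_subset[of "X \<inter> D" "X \<inter> C"])
  moreover have "config_sum (indicator D) X = emeasure (count_space X) (X \<inter> D)"
  proof -
    have "config_sum (indicator D) X = (\<integral>\<^sup>+x. indicator (X \<inter> D) x \<partial>count_space X)"
      unfolding config_sum_def by (intro nn_integral_cong) (auto simp: indicator_def)
    then show ?thesis by (simp del: emeasure_count_space_finite)
  qed
  ultimately show ?thesis by simp
qed

text \<open>
  For an indicator this is the first moment bound on relatively compact sets, exhausted from inside
  the punctured line; the general case follows by the usual approximation by simple functions.
  Measurability is proved in the same induction.
\<close>

lemma campbell_bound: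
  assumes F: "F \<in> borel_measurable borel"
  shows "config_sum F \<in> borel_measurable \<mu> \<and> (\<integral>\<^sup>+X. config_sum F X \<partial>\<mu>) \<le> (\<integral>\<^sup>+x. F x \<partial>\<nu>)"
  using F
proof (induction F rule: borel_measurable_induct)
  case (cong f g)
  have "f = g" by (rule ext) (use cong in auto)
  then show ?case using cong by simp
next
  case (set A)
  then have [measurable]: "A \<in> sets borel" by simp
  define B where "B m = A \<inter> {x. 1 / real (Suc m) \<le> \<bar>x\<bar> \<and> \<bar>x\<bar> \<le> real (Suc m)}" for m
  have Bb [measurable]: "B m \<in> sets borel" for m unfolding B_def by measurable
  have rel: "rel_compact_borel (B m)" for m
  proof -
    have "B m \<subseteq> {-real (Suc m)..real (Suc m)} - {-(1 / real (Suc m))<..<1 / real (Suc m)}"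
      by (auto simp: B_def abs_le_iff)
    moreover have "compact ({-real (Suc m)..real (Suc m)} - {-(1 / real (Suc m))<..<1 / real (Suc m)})"
      by (rule compact_diff) auto
    moreover have "{-real (Suc m)..real (Suc m)} - {-(1 / real (Suc m))<..<1 / real (Suc m)} \<subseteq> Rstar"
      by auto
    ultimately show ?thesis unfolding rel_compact_borel_def using Bb by blast
  qed
  have inc: "incseq B"
  proof (rule incseq_SucI, rule subsetI)
    fix m x assume "x \<in> B m"
    moreover have "1 / real (Suc (Suc m)) \<le> 1 / real (Suc m)" by (intro divide_left_mono) auto
    ultimately show "x \<in> B (Suc m)" by (auto simp: B_def)
  qed
  have UB: "(\<Union>m. B m) = A - {0}"
  proof -
    have "\<exists>m. 1 / real (Suc m) \<le> \<bar>x\<bar> \<and> \<bar>x\<bar> \<le> real (Suc m)" if "x \<noteq> 0" for x :: real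
    proof -
      obtain m where m: "real m > \<bar>x\<bar> + 1 / \<bar>x\<bar>" using reals_Archimedean2 by blast
      have p: "0 < 1 / \<bar>x\<bar>" using that by simp
      have "\<bar>x\<bar> \<le> real (Suc m)" using m p by linarith
      moreover have "1 / \<bar>x\<bar> \<le> real (Suc m)" using m abs_ge_zero[of x] by (simp del: abs_ge_zero)
      then have "1 / real (Suc m) \<le> \<bar>x\<bar>" using that by (simp add: field_simps)
      ultimately show ?thesis by blast
    qed
    then show ?thesis by (auto simp: B_def)
  qed
  have cs: "config_sum (indicator A) X = (SUP m. config_sum (indicator (B m)) X)" if X: "X \<in> Conf" for X
  proof -
    have e: "config_sum (indicator S) X = emeasure (count_space X) (X \<inter> S)" for S
    proof -
      have "config_sum (indicator S) X = (\<integral>\<^sup>+x. indicator (X \<inter> S) x \<partial>count_space X)"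
        unfolding config_sum_def by (intro nn_integral_cong) (auto simp: indicator_def)
      then show ?thesis by (simp del: emeasure_count_space_finite)
    qed
    have "X \<subseteq> Rstar" using X by (simp add: Conf_def)
    then have "X \<inter> A = (\<Union>m. X \<inter> B m)" using UB by blast
    moreover have "(SUP m. emeasure (count_space X) (X \<inter> B m)) = emeasure (count_space X) (\<Union>m. X \<inter> B m)"
      using inc by (intro SUP_emeasure_incseq) (auto simp: incseq_def)
    ultimately show ?thesis by (simp only: e)
  qed
  have meas [measurable]: "config_sum (indicator (B m)) \<in> borel_measurable \<mu>" for m
  proof -
    have "(\<lambda>X. of_nat (card (X \<inter> B m)) :: ennreal) \<in> borel_measurable \<mu>"
      by (rule measurable_compose[OF card_measurable[OF rel]]) simp
    then show ?thesis
      by (subst measurable_cong[of _ _ "\<lambda>X. of_nat (card (X \<inter> B m))"])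
         (auto simp: space_mu config_sum_indicator[OF _ rel])
  qed
  have le: "(\<integral>\<^sup>+X. config_sum (indicator (B m)) X \<partial>\<mu>) \<le> emeasure \<nu> A" for m
  proof -
    have "(\<integral>\<^sup>+X. config_sum (indicator (B m)) X \<partial>\<mu>) = (\<integral>\<^sup>+X. ennreal (\<Prod>i\<in>{0::nat}. real (card (X \<inter> B m))) \<partial>\<mu>)"
      by (intro nn_integral_cong) (auto simp: space_mu config_sum_indicator[OF _ rel] ennreal_of_nat_eq_real_of_nat)
    also have "\<dots> \<le> ennreal (sqrt (card {0::nat}) ^ card {0::nat}) * (\<Prod>i\<in>{0::nat}. emeasure \<nu> (B m))"
      using rel by (intro correlation_bound) (auto simp: disjoint_family_on_def)
    also have "\<dots> = emeasure \<nu> (B m)" by simp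
    also have "\<dots> \<le> emeasure \<nu> A" by (intro emeasure_mono) (auto simp: B_def)
    finally show ?thesis .
  qed
  have csA: "config_sum (indicator A) \<in> borel_measurable \<mu>"
    by (subst measurable_cong[of _ _ "\<lambda>X. SUP m. config_sum (indicator (B m)) X"]) (auto simp: space_mu cs)
  have "(\<integral>\<^sup>+X. config_sum (indicator A) X \<partial>\<mu>) = (\<integral>\<^sup>+X. (SUP m. config_sum (indicator (B m)) X) \<partial>\<mu>)"
    by (intro nn_integral_cong) (auto simp: space_mu cs)
  also have "\<dots> = (SUP m. \<integral>\<^sup>+X. config_sum (indicator (B m)) X \<partial>\<mu>)"
  proof (rule nn_integral_monotone_convergence_SUP)
    show "incseq (\<lambda>m X. config_sum (indicator (B m)) X)"
      unfolding incseq_def le_fun_def config_sum_def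
    proof (intro allI impI nn_integral_mono)
      fix m n :: nat and x
      assume "m \<le> n"
      then have "B m \<subseteq> B n" using inc by (simp add: incseq_def)
      then show "indicator (B m) x \<le> (indicator (B n) x :: ennreal)" by (auto simp: indicator_def)
    qed
  qed measurable
  also have "\<dots> \<le> emeasure \<nu> A" by (intro SUP_least le)
  finally show ?case using csA by simp
next
  case (mult u c)
  have "config_sum (\<lambda>x. c * u x) = (\<lambda>X. c * config_sum u X)"
    unfolding config_sum_def by (intro ext nn_integral_cmult) simp
  moreover have "(\<integral>\<^sup>+x. c * u x \<partial>\<nu>) = c * (\<integral>\<^sup>+x. u x \<partial>\<nu>)"
    using mult(2) by (intro nn_integral_cmult) simp
  ultimately show ?case using mult(4) by (auto simp: nn_integral_cmult intro!: mult_left_mono)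
next
  case (add u v)
  have "config_sum (\<lambda>x. v x + u x) = (\<lambda>X. config_sum v X + config_sum u X)"
    unfolding config_sum_def by (intro ext nn_integral_add) simp_all
  moreover have "(\<integral>\<^sup>+x. v x + u x \<partial>\<nu>) = (\<integral>\<^sup>+x. v x \<partial>\<nu>) + (\<integral>\<^sup>+x. u x \<partial>\<nu>)"
    using add.hyps by (intro nn_integral_add) simp_all
  ultimately show ?case using add.IH by (auto simp: nn_integral_add intro!: add_mono)
next
  case (seq U)
  have cU: "config_sum (SUP i. U i) = (\<lambda>X. SUP i. config_sum (U i) X)"
    unfolding config_sum_def SUP_apply
    using \<open>incseq U\<close> by (intro ext nn_integral_monotone_convergence_SUP) (auto simp: incseq_def le_fun_def)
  have mU [measurable]: "config_sum (U i) \<in> borel_measurable \<mu>" for i using seq.IH by blast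
  have "(\<integral>\<^sup>+X. (SUP i. config_sum (U i) X) \<partial>\<mu>) = (SUP i. \<integral>\<^sup>+X. config_sum (U i) X \<partial>\<mu>)"
  proof (rule nn_integral_monotone_convergence_SUP)
    show "incseq (\<lambda>i X. config_sum (U i) X)"
      using \<open>incseq U\<close> unfolding incseq_def le_fun_def config_sum_def
      by (auto intro!: nn_integral_mono)
  qed measurable
  also have "\<dots> \<le> (\<integral>\<^sup>+x. (SUP i. U i) x \<partial>\<nu>)"
  proof (rule SUP_least)
    fix i
    have "(\<integral>\<^sup>+X. config_sum (U i) X \<partial>\<mu>) \<le> (\<integral>\<^sup>+x. U i x \<partial>\<nu>)" using seq.IH by blast
    also have "\<dots> \<le> (\<integral>\<^sup>+x. (SUP i. U i) x \<partial>\<nu>)"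
    proof (rule nn_integral_mono)
      fix x
      have "U i \<le> (SUP i. U i)" by (rule SUP_upper) simp
      then show "U i x \<le> (SUP i. U i) x" by (rule le_funD)
    qed
    finally show "(\<integral>\<^sup>+X. config_sum (U i) X \<partial>\<mu>) \<le> (\<integral>\<^sup>+x. (SUP i. U i) x \<partial>\<nu>)" .
  qed
  finally show ?case unfolding cU by simp
qed

lemma finite_AE:
  assumes A: "A \<in> sets borel" and fin: "emeasure \<nu> A < \<infinity>"
  shows "AE X in \<mu>. finite (X \<inter> A)"
proof -
  note c = campbell_bound[of "indicator A"]
  have "(\<integral>\<^sup>+X. config_sum (indicator A) X \<partial>\<mu>) < \<infinity>"
    using c A fin by (auto intro: le_less_trans)
  then have "AE X in \<mu>. config_sum (indicator A) X \<noteq> \<infinity>"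
    using c A by (intro nn_integral_noteq_infinite) auto
  then show ?thesis
  proof eventually_elim
    case (elim X)
    have "config_sum (indicator A) X = (\<integral>\<^sup>+x. indicator (X \<inter> A) x \<partial>count_space X)"
      unfolding config_sum_def by (intro nn_integral_cong) (auto simp: indicator_def)
    also have "\<dots> = emeasure (count_space X) (X \<inter> A)" by (simp del: emeasure_count_space_finite)
    finally show ?case using elim by (auto simp: emeasure_count_space split: if_splits)
  qed
qed

text \<open>
  The products $\prod_j (1 + t\,\#(X \cap D_j))$ over ever finer partitions converge to
  $(1+t)^{\#}$. Expanding the product gives correlation integrals over disjoint cells, whose sum is
  bounded independently of the partition by \<open>subset_sum_bound\<close>. Fatou's lemma passes to the limit. Working with
  disjoint cells avoids factorial moment measures on the diagonal.
\<close>

lemma exponential_moment: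
  assumes \<delta>: "0 < \<delta>" and t: "0 \<le> t" and fin: "emeasure \<nu> {x. \<delta> < \<bar>x\<bar>} < \<infinity>"
  shows "(\<integral>\<^sup>+X. ennreal ((1 + t) ^ card (X \<inter> {x. \<delta> < \<bar>x\<bar>})) \<partial>\<mu>) < \<infinity>"
proof -
  define E where "E = {x::real. \<delta> < \<bar>x\<bar>}"
  define v where "v = measure \<nu> E"
  define c where "c k = (t * sqrt (real k)) ^ k" for k :: nat
  define b where "b k = c k / real k ^ k * exp (real k * v)" for k :: nat
  have c0: "0 \<le> c k" for k using t by (simp add: c_def)
  have b0: "0 \<le> b k" for k using c0 by (simp add: b_def)
  have sb: "summable b" unfolding b_def c_def by (rule superexponential_summable[OF t])
  have Eb [measurable]: "E \<in> sets borel" unfolding E_def by measurable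
  have Ev: "emeasure \<nu> E = ennreal v"
    unfolding v_def using fin by (intro emeasure_eq_ennreal_measure) (auto simp: E_def)
  define Z where "Z q X = (\<Prod>j<2 * q\<^sup>2. 1 + t * real (card (X \<inter> mesh_cell \<delta> q j)))" for q X
  have cellb [measurable]: "mesh_cell \<delta> q j \<in> sets borel" for q j
    unfolding mesh_cell_def by measurable
  have cellE: "mesh_cell \<delta> q j \<subseteq> E" for q j by (auto simp: mesh_cell_def E_def)
  have cell_rel: "rel_compact_borel (mesh_cell \<delta> q j)" if "j < 2 * q\<^sup>2" for q j
    using that by (intro mesh_cell_rel_compact \<delta>) (auto intro: Nat.gr0I)
  have card_real [measurable]: "(\<lambda>X. real (card (X \<inter> mesh_cell \<delta> q j))) \<in> borel_measurable \<mu>"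
    if "j \<in> {..<2 * q\<^sup>2}" for q j
    by (rule measurable_compose[OF card_measurable[OF cell_rel]]) (use that in simp_all)
  have Zm: "Z q \<in> borel_measurable \<mu>" for q
    unfolding Z_def by (intro borel_measurable_prod borel_measurable_add borel_measurable_times card_real) auto
  have Zb: "(\<integral>\<^sup>+X. ennreal (Z q X) \<partial>\<mu>) \<le> ennreal (suminf b)" for q
  proof -
    define J where "J = {..<2 * q\<^sup>2}"
    define a where "a j = measure \<nu> (mesh_cell \<delta> q j)" for j
    have a0: "0 \<le> a j" for j by (simp add: a_def)
    have aj: "emeasure \<nu> (mesh_cell \<delta> q j) = ennreal (a j)" for j
    proof -
      have "emeasure \<nu> (mesh_cell \<delta> q j) \<le> emeasure \<nu> E"
        by (intro emeasure_mono cellE) simp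
      then show ?thesis unfolding a_def Ev
        by (intro emeasure_eq_ennreal_measure) (auto simp: top_unique)
    qed
    have sum_a: "(\<Sum>j\<in>J. a j) \<le> v"
    proof -
      have "ennreal (\<Sum>j\<in>J. a j) = (\<Sum>j\<in>J. emeasure \<nu> (mesh_cell \<delta> q j))"
        by (simp add: aj a0 sum_ennreal)
      also have "\<dots> = emeasure \<nu> (\<Union>j\<in>J. mesh_cell \<delta> q j)"
        by (rule sum_emeasure) (auto simp: J_def mesh_cell_disjoint)
      also have "\<dots> \<le> emeasure \<nu> E" using cellE by (intro emeasure_mono) auto
      finally show ?thesis unfolding Ev by (simp add: v_def)
    qed
    have "(\<integral>\<^sup>+X. ennreal (Z q X) \<partial>\<mu>)
        = (\<integral>\<^sup>+X. (\<Sum>S\<in>Pow J. ennreal (t ^ card S) * ennreal (\<Prod>j\<in>S. real (card (X \<inter> mesh_cell \<delta> q j)))) \<partial>\<mu>)"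
    proof (intro nn_integral_cong)
      fix X
      have "Z q X = (\<Sum>S\<in>Pow J. t ^ card S * (\<Prod>j\<in>S. real (card (X \<inter> mesh_cell \<delta> q j))))"
        using prod_add[of J "\<lambda>j. t * real (card (X \<inter> mesh_cell \<delta> q j))" "\<lambda>_. 1"]
        by (simp add: Z_def J_def add.commute prod.distrib)
      then show "ennreal (Z q X) = (\<Sum>S\<in>Pow J. ennreal (t ^ card S) * ennreal (\<Prod>j\<in>S. real (card (X \<inter> mesh_cell \<delta> q j))))"
        using t by (simp add: sum_ennreal[symmetric] ennreal_mult prod_nonneg)
    qed
    also have "\<dots> = (\<Sum>S\<in>Pow J. \<integral>\<^sup>+X. ennreal (t ^ card S) * ennreal (\<Prod>j\<in>S. real (card (X \<inter> mesh_cell \<delta> q j))) \<partial>\<mu>)"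
    proof (rule nn_integral_sum)
      fix S assume "S \<in> Pow J"
      then have "j \<in> {..<2 * q\<^sup>2}" if "j \<in> S" for j using that by (auto simp: J_def)
      then have "(\<lambda>X. \<Prod>j\<in>S. real (card (X \<inter> mesh_cell \<delta> q j))) \<in> borel_measurable \<mu>"
        by (intro borel_measurable_prod card_real)
      from measurable_compose[OF this measurable_ennreal]
      show "(\<lambda>X. ennreal (t ^ card S) * ennreal (\<Prod>j\<in>S. real (card (X \<inter> mesh_cell \<delta> q j)))) \<in> borel_measurable \<mu>"
        by (intro borel_measurable_times_ennreal borel_measurable_const)
    qed
    also have "\<dots> \<le> (\<Sum>S\<in>Pow J. ennreal (c (card S) * (\<Prod>j\<in>S. a j)))"
    proof (rule sum_mono)
      fix S assume S: "S \<in> Pow J"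
      then have "j \<in> {..<2 * q\<^sup>2}" if "j \<in> S" for j using that by (auto simp: J_def)
      then have "(\<lambda>X. \<Prod>j\<in>S. real (card (X \<inter> mesh_cell \<delta> q j))) \<in> borel_measurable \<mu>"
        by (intro borel_measurable_prod card_real)
      then have "(\<integral>\<^sup>+X. ennreal (t ^ card S) * ennreal (\<Prod>j\<in>S. real (card (X \<inter> mesh_cell \<delta> q j))) \<partial>\<mu>)
          = ennreal (t ^ card S) * (\<integral>\<^sup>+X. ennreal (\<Prod>j\<in>S. real (card (X \<inter> mesh_cell \<delta> q j))) \<partial>\<mu>)"
        by (intro nn_integral_cmult measurable_compose[OF _ measurable_ennreal])
      also have "\<dots> \<le> ennreal (t ^ card S) * (ennreal (sqrt (card S) ^ card S) * (\<Prod>j\<in>S. emeasure \<nu> (mesh_cell \<delta> q j)))"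
        using S by (intro mult_left_mono correlation_bound cell_rel mesh_cell_disjoint)
          (auto simp: J_def intro: finite_subset)
      also have "\<dots> = ennreal (c (card S) * (\<Prod>j\<in>S. a j))"
        using t by (simp add: aj prod_ennreal a0 c_def power_mult_distrib ennreal_mult prod_nonneg mult.assoc)
      finally show "(\<integral>\<^sup>+X. ennreal (t ^ card S) * ennreal (\<Prod>j\<in>S. real (card (X \<inter> mesh_cell \<delta> q j))) \<partial>\<mu>)
          \<le> ennreal (c (card S) * (\<Prod>j\<in>S. a j))" .
    qed
    also have "\<dots> = ennreal (\<Sum>S\<in>Pow J. c (card S) * (\<Prod>j\<in>S. a j))"
      by (intro sum_ennreal mult_nonneg_nonneg c0 prod_nonneg a0)
    also have "\<dots> \<le> ennreal (suminf b)"
    proof (rule ennreal_leI)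
      have "(\<Sum>S\<in>Pow J. c (card S) * (\<Prod>j\<in>S. a j)) \<le> (\<Sum>k\<le>card J. c k / real k ^ k * exp (real k * (\<Sum>j\<in>J. a j)))"
        by (rule subset_sum_bound) (auto simp: J_def a0 c0)
      also have "\<dots> \<le> (\<Sum>k\<le>card J. b k)"
        unfolding b_def using sum_a c0 by (intro sum_mono mult_left_mono) (auto intro!: mult_left_mono)
      also have "\<dots> \<le> suminf b" by (intro sum_le_suminf sb b0) auto
      finally show "(\<Sum>S\<in>Pow J. c (card S) * (\<Prod>j\<in>S. a j)) \<le> suminf b" .
    qed
    finally show ?thesis .
  qed
  have "(\<integral>\<^sup>+X. ennreal ((1 + t) ^ card (X \<inter> E)) \<partial>\<mu>) \<le> (\<integral>\<^sup>+X. liminf (\<lambda>q. ennreal (Z q X)) \<partial>\<mu>)"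
  proof (rule nn_integral_mono_AE)
    have "AE X in \<mu>. finite (X \<inter> E)" using fin by (intro finite_AE) (auto simp: E_def)
    then show "AE X in \<mu>. ennreal ((1 + t) ^ card (X \<inter> E)) \<le> liminf (\<lambda>q. ennreal (Z q X))"
    proof eventually_elim
      case (elim X)
      have "X \<inter> E \<inter> mesh_cell \<delta> q j = X \<inter> mesh_cell \<delta> q j" for q j using cellE by blast
      with mesh_separates[OF elim, of \<delta> t]
      have "eventually (\<lambda>q. Z q X = (1 + t) ^ card (X \<inter> E)) sequentially"
        by (simp add: Z_def E_def)
      then have "(\<lambda>q. ennreal (Z q X)) \<longlonglongrightarrow> ennreal ((1 + t) ^ card (X \<inter> E))"
        by (intro tendsto_eventually) (auto elim: eventually_mono)
      then show ?case by (simp add: lim_imp_Liminf)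
    qed
  qed
  also have "\<dots> \<le> liminf (\<lambda>q. \<integral>\<^sup>+X. ennreal (Z q X) \<partial>\<mu>)"
    using Zm by (intro nn_integral_liminf) measurable
  also have "\<dots> \<le> liminf (\<lambda>q. ennreal (suminf b))"
    by (intro Liminf_mono always_eventually allI Zb)
  also have "\<dots> = ennreal (suminf b)" by (simp add: Liminf_const)
  also have "\<dots> < \<infinity>" by simp
  finally show ?thesis by (simp add: E_def)
qed

end

section \<open>Regularized linear statistics\<close>

lemma mono_at_right_converges:
  fixes g :: "real \<Rightarrow> real"
  assumes \<epsilon>: "0 < \<epsilon>" and mono: "\<And>s t. 0 < s \<Longrightarrow> s \<le> t \<Longrightarrow> t \<le> \<epsilon> \<Longrightarrow> g s \<le> g t"
    and bdd: "\<And>s. 0 < s \<Longrightarrow> s \<le> \<epsilon> \<Longrightarrow> b \<le> g s"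
  shows "\<exists>l. (g \<longlongrightarrow> l) (at_right 0)"
proof -
  define l where "l = Inf (g ` {0<..\<epsilon>})"
  have bb: "bdd_below (g ` {0<..\<epsilon>})" using bdd by (auto intro!: bdd_belowI[of _ b])
  have ne: "g ` {0<..\<epsilon>} \<noteq> {}" using \<epsilon> by auto
  have "(g \<longlongrightarrow> l) (at_right 0)"
  proof (rule order_tendstoI)
    fix a assume a: "a < l"
    have "a < g s" if "0 < s" "s < \<epsilon>" for s
    proof -
      have "l \<le> g s" unfolding l_def using that by (intro cInf_lower bb) auto
      then show ?thesis using a by simp
    qed
    then show "eventually (\<lambda>s. a < g s) (at_right 0)"
      unfolding eventually_at_right_field using \<epsilon> by blast
  next
    fix a assume "l < a"
    then obtain t where t: "0 < t" "t \<le> \<epsilon>" "g t < a"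
      unfolding l_def using cInf_less_iff[OF ne bb] by auto
    have "g s < a" if "0 < s" "s < t" for s
      using mono[of s t] that t by auto
    then show "eventually (\<lambda>s. g s < a) (at_right 0)"
      unfolding eventually_at_right_field using t by blast
  qed
  then show ?thesis by blast
qed

text \<open>
  The Bochner integral takes the value 0 on families that are not summable, exactly as the infinite
  sum does; see \<open>infsum_eq_lebesgue\<close>.
\<close>

definition line_sum :: "(real \<Rightarrow> real) \<Rightarrow> real set \<Rightarrow> real \<Rightarrow> real" where
  "line_sum G X \<delta> = (LINT x|count_space X. indicator {x. \<delta> < \<bar>x\<bar>} x * G x)"

lemma infsum_eq_lebesgue:
  fixes F :: "real \<Rightarrow> real"
  shows "infsum F (X \<inter> B) = (LINT x|count_space X. indicator B x * F x)"
proof -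
  have ind: "indicator (X \<inter> B) x * F x = indicator B x * F x" if "x \<in> X" for x
    using that by (simp add: indicator_def)
  have iff: "Infinite_Set_Sum.abs_summable_on F (X \<inter> B) \<longleftrightarrow> integrable (count_space X) (\<lambda>x. indicator B x * F x)"
    unfolding abs_summable_on_altdef'[of "X \<inter> B" X F, OF Int_lower1] set_integrable_def
    by (intro Bochner_Integration.integrable_cong refl) (simp add: indicator_def)
  show ?thesis
  proof (cases "Infinite_Set_Sum.abs_summable_on F (X \<inter> B)")
    case True
    then have "infsum F (X \<inter> B) = infsetsum F (X \<inter> B)" by (simp add: infsetsum_infsum)
    also have "\<dots> = (LINT x|count_space X. indicator B x * F x)"
      unfolding infsetsum_altdef'[of "X \<inter> B" X, OF Int_lower1] set_lebesgue_integral_def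
      by (intro Bochner_Integration.integral_cong refl) (simp add: indicator_def)
    finally show ?thesis .
  next
    case False
    then have "\<not> F summable_on (X \<inter> B)"
      using abs_summable_equivalent[of F "X \<inter> B"] summable_on_iff_abs_summable_on_real[of F "X \<inter> B"] by blast
    then have "infsum F (X \<inter> B) = 0" by (rule infsum_not_exists)
    then show ?thesis using False iff by (simp add: not_integrable_integral_eq)
  qed
qed

lemma abs_line_sum_le: "ennreal \<bar>line_sum G X \<delta>\<bar> \<le> config_sum (\<lambda>x. ennreal \<bar>G x\<bar>) X"
proof (cases "integrable (count_space X) (\<lambda>x. indicator {x. \<delta> < \<bar>x\<bar>} x * G x)")
  case True
  have "ennreal (norm (line_sum G X \<delta>)) \<le> (\<integral>\<^sup>+x. ennreal (norm (indicator {x. \<delta> < \<bar>x\<bar>} x * G x)) \<partial>count_space X)"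
    unfolding line_sum_def by (rule integral_norm_bound_ennreal[OF True])
  also have "\<dots> \<le> config_sum (\<lambda>x. ennreal \<bar>G x\<bar>) X"
    unfolding config_sum_def by (intro nn_integral_mono) (auto simp: indicator_def)
  finally show ?thesis by simp
next
  case False
  then show ?thesis by (simp add: line_sum_def not_integrable_integral_eq)
qed

lemma Conf_annulus_finite:
  assumes "X \<in> Conf" "0 < s"
  shows "finite (X \<inter> {x. s \<le> \<bar>x\<bar> \<and> \<bar>x\<bar> \<le> t})"
proof -
  have "{x::real. s \<le> \<bar>x\<bar> \<and> \<bar>x\<bar> \<le> t} = {-t..t} - {-s<..<s}" by auto
  moreover have "compact ({-t..t} - {-s<..<s})" by (rule compact_diff) auto
  ultimately have "compact {x::real. s \<le> \<bar>x\<bar> \<and> \<bar>x\<bar> \<le> t}" by simp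
  moreover have "{x::real. s \<le> \<bar>x\<bar> \<and> \<bar>x\<bar> \<le> t} \<subseteq> Rstar" using assms(2) by auto
  ultimately show ?thesis using assms(1) by (auto simp: Conf_def)
qed

text \<open>
  Lowering the cutoff adds finitely many nonpositive terms. If the sum diverges, it diverges for both
  cutoffs and both sides are 0.
\<close>

lemma line_sum_mono:
  assumes X: "X \<in> Conf" and neg: "\<And>x. \<bar>x\<bar> \<le> \<epsilon> \<Longrightarrow> G x \<le> 0"
    and st: "0 < s" "s \<le> t" "t \<le> \<epsilon>"
  shows "line_sum G X s \<le> line_sum G X t"
proof -
  let ?f = "\<lambda>s x. indicator {x. s < \<bar>x\<bar>} x * G x :: real"
  have fin: "finite {x \<in> X. ?f s x - ?f t x \<noteq> 0}"
    by (rule finite_subset[OF _ Conf_annulus_finite[OF X st(1), of t]]) (use st in \<open>auto simp: indicator_def split: if_splits\<close>)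
  have d: "integrable (count_space X) (\<lambda>x. ?f s x - ?f t x)"
  proof -
    have "Infinite_Set_Sum.abs_summable_on (\<lambda>x. ?f s x - ?f t x) X
        \<longleftrightarrow> Infinite_Set_Sum.abs_summable_on (\<lambda>x. ?f s x - ?f t x) {x \<in> X. ?f s x - ?f t x \<noteq> 0}"
      by (rule abs_summable_on_cong_neutral) auto
    moreover have "Infinite_Set_Sum.abs_summable_on (\<lambda>x. ?f s x - ?f t x) {x \<in> X. ?f s x - ?f t x \<noteq> 0}"
      using fin by (rule abs_summable_on_finite)
    ultimately show ?thesis unfolding Infinite_Set_Sum.abs_summable_on_def by blast
  qed
  have le: "?f s x \<le> ?f t x" for x
    using neg[of x] st by (auto simp: indicator_def)
  show ?thesis
  proof (cases "integrable (count_space X) (?f s)")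
    case True
    have "integrable (count_space X) (?f t)"
      using Bochner_Integration.integrable_diff[OF True d] by simp
    then show ?thesis unfolding line_sum_def using True le by (intro integral_mono)
  next
    case False
    have "\<not> integrable (count_space X) (?f t)"
    proof
      assume "integrable (count_space X) (?f t)"
      from Bochner_Integration.integrable_add[OF d this] False show False by simp
    qed
    then show ?thesis using False by (simp add: line_sum_def not_integrable_integral_eq)
  qed
qed

lemma line_sum_le_card:
  assumes fin: "finite (X \<inter> {x. \<epsilon> < \<bar>x\<bar>})" and neg: "\<And>x. \<bar>x\<bar> \<le> \<epsilon> \<Longrightarrow> G x \<le> 0"
    and le: "\<And>x. G x \<le> c" and c: "0 \<le> c"
  shows "line_sum G X s \<le> c * real (card (X \<inter> {x. \<epsilon> < \<bar>x\<bar>}))"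
proof (cases "integrable (count_space X) (\<lambda>x. indicator {x. s < \<bar>x\<bar>} x * G x)")
  case True
  let ?E = "{x::real. \<epsilon> < \<bar>x\<bar>}"
  have "emeasure (count_space X) (X \<inter> ?E) = ennreal (real (card (X \<inter> ?E)))"
    using fin by (simp add: ennreal_of_nat_eq_real_of_nat)
  then have m: "measure (count_space X) (X \<inter> ?E) = real (card (X \<inter> ?E))" "emeasure (count_space X) (X \<inter> ?E) < \<infinity>"
    by (simp_all add: measure_def)
  have i: "integrable (count_space X) (\<lambda>x. c * indicator (X \<inter> ?E) x)"
    using m(2) by (intro integrable_mult_right) simp
  have "line_sum G X s \<le> (LINT x|count_space X. c * indicator (X \<inter> ?E) x)"
    unfolding line_sum_def
  proof (rule integral_mono[OF True i])
    fix x assume "x \<in> space (count_space X)"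
    then show "indicator {x. s < \<bar>x\<bar>} x * G x \<le> c * indicator (X \<inter> ?E) x"
      using neg[of x] le[of x] c by (auto simp: indicator_def not_less)
  qed
  also have "\<dots> = c * real (card (X \<inter> ?E))"
  proof -
    have "X \<inter> ?E \<inter> X = X \<inter> ?E" by blast
    then show ?thesis using m(1) by simp
  qed
  finally show ?thesis .
next
  case False
  then show ?thesis using c by (simp add: line_sum_def not_integrable_integral_eq)
qed

context dominated_process begin

text \<open>
  Where the sum converges it is the difference of the sums over positive and negative parts, and the
  set where it converges is measurable.
\<close>

lemma line_sum_measurable:
  assumes G [measurable]: "G \<in> borel_measurable borel"
  shows "(\<lambda>X. line_sum G X \<delta>) \<in> borel_measurable \<mu>"
proof -
  let ?g = "\<lambda>x. indicator {x. \<delta> < \<bar>x\<bar>} x * G x"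
  have m: "config_sum F \<in> borel_measurable \<mu>" if "F \<in> borel_measurable borel" for F
    using campbell_bound[OF that] by blast
  have [measurable]: "config_sum (\<lambda>x. ennreal \<bar>?g x\<bar>) \<in> borel_measurable \<mu>"
    "config_sum (\<lambda>x. ennreal (?g x)) \<in> borel_measurable \<mu>"
    "config_sum (\<lambda>x. ennreal (- ?g x)) \<in> borel_measurable \<mu>"
    by (rule m, measurable)+
  have "line_sum G X \<delta> = (if config_sum (\<lambda>x. ennreal \<bar>?g x\<bar>) X < \<infinity>
      then enn2real (config_sum (\<lambda>x. ennreal (?g x)) X) - enn2real (config_sum (\<lambda>x. ennreal (- ?g x)) X) else 0)" for X
  proof (cases "integrable (count_space X) ?g")
    case True
    then show ?thesis unfolding line_sum_def config_sum_def
      by (simp add: real_lebesgue_integral_def[OF True] integrable_iff_bounded)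
  next
    case False
    then show ?thesis unfolding line_sum_def config_sum_def
      by (simp add: not_integrable_integral_eq integrable_iff_bounded)
  qed
  then show ?thesis by simp
qed

end

text \<open>
  The summands \<open>G j\<close> are bounded above, nonpositive near the origin, and absolutely integrable
  against the dominating measure. They are summed separately because the convention for divergent
  sums applies to each of them individually.
\<close>

locale linear_statistic = dominated_process \<mu> K w
  for \<mu> K w +
  fixes J :: "'i set" and G :: "'i \<Rightarrow> real \<Rightarrow> real" and \<epsilon> c :: real
  assumes J: "finite J"
    and G_measurable: "\<And>j. j \<in> J \<Longrightarrow> G j \<in> borel_measurable borel"
    and G_integrable: "\<And>j. j \<in> J \<Longrightarrow> (\<integral>\<^sup>+x. ennreal \<bar>G j x\<bar> \<partial>\<nu>) < \<infinity>"
    and \<epsilon>: "0 < \<epsilon>"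
    and G_neg: "\<And>j x. j \<in> J \<Longrightarrow> \<bar>x\<bar> \<le> \<epsilon> \<Longrightarrow> G j x \<le> 0"
    and c: "0 \<le> c"
    and G_le: "\<And>j x. j \<in> J \<Longrightarrow> G j x \<le> c"
    and tail_finite: "emeasure \<nu> {x. \<epsilon> < \<bar>x\<bar>} < \<infinity>"
begin

definition S :: "real set \<Rightarrow> real \<Rightarrow> real" where
  "S X \<delta> = (\<Sum>j\<in>J. line_sum (G j) X \<delta>)"

text \<open>
  An integrable majorant of all truncated sums at once.
\<close>

definition total :: "real set \<Rightarrow> ennreal" where
  "total X = (\<Sum>j\<in>J. config_sum (\<lambda>x. ennreal \<bar>G j x\<bar>) X)"

lemma S_measurable [measurable]: "(\<lambda>X. S X \<delta>) \<in> borel_measurable \<mu>"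
  unfolding S_def by (intro borel_measurable_sum line_sum_measurable G_measurable)

lemma total_measurable [measurable]: "total \<in> borel_measurable \<mu>"
proof -
  have "config_sum (\<lambda>x. ennreal \<bar>G j x\<bar>) \<in> borel_measurable \<mu>" if "j \<in> J" for j
  proof -
    note [measurable] = G_measurable[OF that]
    show ?thesis using campbell_bound[of "\<lambda>x. ennreal \<bar>G j x\<bar>"] by simp
  qed
  then show ?thesis unfolding total_def[abs_def] by (intro borel_measurable_sum) auto
qed

lemma total_finite: "(\<integral>\<^sup>+X. total X \<partial>\<mu>) < \<infinity>"
proof -
  have m: "config_sum (\<lambda>x. ennreal \<bar>G j x\<bar>) \<in> borel_measurable \<mu> \<and>
      (\<integral>\<^sup>+X. config_sum (\<lambda>x. ennreal \<bar>G j x\<bar>) X \<partial>\<mu>) \<le> (\<integral>\<^sup>+x. ennreal \<bar>G j x\<bar> \<partial>\<nu>)" if "j \<in> J" for j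
  proof -
    note [measurable] = G_measurable[OF that]
    show ?thesis by (rule campbell_bound) measurable
  qed
  have "(\<integral>\<^sup>+X. total X \<partial>\<mu>) = (\<Sum>j\<in>J. \<integral>\<^sup>+X. config_sum (\<lambda>x. ennreal \<bar>G j x\<bar>) X \<partial>\<mu>)"
    unfolding total_def using m by (intro nn_integral_sum) auto
  also have "\<dots> \<le> (\<Sum>j\<in>J. \<integral>\<^sup>+x. ennreal \<bar>G j x\<bar> \<partial>\<nu>)"
    using m by (intro sum_mono) auto
  also have "\<dots> < \<infinity>"
  proof -
    have "(\<Sum>j\<in>I. \<integral>\<^sup>+x. ennreal \<bar>G j x\<bar> \<partial>\<nu>) < \<infinity>" if "finite I" "I \<subseteq> J" for I
      using that by (induction I) (use G_integrable in auto)
    then show ?thesis using J by blast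
  qed
  finally show ?thesis .
qed

lemma S_le_total: "ennreal \<bar>S X \<delta>\<bar> \<le> total X"
proof -
  have "ennreal \<bar>S X \<delta>\<bar> \<le> ennreal (\<Sum>j\<in>J. \<bar>line_sum (G j) X \<delta>\<bar>)"
    unfolding S_def by (intro ennreal_leI sum_abs)
  also have "\<dots> = (\<Sum>j\<in>J. ennreal \<bar>line_sum (G j) X \<delta>\<bar>)" by (simp add: sum_ennreal)
  also have "\<dots> \<le> total X" unfolding total_def by (intro sum_mono abs_line_sum_le)
  finally show ?thesis .
qed

lemma S_mono:
  assumes "X \<in> Conf" "0 < s" "s \<le> t" "t \<le> \<epsilon>"
  shows "S X s \<le> S X t"
  unfolding S_def using assms G_neg by (intro sum_mono line_sum_mono) auto

lemma S_integrable: "integrable \<mu> (\<lambda>X. S X \<delta>)"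
proof (rule integrableI_bounded)
  have "(\<integral>\<^sup>+X. ennreal (norm (S X \<delta>)) \<partial>\<mu>) \<le> (\<integral>\<^sup>+X. total X \<partial>\<mu>)"
    by (intro nn_integral_mono) (simp add: S_le_total)
  then show "(\<integral>\<^sup>+X. ennreal (norm (S X \<delta>)) \<partial>\<mu>) < \<infinity>" using total_finite by (rule le_less_trans)
qed measurable

lemma mean_converges: "\<exists>m. ((\<lambda>\<delta>. LINT X|\<mu>. S X \<delta>) \<longlongrightarrow> m) (at_right 0)"
proof (rule mono_at_right_converges[OF \<epsilon>])
  fix s t assume "0 < s" "s \<le> t" "t \<le> \<epsilon>"
  then show "(LINT X|\<mu>. S X s) \<le> (LINT X|\<mu>. S X t)"
    by (intro integral_mono S_integrable S_mono) (auto simp: space_mu)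
next
  fix s
  have "ennreal \<bar>LINT X|\<mu>. S X s\<bar> \<le> (\<integral>\<^sup>+X. ennreal (norm (S X s)) \<partial>\<mu>)"
    using integral_norm_bound_ennreal[OF S_integrable[of s]] by simp
  also have "\<dots> \<le> (\<integral>\<^sup>+X. total X \<partial>\<mu>)"
    by (intro nn_integral_mono) (simp add: S_le_total)
  also have "\<dots> = ennreal (enn2real (\<integral>\<^sup>+X. total X \<partial>\<mu>))"
    using total_finite by (simp add: ennreal_enn2real_if)
  finally have "\<bar>LINT X|\<mu>. S X s\<bar> \<le> enn2real (\<integral>\<^sup>+X. total X \<partial>\<mu>)" by simp
  then show "- enn2real (\<integral>\<^sup>+X. total X \<partial>\<mu>) \<le> (LINT X|\<mu>. S X s)" by linarith
qed

lemma S_converges_AE: "AE X in \<mu>. \<exists>l. (S X \<longlongrightarrow> l) (at_right 0)"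
proof -
  have "AE X in \<mu>. total X \<noteq> \<infinity>"
    using total_finite by (intro nn_integral_noteq_infinite) auto
  then show ?thesis using AE_space
  proof eventually_elim
    case (elim X)
    show ?case
    proof (rule mono_at_right_converges[OF \<epsilon>])
      show "S X s \<le> S X t" if "0 < s" "s \<le> t" "t \<le> \<epsilon>" for s t
        using elim that by (intro S_mono) (auto simp: space_mu)
      fix s
      have "ennreal \<bar>S X s\<bar> \<le> ennreal (enn2real (total X))"
        using S_le_total[of X s] elim by (simp add: ennreal_enn2real_if)
      then have "\<bar>S X s\<bar> \<le> enn2real (total X)" by simp
      then show "- enn2real (total X) \<le> S X s" by linarith
    qed
  qed
qed

definition centered :: "real set \<Rightarrow> real \<Rightarrow> real" where
  "centered X \<delta> = S X \<delta> - (LINT Y|\<mu>. S Y \<delta>)"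

lemma centered_converges_AE: "AE X in \<mu>. \<exists>l. (centered X \<longlongrightarrow> l) (at_right 0)"
  using S_converges_AE
proof eventually_elim
  case (elim X)
  then obtain l where "(S X \<longlongrightarrow> l) (at_right 0)" by blast
  moreover obtain m where "((\<lambda>\<delta>. LINT X|\<mu>. S X \<delta>) \<longlongrightarrow> m) (at_right 0)" using mean_converges by blast
  ultimately have "(centered X \<longlongrightarrow> l - m) (at_right 0)"
    unfolding centered_def[abs_def] by (rule tendsto_diff)
  then show ?case by blast
qed

text \<open>
  The truncated sums are monotone and their means converge, so the behaviour along a single sequence
  of cutoffs decides the convergence. As this holds for every configuration, the limit, including the
  default value that it takes when there is no convergence, is the limit of a sequence of measurable
  functions.
\<close>

lemma centered_sequentially:
  assumes X: "X \<in> Conf"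
  shows "(centered X \<longlongrightarrow> l) (at_right 0) \<longleftrightarrow> (\<lambda>m. centered X (\<epsilon> / real (Suc m))) \<longlonglongrightarrow> l"
proof -
  obtain e where e: "((\<lambda>\<delta>. LINT X|\<mu>. S X \<delta>) \<longlongrightarrow> e) (at_right 0)" using mean_converges by blast
  define d where "d m = \<epsilon> / real (Suc m)" for m
  have d: "0 < d m" "d m \<le> \<epsilon>" for m using \<epsilon> by (auto simp: d_def divide_le_eq)
  have d0: "d \<longlonglongrightarrow> 0"
    unfolding d_def by (rule LIMSEQ_Suc[OF lim_const_over_n])
  have dr: "filterlim d (at_right 0) sequentially"
    by (rule tendsto_imp_filterlim_at_right[OF d0]) (simp add: d(1))
  show ?thesis unfolding d_def[symmetric]
  proof
    assume "(centered X \<longlongrightarrow> l) (at_right 0)"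
    then show "(\<lambda>m. centered X (d m)) \<longlonglongrightarrow> l" using dr by (rule filterlim_compose)
  next
    assume lim: "(\<lambda>m. centered X (d m)) \<longlonglongrightarrow> l"
    have "(\<lambda>m. centered X (d m) + (LINT X|\<mu>. S X (d m))) \<longlonglongrightarrow> l + e"
      by (intro tendsto_add lim filterlim_compose[OF e dr])
    then have lim': "(\<lambda>m. S X (d m)) \<longlonglongrightarrow> l + e" by (simp add: centered_def)
    have "Bseq (\<lambda>m. S X (d m))" by (rule convergent_imp_Bseq[OF convergentI[OF lim']])
    then obtain b where b: "\<And>m. \<bar>S X (d m)\<bar> \<le> b" by (auto simp: Bseq_def)
    have "\<exists>l. (S X \<longlongrightarrow> l) (at_right 0)"
    proof (rule mono_at_right_converges[OF \<epsilon>])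
      show "S X s \<le> S X t" if "0 < s" "s \<le> t" "t \<le> \<epsilon>" for s t
        using X that by (intro S_mono)
      fix s assume s: "0 < s" "s \<le> \<epsilon>"
      have "eventually (\<lambda>m. d m < s) sequentially" using d0 s(1) by (rule order_tendstoD(2))
      then obtain m where "d m < s" by (auto simp: eventually_sequentially)
      then have "S X (d m) \<le> S X s" using X d s by (intro S_mono) auto
      then show "- b \<le> S X s" using b[of m] by linarith
    qed
    then obtain l' where l': "(S X \<longlongrightarrow> l') (at_right 0)" by blast
    have "(\<lambda>m. S X (d m)) \<longlonglongrightarrow> l'" by (rule filterlim_compose[OF l' dr])
    then have "l' = l + e" using lim' by (rule LIMSEQ_unique)
    then have "((\<lambda>\<delta>. S X \<delta> - (LINT X|\<mu>. S X \<delta>)) \<longlongrightarrow> (l + e) - e) (at_right 0)"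
      using l' e by (intro tendsto_diff) auto
    then show "(centered X \<longlongrightarrow> l) (at_right 0)" unfolding centered_def[abs_def] by simp
  qed
qed

definition limit :: "real set \<Rightarrow> real" where
  "limit X = Lim (at_right 0) (centered X)"

lemma limit_measurable: "limit \<in> borel_measurable \<mu>"
proof -
  have "(\<lambda>X. lim (\<lambda>m. centered X (\<epsilon> / real (Suc m)))) \<in> borel_measurable \<mu>"
    unfolding centered_def by measurable
  moreover have "limit X = lim (\<lambda>m. centered X (\<epsilon> / real (Suc m)))" if "X \<in> space \<mu>" for X
    using that unfolding limit_def t2_space_class.Lim_def lim_def
    by (simp add: centered_sequentially space_mu)
  ultimately show ?thesis by (subst measurable_cong) auto
qed

text \<open>
  The centered limit differs from the limit of the sums by a constant, and almost surely each of the sums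
  is at most \<open>c\<close> times the number of points outside the \<open>\<epsilon>\<close>-neighbourhood of the origin.
\<close>

lemma exp_limit_integrable: "integrable \<mu> (\<lambda>X. exp (limit X))"
proof -
  note [measurable] = limit_measurable
  obtain e where e: "((\<lambda>\<delta>. LINT X|\<mu>. S X \<delta>) \<longlongrightarrow> e) (at_right 0)" using mean_converges by blast
  \<comment> \<open>With this \<open>t\<close>, \<open>(1 + t) ^ N\<close> is the exponential of \<open>card J * c * N\<close>.\<close>
  define t where "t = exp (real (card J) * c) - 1"
  have t: "0 \<le> t" using c by (simp add: t_def)
  let ?N = "\<lambda>X. card (X \<inter> {x. \<epsilon> < \<bar>x\<bar>})"
  have "integrable \<mu> (\<lambda>X. exp (limit X + e))"
  proof (rule integrableI_bounded)
    have fin: "AE X in \<mu>. finite (X \<inter> {x. \<epsilon> < \<bar>x\<bar>})"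
      by (intro finite_AE tail_finite) measurable
    have "AE X in \<mu>. ennreal (norm (exp (limit X + e))) \<le> ennreal ((1 + t) ^ ?N X)"
      using S_converges_AE fin AE_space
    proof eventually_elim
      case (elim X)
      then obtain l where l: "(S X \<longlongrightarrow> l) (at_right 0)" by blast
      have "(centered X \<longlongrightarrow> l - e) (at_right 0)"
        unfolding centered_def[abs_def] by (intro tendsto_diff l e)
      then have lim: "limit X = l - e"
        unfolding limit_def by (intro tendsto_Lim) simp
      have "l \<le> real (?N X) * (real (card J) * c)"
      proof (rule tendsto_upperbound[OF l])
        have "S X s \<le> real (?N X) * (real (card J) * c)" for s
        proof -
          have "S X s \<le> (\<Sum>j\<in>J. c * real (?N X))"
            unfolding S_def using elim(2) G_neg G_le c by (intro sum_mono line_sum_le_card) auto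
          then show ?thesis by (simp add: mult_ac)
        qed
        then show "eventually (\<lambda>s. S X s \<le> real (?N X) * (real (card J) * c)) (at_right 0)" by simp
      qed simp
      then have "exp (limit X + e) \<le> exp (real (?N X) * (real (card J) * c))"
        by (simp add: lim)
      also have "\<dots> = (1 + t) ^ ?N X"
      proof -
        have "1 + t = exp (real (card J) * c)" by (simp add: t_def)
        then show ?thesis by (simp only: exp_of_nat_mult)
      qed
      finally show ?case by (simp add: ennreal_leI)
    qed
    then have "(\<integral>\<^sup>+X. ennreal (norm (exp (limit X + e))) \<partial>\<mu>) \<le> (\<integral>\<^sup>+X. ennreal ((1 + t) ^ ?N X) \<partial>\<mu>)"
      by (rule nn_integral_mono_AE)
    also have "\<dots> < \<infinity>" by (rule exponential_moment[OF \<epsilon> t tail_finite])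
    finally show "(\<integral>\<^sup>+X. ennreal (norm (exp (limit X + e))) \<partial>\<mu>) < \<infinity>" .
  qed measurable
  then have "integrable \<mu> (\<lambda>X. exp (- e) * exp (limit X + e))" by (rule integrable_mult_right)
  moreover have "exp (- e) * exp (limit X + e) = exp (limit X)" for X
    by (simp add: exp_add[symmetric])
  ultimately show ?thesis by simp
qed

end

section \<open>The kernel of $L(1+L)^{-1}$\<close>

lemma L2_star_eq: "L2_star = L2 lborel_star"
  by (simp add: L2_star_def L2_def)

lemma L2_star_norm_eq: "L2_star_norm f = sqrt (sqnorm lborel_star f)"
  by (simp add: L2_star_norm_def sqnorm_def)

lemma space_lborel_star [simp]: "space lborel_star = Rstar"
  by (simp add: space_restrict_space)

lemma measurable_lborel_star: "f \<in> borel_measurable borel \<Longrightarrow> f \<in> borel_measurable lborel_star"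
  by (intro measurable_restrict_space1) simp

text \<open>
  One formula for all sign patterns, continuous across the diagonal. For opposite signs
  $x - y = \pm(|x|+|y|)$.
\<close>

lemma L_kernel_eq:
  assumes "x \<noteq> 0" "y \<noteq> 0"
  shows "L_kernel A x y = complex_of_real (A x * A y * (sgn x - sgn y) / (2 * (\<bar>x\<bar> + \<bar>y\<bar>)))"
proof -
  consider "x > 0" "y > 0" | "x > 0" "y < 0" | "x < 0" "y > 0" | "x < 0" "y < 0" using assms by linarith
  then show ?thesis
    unfolding L_kernel_def of_real_eq_iff
  proof cases
    case 2
    have "A x * A y * 2 / (2 * x - 2 * y) = (A x * A y * 2) / ((x - y) * 2)"
      by (rule arg_cong2[where f = "(/)"]) auto
    also have "\<dots> = A x * A y / (x - y)" by (rule mult_divide_mult_cancel_right) simp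
    finally have "A x * A y * 2 / (2 * x - 2 * y) = A x * A y / (x - y)" .
    with 2 show "(A_plus A x * A_minus A y + A_minus A x * A_plus A y) / (x - y)
        = A x * A y * (sgn x - sgn y) / (2 * (\<bar>x\<bar> + \<bar>y\<bar>))"
      by (simp add: A_plus_def A_minus_def)
  next
    case 3
    have "A x * A y * (- 1 - 1) / (2 * (- x + y)) = (A x * A y * (- 2)) / ((x - y) * (- 2))"
      by (rule arg_cong2[where f = "(/)"]) auto
    also have "\<dots> = A x * A y / (x - y)" by (rule mult_divide_mult_cancel_right) simp
    finally have "A x * A y * (- 1 - 1) / (2 * (- x + y)) = A x * A y / (x - y)" .
    with 3 show "(A_plus A x * A_minus A y + A_minus A x * A_plus A y) / (x - y)
        = A x * A y * (sgn x - sgn y) / (2 * (\<bar>x\<bar> + \<bar>y\<bar>))"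
      by (simp add: A_plus_def A_minus_def)
  qed (auto simp: A_plus_def A_minus_def)
qed

lemma cmod_L_kernel_le:
  assumes "x \<noteq> 0" "y \<noteq> 0"
  shows "cmod (L_kernel A x y) \<le> \<bar>A x\<bar> * \<bar>A y\<bar> / (\<bar>x\<bar> + \<bar>y\<bar>)"
proof -
  have "\<bar>sgn x - sgn y\<bar> \<le> 2" by (simp add: sgn_if)
  then have "\<bar>A x\<bar> * \<bar>A y\<bar> * \<bar>sgn x - sgn y\<bar> / (2 * (\<bar>x\<bar> + \<bar>y\<bar>)) \<le> \<bar>A x\<bar> * \<bar>A y\<bar> * 2 / (2 * (\<bar>x\<bar> + \<bar>y\<bar>))"
    by (intro divide_right_mono mult_left_mono) auto
  also have "\<bar>A x\<bar> * \<bar>A y\<bar> * 2 / (2 * s) = \<bar>A x\<bar> * \<bar>A y\<bar> / s" for s by simp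
  finally show ?thesis unfolding L_kernel_eq[OF assms] norm_of_real by (simp add: abs_mult)
qed

text \<open>
  Statements that hold almost everywhere hold on a dense set; this brings estimates for a.e. point
  to all points by continuity.
\<close>

lemma open_meets_AE:
  assumes U: "open U" "x0 \<in> U" "U \<subseteq> Rstar" and ae: "AE x in lborel_star. P x"
  shows "\<exists>x\<in>U. P x"
proof (rule ccontr)
  assume "\<not> ?thesis"
  then have no: "\<And>x. x \<in> U \<Longrightarrow> \<not> P x" by blast
  have "AE x in lborel. x \<in> Rstar \<longrightarrow> P x"
    using ae by (subst (asm) AE_restrict_space_iff) auto
  then have "AE x in lborel. x \<notin> U" by eventually_elim (use no U(3) in auto)
  then have "U \<in> null_sets lborel" using U(1) by (subst AE_iff_null_sets) auto
  moreover obtain e where e: "e > 0" "cball x0 e \<subseteq> U" using U(1,2) open_contains_cball by blast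
  then have "{x0 - e..x0 + e} \<subseteq> U" by (simp add: cball_eq_atLeastAtMost)
  then have "emeasure lborel {x0 - e..x0 + e} \<le> emeasure lborel U"
    using U(1) by (intro emeasure_mono) auto
  ultimately show False using e by (simp add: null_sets_def)
qed

locale integrable_operator =
  fixes A :: "real \<Rightarrow> real" and K :: "real \<Rightarrow> real \<Rightarrow> complex"
  assumes A_cont: "continuous_on Rstar A"
    and A_sq: "(\<lambda>x. complex_of_real (A x)) \<in> L2_star"
    and bounded: "bounded_op (L_op A)"
    and K_kernel: "is_K_kernel A K"
begin

abbreviation "Lk \<equiv> L_kernel A"

lemma A_L2: "(\<lambda>x. complex_of_real (A x)) \<in> L2 lborel_star"
  using A_sq by (simp add: L2_star_eq)

lemma A_measurable [measurable]: "A \<in> borel_measurable lborel_star"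
  using measurable_compose[OF L2_measurable[OF A_L2] borel_measurable_Re] by simp

lemma Lk_measurable [measurable]: "(\<lambda>(x, y). Lk x y) \<in> borel_measurable (lborel_star \<Otimes>\<^sub>M lborel_star)"
proof -
  have [measurable]: "(\<lambda>x. x) \<in> borel_measurable lborel_star"
    by (rule measurable_lborel_star) simp
  have [measurable]: "(\<lambda>x. indicator {0<..} x :: real) \<in> borel_measurable lborel_star"
    "(\<lambda>x. indicator {..<0} x :: real) \<in> borel_measurable lborel_star"
    by (rule measurable_lborel_star, simp)+
  show ?thesis unfolding L_kernel_def A_plus_def A_minus_def by measurable
qed

lemma Lk_row_L2:
  assumes "x \<noteq> 0"
  shows "Lk x \<in> L2 lborel_star"
proof (rule L2_mono(1)[OF L2_cmult(1)[OF A_L2, of "complex_of_real (\<bar>A x\<bar> / \<bar>x\<bar>)"]])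
  show "Lk x \<in> borel_measurable lborel_star"
    using measurable_compose_Pair1[of x lborel_star "\<lambda>(x, y). Lk x y" lborel_star borel] Lk_measurable assms
    by simp
  have "cmod (Lk x y) \<le> cmod (complex_of_real (\<bar>A x\<bar> / \<bar>x\<bar>) * complex_of_real (A y))" if "y \<noteq> 0" for y
  proof -
    have "\<bar>A x\<bar> * \<bar>A y\<bar> / (\<bar>x\<bar> + \<bar>y\<bar>) \<le> \<bar>A x\<bar> * \<bar>A y\<bar> / \<bar>x\<bar>"
      using assms by (intro divide_left_mono) auto
    then show ?thesis using cmod_L_kernel_le[OF assms that, of A] by (simp add: norm_mult norm_divide)
  qed
  then show "AE y in lborel_star. cmod (Lk x y) \<le> cmod (complex_of_real (\<bar>A x\<bar> / \<bar>x\<bar>) * complex_of_real (A y))"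
    by (intro AE_I2) simp
qed

text \<open>
  The locale interpretation below needs the bound of the operator as a term.
\<close>

definition op_const :: real where
  "op_const = (SOME C. \<forall>f\<in>L2_star. L_op A f \<in> L2_star \<and> L2_star_norm (L_op A f) \<le> C * L2_star_norm f)"

lemma op_const:
  assumes "f \<in> L2 lborel_star"
  shows "L_op A f \<in> L2 lborel_star" "sqnorm lborel_star (L_op A f) \<le> op_const\<^sup>2 * sqnorm lborel_star f"
proof -
  have *: "\<forall>f\<in>L2_star. L_op A f \<in> L2_star \<and> L2_star_norm (L_op A f) \<le> op_const * L2_star_norm f"
    unfolding op_const_def by (rule someI_ex) (use bounded in \<open>simp add: bounded_op_def\<close>)
  with assms show "L_op A f \<in> L2 lborel_star" by (simp add: L2_star_eq)
  have "sqrt (sqnorm lborel_star (L_op A f)) \<le> op_const * sqrt (sqnorm lborel_star f)"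
    using * assms by (simp add: L2_star_eq L2_star_norm_eq)
  then have "(sqrt (sqnorm lborel_star (L_op A f)))\<^sup>2 \<le> (op_const * sqrt (sqnorm lborel_star f))\<^sup>2"
    by (intro power_mono) auto
  then show "sqnorm lborel_star (L_op A f) \<le> op_const\<^sup>2 * sqnorm lborel_star f"
    by (simp add: power_mult_distrib)
qed

text \<open>
  On each off-diagonal block the sign of $L(x,y)$ is the product of a function of \<open>x\<close> and the sign of
  \<open>A y\<close>. Hence the operator with kernel $|L|$ inherits the bound of \<open>L\<close>.
\<close>

lemma abs_kernel_twist:
  assumes x: "x \<noteq> 0" and f: "f \<in> L2 lborel_star"
  shows "(LINT y|lborel_star. cmod (Lk x y) * cmod (f y))
    = cmod (L_op A (\<lambda>y. complex_of_real (sgn (A y) * cmod (f y))) x)"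
proof -
  have pt: "Lk x y * complex_of_real (sgn (A y) * cmod (f y))
      = complex_of_real (sgn x * sgn (A x)) * complex_of_real (cmod (Lk x y) * cmod (f y))" if y: "y \<noteq> 0" for y
  proof -
    have "A x * A y * (sgn x - sgn y) * sgn (A y) = sgn x * sgn (A x) * (\<bar>A x\<bar> * \<bar>A y\<bar> * \<bar>sgn x - sgn y\<bar>)"
      using x y by (auto simp: sgn_if)
    then have "A x * A y * (sgn x - sgn y) / (2 * (\<bar>x\<bar> + \<bar>y\<bar>)) * sgn (A y)
        = sgn x * sgn (A x) * \<bar>A x * A y * (sgn x - sgn y) / (2 * (\<bar>x\<bar> + \<bar>y\<bar>))\<bar>"
      by (simp add: abs_mult)
    then show ?thesis unfolding L_kernel_eq[OF x y]
      by (simp only: norm_of_real of_real_mult[symmetric] mult.assoc[symmetric])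
  qed
  have "L_op A (\<lambda>y. complex_of_real (sgn (A y) * cmod (f y))) x
      = (LINT y|lborel_star. complex_of_real (sgn x * sgn (A x)) * complex_of_real (cmod (Lk x y) * cmod (f y)))"
    unfolding integral_op_def by (intro Bochner_Integration.integral_cong refl pt) simp
  also have "\<dots> = complex_of_real (sgn x * sgn (A x)) * complex_of_real (LINT y|lborel_star. cmod (Lk x y) * cmod (f y))"
    by (simp only: integral_mult_right_zero integral_complex_of_real)
  finally have eq: "cmod (L_op A (\<lambda>y. complex_of_real (sgn (A y) * cmod (f y))) x)
      = \<bar>sgn x * sgn (A x)\<bar> * \<bar>LINT y|lborel_star. cmod (Lk x y) * cmod (f y)\<bar>"
    by (simp only: norm_mult norm_of_real)
  show ?thesis
  proof (cases "A x = 0")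
    case True
    then have "(LINT y|lborel_star. cmod (Lk x y) * cmod (f y)) = (LINT y|lborel_star. 0)"
      by (intro Bochner_Integration.integral_cong refl) (simp add: L_kernel_eq[OF x])
    then show ?thesis unfolding eq by simp
  next
    case False
    then have "\<bar>sgn x * sgn (A x)\<bar> = 1" using x by (simp add: abs_mult abs_sgn_eq)
    then show ?thesis unfolding eq by simp
  qed
qed

sublocale skew_kernel lborel_star Lk "op_const\<^sup>2"
proof (rule skew_kernel.intro)
  show "sigma_finite_measure lborel_star"
    by (rule sigma_finite_measure_restrict_space[OF sigma_finite_lborel]) simp
  show "skew_kernel_axioms lborel_star Lk (op_const\<^sup>2)"
  proof
    show "(\<lambda>(x, y). Lk x y) \<in> borel_measurable (lborel_star \<Otimes>\<^sub>M lborel_star)"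
      by (rule Lk_measurable)
    fix x y assume xy: "x \<in> space lborel_star" "y \<in> space lborel_star"
    have "A y * A x * (sgn y - sgn x) / (2 * (\<bar>y\<bar> + \<bar>x\<bar>)) = - (A x * A y * (sgn x - sgn y) / (2 * (\<bar>x\<bar> + \<bar>y\<bar>)))"
      by (simp only: add.commute[of "\<bar>y\<bar>"] mult.commute[of "A y"] minus_divide_left mult_minus_right[symmetric] minus_diff_eq)
    note skew = this
    have "x \<noteq> 0" "y \<noteq> 0" using xy by simp_all
    then show "Lk y x = - cnj (Lk x y)"
      unfolding L_kernel_eq[OF \<open>x \<noteq> 0\<close> \<open>y \<noteq> 0\<close>] L_kernel_eq[OF \<open>y \<noteq> 0\<close> \<open>x \<noteq> 0\<close>]
        complex_cnj_complex_of_real of_real_minus[symmetric] of_real_eq_iff by (intro skew)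
  next
    fix x assume "x \<in> space lborel_star"
    then show "Lk x \<in> L2 lborel_star" by (intro Lk_row_L2) simp
  next
    fix f assume f: "f \<in> L2 lborel_star"
    note [measurable] = L2_measurable[OF f]
    define g where "g y = complex_of_real (sgn (A y) * cmod (f y))" for y
    have gm: "g \<in> borel_measurable lborel_star" unfolding g_def by measurable
    have gf: "AE y in lborel_star. cmod (g y) \<le> cmod (f y)"
      by (intro AE_I2) (auto simp: g_def norm_mult sgn_if)
    note g = L2_mono[OF f gm gf]
    have "(\<lambda>p. f (snd p)) \<in> borel_measurable (lborel_star \<Otimes>\<^sub>M lborel_star)"
      by (rule measurable_compose[OF measurable_snd L2_measurable[OF f]])
    then have "(\<lambda>p. cmod (Lk (fst p) (snd p)) * cmod (f (snd p))) \<in> borel_measurable (lborel_star \<Otimes>\<^sub>M lborel_star)"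
      using Lk_measurable by (intro borel_measurable_times borel_measurable_norm) (simp_all add: case_prod_unfold)
    then have "(\<lambda>x. LINT y|lborel_star. cmod (Lk x y) * cmod (f y)) \<in> borel_measurable lborel_star"
      by (intro sigma_finite_measure.borel_measurable_lebesgue_integral
          sigma_finite_measure_restrict_space[OF sigma_finite_lborel]) (simp_all add: case_prod_unfold)
    then have m: "(\<lambda>x. complex_of_real (LINT y|lborel_star. cmod (Lk x y) * cmod (f y))) \<in> borel_measurable lborel_star"
      by (rule measurable_compose) simp
    have ae: "AE x in lborel_star. cmod (complex_of_real (LINT y|lborel_star. cmod (Lk x y) * cmod (f y))) \<le> cmod (L_op A g x)"
    proof (rule AE_I2)
      fix x assume "x \<in> space lborel_star"
      then have "x \<noteq> 0" by simp
      moreover have "g = (\<lambda>y. complex_of_real (sgn (A y) * cmod (f y)))"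
        by (rule ext) (rule g_def)
      ultimately have "(LINT y|lborel_star. cmod (Lk x y) * cmod (f y)) = cmod (L_op A g x)"
        using abs_kernel_twist[OF _ f] by (simp only:)
      then show "cmod (complex_of_real (LINT y|lborel_star. cmod (Lk x y) * cmod (f y))) \<le> cmod (L_op A g x)"
        by (simp only: norm_of_real abs_norm_cancel order_refl)
    qed
    note * = L2_mono[OF op_const(1)[OF g(1)] m ae]
    show "(\<lambda>x. complex_of_real (LINT y|lborel_star. cmod (Lk x y) * cmod (f y))) \<in> L2 lborel_star"
      by (rule *)
    have "sqnorm lborel_star (\<lambda>x. complex_of_real (LINT y|lborel_star. cmod (Lk x y) * cmod (f y)))
        \<le> sqnorm lborel_star (L_op A g)" by (rule *)
    also have "\<dots> \<le> op_const\<^sup>2 * sqnorm lborel_star g" by (rule op_const(2)[OF g(1)])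
    also have "\<dots> \<le> op_const\<^sup>2 * sqnorm lborel_star f" by (intro mult_left_mono g) simp
    finally show "sqnorm lborel_star (\<lambda>x. complex_of_real (LINT y|lborel_star. cmod (Lk x y) * cmod (f y)))
        \<le> op_const\<^sup>2 * sqnorm lborel_star f" .
  qed
qed

lemma T_eq: "T f = L_op A f"
  by (rule ext) (simp add: T_def integral_op_def)

lemma Lk_continuous: "continuous_on (Rstar \<times> Rstar) (\<lambda>(x, y). Lk x y)"
proof -
  have 1: "continuous_on (Rstar \<times> Rstar) (\<lambda>p. A (fst p))"
    by (rule continuous_on_compose2[OF A_cont]) (auto intro!: continuous_intros)
  have 2: "continuous_on (Rstar \<times> Rstar) (\<lambda>p. A (snd p))"
    by (rule continuous_on_compose2[OF A_cont]) (auto intro!: continuous_intros)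
  have "continuous_on (Rstar \<times> Rstar)
      (\<lambda>p. complex_of_real (A (fst p) * A (snd p) * (sgn (fst p) - sgn (snd p)) / (2 * (\<bar>fst p\<bar> + \<bar>snd p\<bar>))))"
    by (intro continuous_intros 1 2) (auto simp: add_nonneg_eq_0_iff)
  then show ?thesis
  proof (rule continuous_on_eq)
    fix p assume "p \<in> Rstar \<times> Rstar"
    then have "fst p \<noteq> 0" "snd p \<noteq> 0" by auto
    from L_kernel_eq[OF this, of A]
    show "complex_of_real (A (fst p) * A (snd p) * (sgn (fst p) - sgn (snd p)) / (2 * (\<bar>fst p\<bar> + \<bar>snd p\<bar>)))
        = (case p of (x, y) \<Rightarrow> Lk x y)" by (simp only: case_prod_unfold)
  qed
qed

text \<open>
  Dominated convergence: $|L(x,y)| \le (|A(x)|/|x|)\,|A(y)|$ locally uniformly in \<open>x\<close>.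
\<close>

lemma row_continuous: "continuous_on Rstar row"
proof -
  have "continuous_on Rstar (\<lambda>x. sqnorm lborel_star (Lk x))"
    unfolding continuous_on_sequentially comp_def
  proof safe
    fix x :: "nat \<Rightarrow> real" and a
    assume a: "a \<noteq> 0" and x: "\<forall>n. x n \<in> Rstar" and lim: "x \<longlonglongrightarrow> a"
    have Alim: "(\<lambda>n. A (x n)) \<longlonglongrightarrow> A a"
      using A_cont a x lim unfolding continuous_on_sequentially comp_def by auto
    have "(\<lambda>n. \<bar>A (x n)\<bar> / \<bar>x n\<bar>) \<longlonglongrightarrow> \<bar>A a\<bar> / \<bar>a\<bar>"
      by (intro tendsto_intros Alim lim) (use a in simp)
    then have "Bseq (\<lambda>n. \<bar>A (x n)\<bar> / \<bar>x n\<bar>)"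
      by (intro convergent_imp_Bseq convergentI)
    then obtain R where R: "0 < R" "\<And>n. \<bar>A (x n)\<bar> / \<bar>x n\<bar> \<le> R" unfolding Bseq_def by auto
    show "(\<lambda>n. sqnorm lborel_star (Lk (x n))) \<longlonglongrightarrow> sqnorm lborel_star (Lk a)"
      unfolding sqnorm_def
    proof (rule integral_dominated_convergence)
      show "(\<lambda>y. (cmod (Lk a y))\<^sup>2) \<in> borel_measurable lborel_star"
        using L2_measurable[OF Lk_row_L2[OF a]] by measurable
      show "(\<lambda>y. (cmod (Lk (x n) y))\<^sup>2) \<in> borel_measurable lborel_star" for n
        using L2_measurable[OF Lk_row_L2[of "x n"]] x by auto
      show "integrable lborel_star (\<lambda>y. (cmod (complex_of_real R * complex_of_real (A y)))\<^sup>2)"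
        by (rule L2_integrable[OF L2_cmult(1)[OF A_L2]])
      show "AE y in lborel_star. (\<lambda>n. (cmod (Lk (x n) y))\<^sup>2) \<longlonglongrightarrow> (cmod (Lk a y))\<^sup>2"
      proof (rule AE_I2)
        fix y assume "y \<in> space lborel_star"
        then have y: "y \<noteq> 0" by simp
        have "(\<lambda>n. complex_of_real (A (x n) * A y * (sgn (x n) - sgn y) / (2 * (\<bar>x n\<bar> + \<bar>y\<bar>))))
          \<longlonglongrightarrow> complex_of_real (A a * A y * (sgn a - sgn y) / (2 * (\<bar>a\<bar> + \<bar>y\<bar>)))"
          by (intro tendsto_intros Alim lim) (use a y in auto)
        then have "(\<lambda>n. Lk (x n) y) \<longlonglongrightarrow> Lk a y"
          using x a y by (simp add: L_kernel_eq)
        then show "(\<lambda>n. (cmod (Lk (x n) y))\<^sup>2) \<longlonglongrightarrow> (cmod (Lk a y))\<^sup>2"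
          by (intro tendsto_intros)
      qed
      show "AE y in lborel_star. norm ((cmod (Lk (x n) y))\<^sup>2) \<le> (cmod (complex_of_real R * complex_of_real (A y)))\<^sup>2" for n
      proof (rule AE_I2)
        fix y assume "y \<in> space lborel_star"
        then have y: "y \<noteq> 0" by simp
        have xn: "x n \<noteq> 0" using x by auto
        have "cmod (Lk (x n) y) \<le> \<bar>A (x n)\<bar> * \<bar>A y\<bar> / (\<bar>x n\<bar> + \<bar>y\<bar>)"
          by (rule cmod_L_kernel_le[OF xn y])
        also have "\<dots> \<le> \<bar>A (x n)\<bar> * \<bar>A y\<bar> / \<bar>x n\<bar>"
          using xn by (intro divide_left_mono) auto
        also have "\<dots> = \<bar>A (x n)\<bar> / \<bar>x n\<bar> * \<bar>A y\<bar>" by simp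
        also have "\<dots> \<le> R * \<bar>A y\<bar>" by (intro mult_right_mono R) simp
        finally show "norm ((cmod (Lk (x n) y))\<^sup>2) \<le> (cmod (complex_of_real R * complex_of_real (A y)))\<^sup>2"
          using R(1) by (simp add: norm_mult power_mono)
      qed
    qed
  qed
  then show ?thesis unfolding row_def by (intro continuous_intros)
qed

text \<open>
  Formally $K - L = -L(1+L)^{-1}L$. If the bound failed at a point, it would fail by a fixed margin
  on a neighbourhood; integrating \<open>K x y - L x y\<close> over a short interval of values \<open>y\<close> and comparing with
  \<open>resolvent_indicator\<close> gives a contradiction.
\<close>

lemma K_near_L:
  assumes x0: "x0 \<noteq> 0" and y0: "y0 \<noteq> 0"
  shows "cmod (K x0 y0 - Lk x0 y0) \<le> row x0 * row y0"
proof (rule ccontr)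
  assume "\<not> ?thesis"
  then have less: "row x0 * row y0 < cmod (K x0 y0 - Lk x0 y0)" by simp
  define G where "G p = K (fst p) (snd p) - Lk (fst p) (snd p)" for p
  have Kc: "continuous_on (Rstar \<times> Rstar) (\<lambda>(x, y). K x y)" and Kk: "has_kernel (K_op A) K"
    using K_kernel by (auto simp: is_K_kernel_def)
  have Gc: "continuous_on (Rstar \<times> Rstar) G"
    unfolding G_def using continuous_on_diff[OF Kc Lk_continuous] by (simp add: case_prod_unfold)
  \<comment> \<open>A little room above both row norms absorbs their oscillation near \<open>x0\<close> and \<open>y0\<close>.\<close>
  have "((\<lambda>e. (row x0 + e) * (row y0 + e)) \<longlongrightarrow> (row x0 + 0) * (row y0 + 0)) (at_right 0)"
    by (intro tendsto_intros)
  then have "eventually (\<lambda>e. (row x0 + e) * (row y0 + e) < cmod (G (x0, y0))) (at_right 0)"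
    using less by (intro order_tendstoD(2)) (auto simp: G_def)
  then have "eventually (\<lambda>e. 0 < e \<and> (row x0 + e) * (row y0 + e) < cmod (G (x0, y0))) (at_right 0)"
    using eventually_at_right_less[of "0::real"] by eventually_elim simp
  then obtain e where e: "e > 0" "(row x0 + e) * (row y0 + e) < cmod (G (x0, y0))"
    using eventually_happens'[OF trivial_limit_at_right_real] by blast
  define a where "a = row x0 + e"
  define b where "b = row y0 + e"
  have ab: "0 < a" "0 < b" "row x0 < a" "row y0 < b" "a * b < cmod (G (x0, y0))"
    using e row_nonneg[of x0] row_nonneg[of y0] by (auto simp: a_def b_def)
  \<comment> \<open>Rotating by this phase makes the offending value positive, so that it survives integration.\<close>
  define u where "u = cnj (sgn (G (x0, y0)))"
  have G0: "G (x0, y0) \<noteq> 0" using ab(5) mult_pos_pos[OF ab(1,2)] by auto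
  have u: "cmod u = 1" unfolding u_def using G0 by (simp add: norm_sgn)
  have uG: "Re (u * G (x0, y0)) = cmod (G (x0, y0))"
  proof -
    have "u * G (x0, y0) = complex_of_real ((cmod (G (x0, y0)))\<^sup>2) / complex_of_real (cmod (G (x0, y0)))"
      unfolding u_def complex_norm_square by (simp add: sgn_div_norm scaleR_conv_of_real divide_inverse mult_ac)
    also have "\<dots> = complex_of_real (cmod (G (x0, y0)))" using G0 by (simp add: power2_eq_square)
    finally show ?thesis by simp
  qed
  have op: "open (Rstar \<times> Rstar)" by (intro open_Times) auto
  have "continuous_on (Rstar \<times> Rstar) (\<lambda>p. Re (u * G p))" by (intro continuous_intros Gc)
  then have "open ((\<lambda>p. Re (u * G p)) -` {a * b<..} \<inter> (Rstar \<times> Rstar))"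
    unfolding continuous_on_open_vimage[OF op] by (elim allE[of _ "{a * b<..}"] impE) auto
  moreover have "(x0, y0) \<in> (\<lambda>p. Re (u * G p)) -` {a * b<..} \<inter> (Rstar \<times> Rstar)"
    using ab(5) uG x0 y0 by auto
  ultimately obtain U V where UV: "open U" "open V" "(x0, y0) \<in> U \<times> V"
    "U \<times> V \<subseteq> (\<lambda>p. Re (u * G p)) -` {a * b<..} \<inter> (Rstar \<times> Rstar)"
    by (rule open_prod_elim)
  have rowop: "open (row -` {..<c} \<inter> Rstar)" for c
  proof -
    have "open Rstar" by auto
    from row_continuous[unfolded continuous_on_open_vimage[OF this]]
    show ?thesis by (elim allE[of _ "{..<c}"] impE) auto
  qed
  define U' where "U' = U \<inter> (row -` {..<a} \<inter> Rstar)"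
  have U': "open U'" "x0 \<in> U'" "U' \<subseteq> Rstar"
    using UV rowop ab x0 by (auto simp: U'_def)
  have "open (V \<inter> (row -` {..<b} \<inter> Rstar))" "y0 \<in> V \<inter> (row -` {..<b} \<inter> Rstar)"
    using UV rowop ab y0 by auto
  then obtain r where r: "r > 0" "cball y0 r \<subseteq> V \<inter> (row -` {..<b} \<inter> Rstar)"
    using open_contains_cball by blast
  define B where "B = {y0 - r..y0 + r}"
  have B: "B \<subseteq> V" "\<And>y. y \<in> B \<Longrightarrow> row y < b" "B \<subseteq> Rstar"
  proof -
    have "B = cball y0 r" by (auto simp: B_def dist_real_def abs_le_iff)
    then show "B \<subseteq> V" "\<And>y. y \<in> B \<Longrightarrow> row y < b" "B \<subseteq> Rstar" using r(2) by blast+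
  qed
  have Bs: "B \<in> sets lborel_star"
    by (subst sets_restrict_space_iff) (use B(3) in \<open>simp_all add: B_def\<close>)
  have eB: "emeasure lborel_star B = ennreal (2 * r)"
  proof -
    have "emeasure lborel_star B = emeasure lborel B"
      by (rule emeasure_restrict_space[OF _ B(3)]) simp
    then show ?thesis using r(1) by (simp add: B_def)
  qed
  then have mB: "measure lborel_star B = 2 * r" using r(1) by (simp add: measure_def)
  have fB: "emeasure lborel_star B < \<infinity>" using eB by simp
  have ind: "(indicator B :: real \<Rightarrow> complex) \<in> L2 lborel_star" by (rule indicator_L2[OF Bs fB])
  define g where "g = op_inverse (\<lambda>g x. g x + L_op A g x) (indicator B)"
  have ex: "\<exists>g. g \<in> L2_star \<and> (AE x in lborel_star. g x + L_op A g x = indicator B x)"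
    using resolvent_exists[OF ind] unfolding T_eq L2_star_eq by blast
  have gg: "g \<in> L2_star \<and> (AE x in lborel_star. g x + L_op A g x = indicator B x)"
    unfolding g_def op_inverse_def by (rule someI_ex[OF ex])
  have g: "g \<in> L2 lborel_star" "AE x in lborel_star. g x + T g x = indicator B x"
    unfolding T_eq L2_star_eq[symmetric] using gg by blast+
  have "AE x in lborel_star. integrable lborel_star (\<lambda>y. K x y * indicator B y) \<and>
      K_op A (indicator B) x = integral_op K (indicator B) x"
    by (rule Kk[unfolded has_kernel_def L2_star_eq, THEN bspec, OF ind])
  then have "AE x in lborel_star. integrable lborel_star (\<lambda>y. K x y * indicator B y) \<and>
      T g x = (LINT y|lborel_star. K x y * indicator B y)"
    unfolding K_op_def g_def[symmetric] T_eq integral_op_def[of K] .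
  from open_meets_AE[OF U' this] obtain x where x: "x \<in> U'"
    and int: "integrable lborel_star (\<lambda>y. K x y * indicator B y)"
    and Tg: "T g x = (LINT y|lborel_star. K x y * indicator B y)" by blast
  have xs: "x \<in> space lborel_star" using x U'(3) by auto
  note Lint = k_integrable[OF ind xs]
  have diff: "T g x - T (indicator B) x = (LINT y|lborel_star. G (x, y) * indicator B y)"
  proof -
    have "T (indicator B) x = (LINT y|lborel_star. Lk x y * indicator B y)" by (simp only: T_def)
    then show ?thesis
      by (simp only: Tg G_def left_diff_distrib fst_conv snd_conv Bochner_Integration.integral_diff[OF int Lint])
  qed
  have Gint: "integrable lborel_star (\<lambda>y. G (x, y) * indicator B y)"
    using Bochner_Integration.integrable_diff[OF int Lint]
    by (simp only: G_def left_diff_distrib fst_conv snd_conv)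
  have "a * b * (2 * r) = (LINT y|lborel_star. a * b * indicator B y)"
    using mB B(3) by (simp add: Int_absorb2)
  also have "\<dots> \<le> (LINT y|lborel_star. Re (u * (G (x, y) * indicator B y)))"
  proof (rule integral_mono)
    show "integrable lborel_star (\<lambda>y. a * b * indicator B y)"
      using Bs fB by (intro integrable_mult_right) simp
    show "integrable lborel_star (\<lambda>y. Re (u * (G (x, y) * indicator B y)))"
      by (intro integrable_Re integrable_mult_right Gint)
    fix y
    show "a * b * indicator B y \<le> Re (u * (G (x, y) * indicator B y))"
    proof (cases "y \<in> B")
      case True
      then have "(x, y) \<in> U \<times> V" using x B(1) by (auto simp: U'_def)
      then have "a * b < Re (u * G (x, y))" using UV(4) by auto
      then show ?thesis using True by simp
    qed simp
  qed
  also have "\<dots> = Re (u * (T g x - T (indicator B) x))"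
    unfolding diff integral_Re[OF integrable_mult_right[OF Gint]] integral_mult_right_zero ..
  also have "\<dots> \<le> cmod (u * (T g x - T (indicator B) x))" by (rule complex_Re_le_cmod)
  also have "\<dots> = cmod (T g x - T (indicator B) x)" by (simp add: norm_mult u)
  also have "\<dots> \<le> row x * (measure lborel_star B * b)"
    using B(2) ab(2) by (intro resolvent_indicator[OF Bs fB _ _ g xs]) (auto intro: less_imp_le)
  also have "\<dots> = row x * b * (2 * r)" by (simp add: mB)
  also have "\<dots> < a * b * (2 * r)"
    using x ab r(1) by (intro mult_strict_right_mono) (auto simp: U'_def)
  finally show False by simp
qed

text \<open>
  The first term dominates \<open>L\<close>, by $\sqrt{2|x|}\,\sqrt{2|y|} \le |x|+|y|$; the second one dominates the
  difference of \<open>K\<close> and \<open>L\<close>.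
\<close>

definition weight :: "real \<Rightarrow> real" where
  "weight x = indicator Rstar x *\<^sub>R sqrt ((A x)\<^sup>2 / (2 * \<bar>x\<bar>) + (row x)\<^sup>2)"

lemma weight_sq: "x \<noteq> 0 \<Longrightarrow> (weight x)\<^sup>2 = (A x)\<^sup>2 / (2 * \<bar>x\<bar>) + (row x)\<^sup>2"
  by (simp add: weight_def)

lemma weight_nonneg: "0 \<le> weight x"
  by (simp add: weight_def)

lemma weight_continuous: "continuous_on Rstar (\<lambda>x. sqrt ((A x)\<^sup>2 / (2 * \<bar>x\<bar>) + (row x)\<^sup>2))"
  by (intro continuous_intros A_cont row_continuous) auto

lemma weight_measurable: "weight \<in> borel_measurable borel"
  unfolding weight_def by (rule borel_measurable_continuous_on_indicator[OF _ weight_continuous]) simp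

lemma weight_locally_bounded:
  assumes "compact S" "S \<subseteq> Rstar"
  shows "\<exists>b. \<forall>x\<in>S. (weight x)\<^sup>2 \<le> b"
proof -
  have "continuous_on S (\<lambda>x. (A x)\<^sup>2 / (2 * \<bar>x\<bar>) + (row x)\<^sup>2)"
    using assms(2) by (intro continuous_intros continuous_on_subset[OF A_cont] continuous_on_subset[OF row_continuous]) auto
  then have "bounded ((\<lambda>x. (A x)\<^sup>2 / (2 * \<bar>x\<bar>) + (row x)\<^sup>2) ` S)"
    by (intro compact_imp_bounded compact_continuous_image assms(1))
  then obtain b where b: "\<And>x. x \<in> S \<Longrightarrow> norm ((A x)\<^sup>2 / (2 * \<bar>x\<bar>) + (row x)\<^sup>2) \<le> b"
    unfolding bounded_iff by blast
  have "(weight x)\<^sup>2 \<le> b" if "x \<in> S" for x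
  proof -
    have "x \<noteq> 0" using that assms(2) by auto
    from b[OF that] show ?thesis unfolding weight_sq[OF \<open>x \<noteq> 0\<close>] by simp
  qed
  then show ?thesis by blast
qed

lemma K_le_weight:
  assumes x: "x \<noteq> 0" and y: "y \<noteq> 0"
  shows "cmod (K x y) \<le> weight x * weight y"
proof -
  define a where "a = \<bar>A x\<bar> / sqrt (2 * \<bar>x\<bar>)"
  define b where "b = \<bar>A y\<bar> / sqrt (2 * \<bar>y\<bar>)"
  have ab: "0 \<le> a" "0 \<le> b" by (simp_all add: a_def b_def)
  have w: "weight x * weight y = sqrt ((a\<^sup>2 + (row x)\<^sup>2) * (b\<^sup>2 + (row y)\<^sup>2))"
  proof -
    have "a\<^sup>2 = (A x)\<^sup>2 / (2 * \<bar>x\<bar>)" "b\<^sup>2 = (A y)\<^sup>2 / (2 * \<bar>y\<bar>)"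
      by (simp_all add: a_def b_def power_divide)
    then show ?thesis unfolding real_sqrt_mult using x y by (simp add: weight_def)
  qed
  have "cmod (K x y) \<le> cmod (Lk x y) + cmod (K x y - Lk x y)"
    using norm_triangle_ineq[of "Lk x y" "K x y - Lk x y"] by simp
  also have "\<dots> \<le> a * b + row x * row y"
  proof (rule add_mono)
    have "2 * \<bar>x\<bar> * (2 * \<bar>y\<bar>) \<le> (\<bar>x\<bar> + \<bar>y\<bar>)\<^sup>2"
      using sum_squares_bound[of "\<bar>x\<bar>" "\<bar>y\<bar>"] by (simp add: power2_sum)
    then have s: "sqrt (2 * \<bar>x\<bar>) * sqrt (2 * \<bar>y\<bar>) \<le> \<bar>x\<bar> + \<bar>y\<bar>"
      by (subst real_sqrt_mult[symmetric]) (rule real_le_lsqrt, auto)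
    have "cmod (Lk x y) \<le> \<bar>A x\<bar> * \<bar>A y\<bar> / (\<bar>x\<bar> + \<bar>y\<bar>)" by (rule cmod_L_kernel_le[OF x y])
    also have "\<dots> \<le> \<bar>A x\<bar> * \<bar>A y\<bar> / (sqrt (2 * \<bar>x\<bar>) * sqrt (2 * \<bar>y\<bar>))"
      using x y by (intro divide_left_mono s mult_pos_pos mult_nonneg_nonneg) auto
    also have "\<dots> = a * b" by (simp add: a_def b_def)
    finally show "cmod (Lk x y) \<le> a * b" .
    show "cmod (K x y - Lk x y) \<le> row x * row y" by (rule K_near_L[OF x y])
  qed
  also have "\<dots> \<le> weight x * weight y"
    unfolding w
  proof (rule real_le_rsqrt)
    have "2 * (a * row y) * (b * row x) \<le> (a * row y)\<^sup>2 + (b * row x)\<^sup>2"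
      by (rule sum_squares_bound)
    then show "(a * b + row x * row y)\<^sup>2 \<le> (a\<^sup>2 + (row x)\<^sup>2) * (b\<^sup>2 + (row y)\<^sup>2)"
      by (simp add: power2_eq_square algebra_simps)
  qed
  finally show ?thesis .
qed

text \<open>
  Here the boundedness of \<open>L\<close> is decisive: $|x|\,|L(x,y)|^2 \le |A(x)|\,|L(x,y)|\,|A(y)|$, and the right
  hand side is the form of the bounded kernel $|L|$ evaluated at the square-integrable function $|A|$.
  The pointwise bound $r(x) \le \|A\|\,|A(x)|/|x|$ would not suffice.
\<close>

lemma row_moment: "(\<integral>\<^sup>+x. ennreal (\<bar>x\<bar> * (row x)\<^sup>2) \<partial>lborel_star) < \<infinity>"
proof -
  define G where "G x = complex_of_real (LINT y|lborel_star. cmod (Lk x y) * cmod (complex_of_real (A y)))" for x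
  have G: "G \<in> L2 lborel_star" unfolding G_def by (rule abs_L2[OF A_L2])
  have int: "integrable lborel_star (\<lambda>x. cmod (complex_of_real (A x)) * cmod (G x))"
    by (rule L2_prod_integrable[OF A_L2 G])
  have le: "\<bar>x\<bar> * (row x)\<^sup>2 \<le> cmod (complex_of_real (A x)) * cmod (G x)" if x: "x \<noteq> 0" for x
  proof -
    have i1: "integrable lborel_star (\<lambda>y. (cmod (Lk x y))\<^sup>2)" by (rule L2_integrable[OF Lk_row_L2[OF x]])
    have i2: "integrable lborel_star (\<lambda>y. cmod (Lk x y) * cmod (complex_of_real (A y)))"
      by (rule L2_prod_integrable[OF Lk_row_L2[OF x] A_L2])
    have "\<bar>x\<bar> * (row x)\<^sup>2 = (LINT y|lborel_star. \<bar>x\<bar> * (cmod (Lk x y))\<^sup>2)"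
      by (simp add: row_def sqnorm_def)
    also have "\<dots> \<le> (LINT y|lborel_star. \<bar>A x\<bar> * (cmod (Lk x y) * cmod (complex_of_real (A y))))"
    proof (rule integral_mono)
      show "integrable lborel_star (\<lambda>y. \<bar>x\<bar> * (cmod (Lk x y))\<^sup>2)" by (rule integrable_mult_right[OF i1])
      show "integrable lborel_star (\<lambda>y. \<bar>A x\<bar> * (cmod (Lk x y) * cmod (complex_of_real (A y))))"
        by (rule integrable_mult_right[OF i2])
      fix y assume "y \<in> space lborel_star"
      then have y: "y \<noteq> 0" by simp
      have "\<bar>x\<bar> * cmod (Lk x y) \<le> (\<bar>x\<bar> + \<bar>y\<bar>) * cmod (Lk x y)"
        by (intro mult_right_mono) auto
      also have "\<dots> \<le> \<bar>A x\<bar> * \<bar>A y\<bar>"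
      proof -
        have "0 < \<bar>x\<bar> + \<bar>y\<bar>" using x by simp
        then show ?thesis using cmod_L_kernel_le[OF x y, of A] by (simp add: pos_le_divide_eq mult.commute)
      qed
      finally have "\<bar>x\<bar> * cmod (Lk x y) * cmod (Lk x y) \<le> \<bar>A x\<bar> * \<bar>A y\<bar> * cmod (Lk x y)"
        by (rule mult_right_mono) simp
      then show "\<bar>x\<bar> * (cmod (Lk x y))\<^sup>2 \<le> \<bar>A x\<bar> * (cmod (Lk x y) * cmod (complex_of_real (A y)))"
        by (simp add: power2_eq_square mult_ac)
    qed
    also have "\<dots> = \<bar>A x\<bar> * (LINT y|lborel_star. cmod (Lk x y) * cmod (complex_of_real (A y)))"
      by (rule integral_mult_right_zero)
    also have "\<dots> \<le> \<bar>A x\<bar> * cmod (G x)"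
      unfolding G_def norm_of_real by (intro mult_left_mono) auto
    finally show ?thesis by simp
  qed
  have "(\<integral>\<^sup>+x. ennreal (\<bar>x\<bar> * (row x)\<^sup>2) \<partial>lborel_star)
      \<le> (\<integral>\<^sup>+x. ennreal (cmod (complex_of_real (A x)) * cmod (G x)) \<partial>lborel_star)"
    by (intro nn_integral_mono ennreal_leI le) simp
  also have "\<dots> = ennreal (LINT x|lborel_star. cmod (complex_of_real (A x)) * cmod (G x))"
    by (rule nn_integral_eq_integral[OF int]) simp
  also have "\<dots> < \<infinity>" by simp
  finally show ?thesis .
qed

lemma weight_moment: "(\<integral>\<^sup>+x. ennreal \<bar>x\<bar> * ennreal ((weight x)\<^sup>2) \<partial>lborel) < \<infinity>"
proof -
  have rm: "row \<in> borel_measurable lborel_star"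
  proof -
    have "row \<in> borel_measurable (restrict_space borel Rstar)"
      by (rule borel_measurable_continuous_on_restrict[OF row_continuous])
    then show ?thesis by (simp add: measurable_def sets_restrict_space space_restrict_space)
  qed
  have "(\<integral>\<^sup>+x. ennreal \<bar>x\<bar> * ennreal ((weight x)\<^sup>2) \<partial>lborel)
      = (\<integral>\<^sup>+x. ennreal \<bar>x\<bar> * ennreal ((weight x)\<^sup>2) * indicator Rstar x \<partial>lborel)"
    by (intro nn_integral_cong) (auto simp: weight_def indicator_def)
  also have "\<dots> = (\<integral>\<^sup>+x. ennreal \<bar>x\<bar> * ennreal ((weight x)\<^sup>2) \<partial>lborel_star)"
    by (subst nn_integral_restrict_space) auto
  also have "\<dots> = (\<integral>\<^sup>+x. ennreal (1 / 2) * ennreal ((cmod (complex_of_real (A x)))\<^sup>2) + ennreal (\<bar>x\<bar> * (row x)\<^sup>2) \<partial>lborel_star)"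
  proof (rule nn_integral_cong)
    fix x assume "x \<in> space lborel_star"
    then have x: "x \<noteq> 0" by simp
    have "\<bar>x\<bar> * (weight x)\<^sup>2 = 1 / 2 * (cmod (complex_of_real (A x)))\<^sup>2 + \<bar>x\<bar> * (row x)\<^sup>2"
      unfolding weight_sq[OF x] using x by (simp add: distrib_left)
    then have "ennreal (\<bar>x\<bar> * (weight x)\<^sup>2) = ennreal (1 / 2 * (cmod (complex_of_real (A x)))\<^sup>2 + \<bar>x\<bar> * (row x)\<^sup>2)"
      by (rule arg_cong)
    then show "ennreal \<bar>x\<bar> * ennreal ((weight x)\<^sup>2)
        = ennreal (1 / 2) * ennreal ((cmod (complex_of_real (A x)))\<^sup>2) + ennreal (\<bar>x\<bar> * (row x)\<^sup>2)"
      by (simp only: ennreal_mult[symmetric] ennreal_plus[symmetric] abs_ge_zero zero_le_power2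
          mult_nonneg_nonneg zero_le_divide_1_iff zero_le_numeral)
  qed
  also have "\<dots> = (\<integral>\<^sup>+x. ennreal (1 / 2) * ennreal ((cmod (complex_of_real (A x)))\<^sup>2) \<partial>lborel_star)
      + (\<integral>\<^sup>+x. ennreal (\<bar>x\<bar> * (row x)\<^sup>2) \<partial>lborel_star)"
  proof (rule nn_integral_add)
    have "(\<lambda>x. \<bar>x\<bar>) \<in> borel_measurable lborel_star" by (rule measurable_lborel_star) simp
    then show "(\<lambda>x. ennreal (\<bar>x\<bar> * (row x)\<^sup>2)) \<in> borel_measurable lborel_star"
      using rm by measurable
  qed measurable
  also have "(\<integral>\<^sup>+x. ennreal (1 / 2) * ennreal ((cmod (complex_of_real (A x)))\<^sup>2) \<partial>lborel_star)
      = ennreal (1 / 2) * ennreal (sqnorm lborel_star (\<lambda>x. complex_of_real (A x)))"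
    by (subst nn_integral_cmult) (measurable, simp only: nn_integral_L2[OF A_L2])
  also have "\<dots> + (\<integral>\<^sup>+x. ennreal (\<bar>x\<bar> * (row x)\<^sup>2) \<partial>lborel_star) < \<infinity>"
  proof -
    have "ennreal (1 / 2) * ennreal (sqnorm lborel_star (\<lambda>x. complex_of_real (A x)))
        = ennreal (1 / 2 * sqnorm lborel_star (\<lambda>x. complex_of_real (A x)))"
      by (rule ennreal_mult[symmetric]) simp_all
    then show ?thesis using row_moment by simp
  qed
  finally show ?thesis .
qed

end

section \<open>The logarithmic functional\<close>

text \<open>
  The cutoff selects the semi-axis of \<open>p\<close>, so that exchanging \<open>p\<close> and \<open>q\<close> covers both halves of the
  functional.
\<close>

definition log_ratio :: "real \<Rightarrow> real \<Rightarrow> real \<Rightarrow> real" where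
  "log_ratio p q x = (if 0 < x * p then ln (\<bar>(x / p - 1) / (x / q - 1)\<bar>\<^sup>2) else 0)"

text \<open>
  An integrable majorant, up to a factor, of the logarithmic singularity at the zero of the numerator.
\<close>

definition log_peak :: "real \<Rightarrow> real" where
  "log_peak s = indicator {s. \<bar>s\<bar> < 1 / 2} s * \<bar>s\<bar> powr (- 1 / 2)"

lemma log_ratio_measurable [measurable]: "log_ratio p q \<in> borel_measurable borel"
  unfolding log_ratio_def by measurable

lemma log_peak_measurable [measurable]: "log_peak \<in> borel_measurable borel"
  unfolding log_peak_def by measurable

lemma log_peak_nonneg: "0 \<le> log_peak s"
  by (simp add: log_peak_def)

lemma log_ratio_eq:
  assumes "p * q < 0" "0 < x * p" "x \<noteq> p"
  shows "log_ratio p q x = 2 * (ln \<bar>x / p - 1\<bar> - ln (1 + \<bar>x / q\<bar>))"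
proof -
  have "x / q < 0" using assms by (auto simp: divide_less_0_iff zero_less_mult_iff mult_less_0_iff)
  then have q: "\<bar>x / q - 1\<bar> = 1 + \<bar>x / q\<bar>" by linarith
  have p: "0 < \<bar>x / p - 1\<bar>" using assms by (auto simp: divide_eq_1_iff)
  have "log_ratio p q x = ln ((\<bar>x / p - 1\<bar> / (1 + \<bar>x / q\<bar>))\<^sup>2)"
    unfolding log_ratio_def abs_divide[of "x / p - 1"] q using assms(2) by simp
  also have "\<dots> = 2 * ln (\<bar>x / p - 1\<bar> / (1 + \<bar>x / q\<bar>))"
    using p by (subst ln_realpow) auto
  also have "ln (\<bar>x / p - 1\<bar> / (1 + \<bar>x / q\<bar>)) = ln \<bar>x / p - 1\<bar> - ln (1 + \<bar>x / q\<bar>)"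
  proof -
    have "ln (a / b) = ln a - ln b" if "0 < a" "0 < b" for a b :: real
      using that by (simp add: ln_div)
    moreover have "0 < 1 + \<bar>x / q\<bar>" by (simp add: add_pos_nonneg)
    ultimately show ?thesis using p by blast
  qed
  finally show ?thesis .
qed

text \<open>
  For \<open>x\<close> between 0 and \<open>p\<close> the numerator has absolute value at most 1 and the
  denominator at least 1.
\<close>

lemma log_ratio_nonpos:
  assumes pq: "p * q < 0" and x: "\<bar>x\<bar> \<le> \<bar>p\<bar>"
  shows "log_ratio p q x \<le> 0"
proof (cases "0 < x * p \<and> x \<noteq> p")
  case True
  then have u: "0 < x / p" "x / p \<noteq> 1" "x / p \<le> 1"
    using x by (auto simp: zero_less_divide_iff zero_less_mult_iff divide_le_eq_1)
  have "0 < \<bar>x / p - 1\<bar>" using u(2) by (simp only: zero_less_abs_iff right_minus_eq not_False_eq_True)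
  moreover have "\<bar>x / p - 1\<bar> \<le> 1" using u(1,3) by linarith
  ultimately have le: "ln \<bar>x / p - 1\<bar> \<le> 0" by (rule ln_le_zero_iff[THEN iffD2])
  have ge: "0 \<le> ln (1 + \<bar>x / q\<bar>)" by simp
  have "2 * (a - b) \<le> 0" if "a \<le> 0" "0 \<le> b" for a b :: real
    using that by simp
  from this[OF le ge] show ?thesis
    unfolding log_ratio_eq[OF pq conjunct1[OF True] conjunct2[OF True]] .
next
  case False
  then show ?thesis by (auto simp: log_ratio_def)
qed

lemma log_ratio_le:
  assumes pq: "p * q < 0"
  shows "log_ratio p q x \<le> 2 * ln (1 + \<bar>q / p\<bar>)"
proof (cases "0 < x * p \<and> x \<noteq> p")
  case True
  have nz: "p \<noteq> 0" "q \<noteq> 0" using pq by auto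
  have "\<bar>x / p - 1\<bar> \<le> 1 + \<bar>x / p\<bar>" by linarith
  also have "\<bar>x / p\<bar> = \<bar>q / p\<bar> * \<bar>x / q\<bar>" using nz by (simp add: abs_divide)
  also have "1 + \<bar>q / p\<bar> * \<bar>x / q\<bar> \<le> (1 + \<bar>q / p\<bar>) * (1 + \<bar>x / q\<bar>)"
  proof -
    have le: "1 + a * b \<le> (1 + a) * (1 + b)" if "0 \<le> a" "0 \<le> b" for a b :: real
      using that by (simp add: algebra_simps)
    show ?thesis by (rule le) simp_all
  qed
  finally have le: "\<bar>x / p - 1\<bar> \<le> (1 + \<bar>q / p\<bar>) * (1 + \<bar>x / q\<bar>)" .
  have pos: "0 < \<bar>x / p - 1\<bar>" using True nz by (auto simp: divide_eq_1_iff)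
  have "ln a \<le> ln b" if "0 < a" "a \<le> b" for a b :: real
    using that by (subst ln_le_cancel_iff) auto
  from this[OF pos le] have "ln \<bar>x / p - 1\<bar> \<le> ln ((1 + \<bar>q / p\<bar>) * (1 + \<bar>x / q\<bar>))" .
  also have "\<dots> = ln (1 + \<bar>q / p\<bar>) + ln (1 + \<bar>x / q\<bar>)"
  proof -
    have eq: "ln (a * b) = ln a + ln b" if "0 < a" "0 < b" for a b :: real
      using that by (simp add: ln_mult)
    show ?thesis by (rule eq) (simp_all add: add_pos_nonneg)
  qed
  finally have le_sum: "ln \<bar>x / p - 1\<bar> \<le> ln (1 + \<bar>q / p\<bar>) + ln (1 + \<bar>x / q\<bar>)" .
  have "2 * (a - b) \<le> 2 * c" if "a \<le> c + b" for a b c :: real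
    using that by simp
  from this[OF le_sum] show ?thesis
    unfolding log_ratio_eq[OF pq conjunct1[OF True] conjunct2[OF True]] .
next
  case False
  then show ?thesis by (auto simp: log_ratio_def)
qed

lemma abs_ln_dist_one_le:
  fixes u :: real
  assumes u: "0 < u" "u \<noteq> 1"
  shows "\<bar>ln \<bar>u - 1\<bar>\<bar> \<le> 2 * u + 2 * log_peak (u - 1)"
proof -
  define a where "a = \<bar>u - 1\<bar>"
  have a: "0 < a" using u by (simp add: a_def)
  have up: "ln a \<le> a - 1" using ln_le_minus_one[OF a] .
  have inv: "- ln a \<le> 1 / a - 1" using ln_le_minus_one[of "1 / a"] a by (simp add: ln_div)
  show ?thesis
  proof (cases "a < 1 / 2")
    case True
    have "ln (a powr (- 1 / 2)) \<le> a powr (- 1 / 2) - 1"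
      using a by (intro ln_le_minus_one) simp
    then have "- ln a \<le> 2 * a powr (- 1 / 2)" using a by (simp add: ln_powr)
    moreover have "ln a \<le> 0" using True up by linarith
    ultimately have "\<bar>ln a\<bar> \<le> 2 * a powr (- 1 / 2)" by linarith
    moreover have "log_peak (u - 1) = a powr (- 1 / 2)" using True by (simp add: log_peak_def a_def)
    ultimately show ?thesis using u by (simp add: a_def)
  next
    case False
    have "\<bar>ln a\<bar> \<le> 2 * u"
    proof (cases "u < 1")
      case True
      then have au: "a = 1 - u" "u \<le> 1 / 2" using False by (auto simp: a_def)
      have "1 / a - 1 = u / a" using a by (simp add: au(1) field_simps)
      also have "\<dots> \<le> 2 * u" using False u by (simp add: pos_divide_le_eq[OF a] mult_le_cancel_left1)
      finally have "- ln a \<le> 2 * u" using inv by linarith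
      then show ?thesis using up au u by linarith
    next
      case n: False
      then have au: "a = u - 1" "u \<ge> 3 / 2" using False by (auto simp: a_def)
      have "1 / a \<le> 2" using False a by (simp add: divide_le_eq)
      then show ?thesis using up inv au by linarith
    qed
    then show ?thesis using log_peak_nonneg[of "u - 1"] by (simp add: a_def)
  qed
qed

text \<open>
  Linear growth controls both the behaviour at the origin, where it is sharp, and at infinity, where
  the logarithm is even bounded.
\<close>

lemma abs_log_ratio_le:
  assumes pq: "p * q < 0"
  shows "\<bar>log_ratio p q x\<bar> \<le> (4 / \<bar>p\<bar> + 2 / \<bar>q\<bar>) * \<bar>x\<bar> + 4 * log_peak (x / p - 1)"
proof (cases "0 < x * p \<and> x \<noteq> p")
  case True
  then have u: "0 < x / p" "x / p \<noteq> 1"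
    using pq by (auto simp: zero_less_divide_iff zero_less_mult_iff)
  have b: "0 \<le> ln (1 + \<bar>x / q\<bar>)" "ln (1 + \<bar>x / q\<bar>) \<le> \<bar>x / q\<bar>"
    by (auto intro: ln_add_one_self_le_self)
  have e: "x / p = \<bar>x\<bar> / \<bar>p\<bar>" using abs_of_pos[OF u(1)] by (simp only: abs_divide)
  have "\<bar>2 * (a - b)\<bar> \<le> 2 * \<bar>a\<bar> + 2 * b" if "0 \<le> b" for a b :: real
    using abs_triangle_ineq4[of a b] that by simp
  from this[OF b(1)] have "\<bar>log_ratio p q x\<bar> \<le> 2 * \<bar>ln \<bar>x / p - 1\<bar>\<bar> + 2 * ln (1 + \<bar>x / q\<bar>)"
    unfolding log_ratio_eq[OF pq conjunct1[OF True] conjunct2[OF True]] .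
  also have "\<dots> \<le> 2 * (2 * (x / p) + 2 * log_peak (x / p - 1)) + 2 * \<bar>x / q\<bar>"
    by (intro add_mono mult_left_mono abs_ln_dist_one_le u b) auto
  also have "2 * (2 * (x / p) + 2 * l) + 2 * \<bar>x / q\<bar> = (4 / \<bar>p\<bar> + 2 / \<bar>q\<bar>) * \<bar>x\<bar> + 4 * l" for l
    unfolding e abs_divide by (simp add: distrib_right)
  finally show ?thesis .
next
  case False
  then have "log_ratio p q x = 0" by (auto simp: log_ratio_def)
  then show ?thesis using log_peak_nonneg[of "x / p - 1"] by simp
qed

lemma log_peak_integral: "(\<integral>\<^sup>+s. ennreal (log_peak s) \<partial>lborel) < \<infinity>"
proof -
  define h where "h s = indicator {0..1} s * s powr (- 1 / 2)" for s :: real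
  have hm [measurable]: "h \<in> borel_measurable borel" unfolding h_def by measurable
  have "((\<lambda>x. x powr (- 1 / 2)) has_integral 1 powr (- 1 / 2 + 1) / (- 1 / 2 + 1)) {0..1::real}"
    by (rule has_integral_powr_from_0) auto
  then have h: "(\<integral>\<^sup>+s. ennreal (h s) \<partial>lborel) = ennreal (1 powr (- 1 / 2 + 1) / (- 1 / 2 + 1))"
    unfolding h_def by (intro nn_integral_has_integral_lebesgue) auto
  have h': "(\<integral>\<^sup>+s. ennreal (h (- s)) \<partial>lborel) = (\<integral>\<^sup>+s. ennreal (h s) \<partial>lborel)"
    using nn_integral_real_affine[of "\<lambda>s. ennreal (h s)" "-1" 0] by simp
  have "(\<integral>\<^sup>+s. ennreal (log_peak s) \<partial>lborel) \<le> (\<integral>\<^sup>+s. ennreal (h s) + ennreal (h (- s)) \<partial>lborel)"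
  proof (rule nn_integral_mono)
    fix s
    have "log_peak s \<le> h s + h (- s)"
      by (cases "0 \<le> s") (auto simp: log_peak_def h_def indicator_def)
    then have "ennreal (log_peak s) \<le> ennreal (h s + h (- s))" by (rule ennreal_leI)
    also have "\<dots> = ennreal (h s) + ennreal (h (- s))"
      by (rule ennreal_plus) (simp_all add: h_def)
    finally show "ennreal (log_peak s) \<le> ennreal (h s) + ennreal (h (- s))" .
  qed
  also have "\<dots> = (\<integral>\<^sup>+s. ennreal (h s) \<partial>lborel) + (\<integral>\<^sup>+s. ennreal (h (- s)) \<partial>lborel)"
    by (rule nn_integral_add) measurable
  also have "\<dots> < \<infinity>" unfolding h' h by simp
  finally show ?thesis .
qed

lemma log_peak_scaled:
  assumes "p \<noteq> 0"
  shows "(\<integral>\<^sup>+x. ennreal (log_peak (x / p - 1)) \<partial>lborel) < \<infinity>"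
proof -
  have "(\<integral>\<^sup>+x. ennreal (log_peak (x / p - 1)) \<partial>lborel)
      = ennreal \<bar>p\<bar> * (\<integral>\<^sup>+x. ennreal (log_peak ((p + p * x) / p - 1)) \<partial>lborel)"
    using assms by (intro nn_integral_real_affine) auto
  also have "\<dots> = ennreal \<bar>p\<bar> * (\<integral>\<^sup>+x. ennreal (log_peak x) \<partial>lborel)"
    using assms by (simp add: add_divide_distrib)
  also have "\<dots> < \<infinity>" using log_peak_integral by (simp add: ennreal_mult_less_top)
  finally show ?thesis .
qed

text \<open>
  The two properties of the weight that make the logarithms integrable: the first handles the origin
  and infinity, the second the logarithmic singularities.
\<close>

locale regular_process = dominated_process +
  assumes moment: "(\<integral>\<^sup>+x. ennreal \<bar>x\<bar> * ennreal ((w x)\<^sup>2) \<partial>lborel) < \<infinity>"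
    and locally_bounded: "\<And>S. compact S \<Longrightarrow> S \<subseteq> Rstar \<Longrightarrow> \<exists>b. \<forall>x\<in>S. (w x)\<^sup>2 \<le> b"
begin

lemma nu_integral:
  assumes "F \<in> borel_measurable borel"
  shows "(\<integral>\<^sup>+x. F x \<partial>\<nu>) = (\<integral>\<^sup>+x. F x * ennreal ((w x)\<^sup>2) \<partial>lborel)"
  unfolding \<nu>_def using assms by (subst nn_integral_density) (auto simp: mult.commute)

lemma tail_mass_finite:
  assumes "0 < \<epsilon>"
  shows "emeasure \<nu> {x. \<epsilon> < \<bar>x\<bar>} < \<infinity>"
proof -
  have "emeasure \<nu> {x. \<epsilon> < \<bar>x\<bar>} = (\<integral>\<^sup>+x. indicator {x. \<epsilon> < \<bar>x\<bar>} x \<partial>\<nu>)"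
    by (subst nn_integral_indicator) auto
  also have "\<dots> = (\<integral>\<^sup>+x. indicator {x. \<epsilon> < \<bar>x\<bar>} x * ennreal ((w x)\<^sup>2) \<partial>lborel)"
    by (rule nu_integral) measurable
  also have "\<dots> \<le> (\<integral>\<^sup>+x. ennreal (1 / \<epsilon>) * (ennreal \<bar>x\<bar> * ennreal ((w x)\<^sup>2)) \<partial>lborel)"
  proof (rule nn_integral_mono)
    fix x
    show "indicator {x. \<epsilon> < \<bar>x\<bar>} x * ennreal ((w x)\<^sup>2) \<le> ennreal (1 / \<epsilon>) * (ennreal \<bar>x\<bar> * ennreal ((w x)\<^sup>2))"
    proof (cases "\<epsilon> < \<bar>x\<bar>")
      case True
      then have "1 * (w x)\<^sup>2 \<le> \<bar>x\<bar> / \<epsilon> * (w x)\<^sup>2" using assms by (intro mult_right_mono) auto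
      then have "ennreal ((w x)\<^sup>2) \<le> ennreal (1 / \<epsilon> * (\<bar>x\<bar> * (w x)\<^sup>2))" by (intro ennreal_leI) simp
      also have "\<dots> = ennreal (1 / \<epsilon>) * (ennreal \<bar>x\<bar> * ennreal ((w x)\<^sup>2))"
        using assms by (simp add: ennreal_mult[symmetric])
      finally show ?thesis using True by simp
    qed simp
  qed
  also have "\<dots> = ennreal (1 / \<epsilon>) * (\<integral>\<^sup>+x. ennreal \<bar>x\<bar> * ennreal ((w x)\<^sup>2) \<partial>lborel)"
    by (rule nn_integral_cmult) measurable
  also have "\<dots> < \<infinity>" using moment by (simp add: ennreal_mult_less_top)
  finally show ?thesis .
qed

lemma log_ratio_integrable:
  assumes pq: "p * q < 0"
  shows "(\<integral>\<^sup>+x. ennreal \<bar>log_ratio p q x\<bar> \<partial>\<nu>) < \<infinity>"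
proof -
  have p: "p \<noteq> 0" using pq by auto
  define I where "I = {x. \<bar>x - p\<bar> \<le> \<bar>p\<bar> / 2}"
  have "I = cball p (\<bar>p\<bar> / 2)" by (auto simp: I_def cball_def dist_real_def abs_minus_commute)
  then have cI: "compact I" by simp
  have "I \<subseteq> Rstar" using p by (auto simp: I_def)
  from locally_bounded[OF cI this] obtain b where b: "\<And>x. x \<in> I \<Longrightarrow> (w x)\<^sup>2 \<le> b" by blast
  define B where "B = max b 0"
  define c where "c = 4 / \<bar>p\<bar> + 2 / \<bar>q\<bar>"
  have c: "0 \<le> c" by (simp add: c_def)
  have "(\<integral>\<^sup>+x. ennreal \<bar>log_ratio p q x\<bar> \<partial>\<nu>) = (\<integral>\<^sup>+x. ennreal \<bar>log_ratio p q x\<bar> * ennreal ((w x)\<^sup>2) \<partial>lborel)"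
    by (rule nu_integral) measurable
  also have "\<dots> \<le> (\<integral>\<^sup>+x. ennreal c * (ennreal \<bar>x\<bar> * ennreal ((w x)\<^sup>2)) + ennreal (4 * B) * ennreal (log_peak (x / p - 1)) \<partial>lborel)"
  proof (rule nn_integral_mono)
    fix x
    have pk: "log_peak (x / p - 1) * (w x)\<^sup>2 \<le> log_peak (x / p - 1) * B"
    proof (cases "\<bar>x / p - 1\<bar> < 1 / 2")
      case True
      have "\<bar>x - p\<bar> = \<bar>p\<bar> * \<bar>x / p - 1\<bar>" using p by (simp add: abs_mult[symmetric] right_diff_distrib)
      also have "\<dots> \<le> \<bar>p\<bar> * (1 / 2)" using True by (intro mult_left_mono) auto
      finally have "x \<in> I" by (simp add: I_def)
      then show ?thesis using b[of x] by (intro mult_left_mono log_peak_nonneg) (auto simp: B_def)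
    qed (simp add: log_peak_def)
    have "\<bar>log_ratio p q x\<bar> * (w x)\<^sup>2 \<le> (c * \<bar>x\<bar> + 4 * log_peak (x / p - 1)) * (w x)\<^sup>2"
      unfolding c_def by (intro mult_right_mono abs_log_ratio_le pq) simp
    also have "\<dots> \<le> c * (\<bar>x\<bar> * (w x)\<^sup>2) + 4 * B * log_peak (x / p - 1)"
    proof -
      have "(c * \<bar>x\<bar> + 4 * log_peak (x / p - 1)) * (w x)\<^sup>2
          = c * (\<bar>x\<bar> * (w x)\<^sup>2) + 4 * (log_peak (x / p - 1) * (w x)\<^sup>2)"
        by (simp add: distrib_right)
      also have "\<dots> \<le> c * (\<bar>x\<bar> * (w x)\<^sup>2) + 4 * (log_peak (x / p - 1) * B)"
        using pk by simp
      finally show ?thesis by (simp add: mult_ac)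
    qed
    finally have "ennreal (\<bar>log_ratio p q x\<bar> * (w x)\<^sup>2)
        \<le> ennreal (c * (\<bar>x\<bar> * (w x)\<^sup>2) + 4 * B * log_peak (x / p - 1))" by (rule ennreal_leI)
    also have "\<dots> = ennreal (c * (\<bar>x\<bar> * (w x)\<^sup>2)) + ennreal (4 * B * log_peak (x / p - 1))"
      using c log_peak_nonneg by (intro ennreal_plus) (auto simp: B_def)
    also have "ennreal (c * (\<bar>x\<bar> * (w x)\<^sup>2)) = ennreal c * (ennreal \<bar>x\<bar> * ennreal ((w x)\<^sup>2))"
      using c by (simp add: ennreal_mult)
    also have "ennreal (4 * B * log_peak (x / p - 1)) = ennreal (4 * B) * ennreal (log_peak (x / p - 1))"
      using log_peak_nonneg by (intro ennreal_mult) (auto simp: B_def)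
    finally show "ennreal \<bar>log_ratio p q x\<bar> * ennreal ((w x)\<^sup>2)
        \<le> ennreal c * (ennreal \<bar>x\<bar> * ennreal ((w x)\<^sup>2)) + ennreal (4 * B) * ennreal (log_peak (x / p - 1))"
      by (simp add: ennreal_mult)
  qed
  also have "\<dots> = ennreal c * (\<integral>\<^sup>+x. ennreal \<bar>x\<bar> * ennreal ((w x)\<^sup>2) \<partial>lborel)
      + ennreal (4 * B) * (\<integral>\<^sup>+x. ennreal (log_peak (x / p - 1)) \<partial>lborel)"
    by (simp add: nn_integral_add nn_integral_cmult)
  also have "\<dots> < \<infinity>"
    using moment log_peak_scaled[OF p] by (simp add: ennreal_mult_less_top)
  finally show ?thesis .
qed

end

lemma D_sum_eq:
  assumes pp: "\<forall>i\<in>{1..n}. pp i > 0" and pm: "\<forall>i\<in>{1..n}. pm i < 0" and \<delta>: "0 < \<delta>"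
  shows "D_sum n pp pm \<delta> X = (\<Sum>j\<in>{1..n} \<times> UNIV.
    line_sum (case j of (i, right) \<Rightarrow> if right then log_ratio (pp i) (pm i) else log_ratio (pm i) (pp i)) X \<delta>)"
proof -
  have "(\<Sum>j\<in>{1..n} \<times> UNIV.
      line_sum (case j of (i, right) \<Rightarrow> if right then log_ratio (pp i) (pm i) else log_ratio (pm i) (pp i)) X \<delta>)
    = (\<Sum>i=1..n. \<Sum>right\<in>UNIV. line_sum (if right then log_ratio (pp i) (pm i) else log_ratio (pm i) (pp i)) X \<delta>)"
    by (subst sum.cartesian_product) (intro sum.cong refl, auto)
  also have "\<dots> = D_sum n pp pm \<delta> X"
    unfolding D_sum_def
  proof (intro sum.cong refl)
    fix i assume i: "i \<in> {1..n}"
    then have s: "0 < pp i" "pm i < 0" using pp pm by auto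
    have r: "line_sum (log_ratio (pp i) (pm i)) X \<delta>
        = (\<Sum>\<^sub>\<infinity>x\<in>X \<inter> {\<delta><..}. ln (\<bar>(x / pp i - 1) / (x / pm i - 1)\<bar>\<^sup>2))"
      unfolding infsum_eq_lebesgue line_sum_def using s \<delta>
      by (intro Bochner_Integration.integral_cong refl)
         (auto simp: log_ratio_def indicator_def zero_less_mult_iff)
    have l: "line_sum (log_ratio (pm i) (pp i)) X \<delta>
        = (\<Sum>\<^sub>\<infinity>x\<in>X \<inter> {..< - \<delta>}. ln (\<bar>(x / pm i - 1) / (x / pp i - 1)\<bar>\<^sup>2))"
      unfolding infsum_eq_lebesgue line_sum_def using s \<delta>
      by (intro Bochner_Integration.integral_cong refl)
         (auto simp: log_ratio_def indicator_def zero_less_mult_iff)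
    show "(\<Sum>right\<in>UNIV. line_sum (if right then log_ratio (pp i) (pm i) else log_ratio (pm i) (pp i)) X \<delta>)
      = (\<Sum>\<^sub>\<infinity>x\<in>X \<inter> {\<delta><..}. ln (\<bar>(x / pp i - 1) / (x / pm i - 1)\<bar>\<^sup>2)) +
        (\<Sum>\<^sub>\<infinity>x\<in>X \<inter> {..< - \<delta>}. ln (\<bar>(x / pm i - 1) / (x / pp i - 1)\<bar>\<^sup>2))"
      unfolding r[symmetric] l[symmetric] by (simp add: UNIV_bool)
  qed
  finally show ?thesis by simp
qed

theorem proposition1p8:
  fixes A :: "real \<Rightarrow> real"
    and K :: "real \<Rightarrow> real \<Rightarrow> complex"
    and \<mu> :: "real set measure"
    and n :: nat
    and pp pm :: "nat \<Rightarrow> real"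
  assumes A_C1: "A C1_differentiable_on Rstar"
    and A_L2: "(\<lambda>x. complex_of_real (A x)) \<in> L2_star"
    and A_support: "Rstar \<inter> closure {x \<in> Rstar. A x \<noteq> 0} = Rstar"
    and L_bounded: "has_kernel (L_op A) (L_kernel A)" "bounded_op (L_op A)"
    and K_L: "is_K_kernel A K"
    and mu_L: "determinantal \<mu> K"
    and n: "n \<ge> 1"
    and pp: "\<forall>i\<in>{1..n}. pp i > 0" "inj_on pp {1..n}"
    and pm: "\<forall>i\<in>{1..n}. pm i < 0" "inj_on pm {1..n}"
  shows "(\<forall>\<delta>>0. integrable \<mu> (D_sum n pp pm \<delta>)) \<and>
         (AE X in \<mu>. \<exists>l. (centered_D_sum \<mu> n pp pm X \<longlongrightarrow> l) (at_right 0)) \<and>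
         integrable \<mu> (\<lambda>X. exp (S_bar \<mu> n pp pm X))"
proof -
  interpret op: integrable_operator A K
    using C1_differentiable_imp_continuous_on[OF A_C1] A_L2 L_bounded(2) K_L
    by unfold_locales
  interpret reg: regular_process \<mu> K op.weight
    by unfold_locales (fact mu_L op.weight_measurable op.weight_nonneg op.K_le_weight op.weight_moment op.weight_locally_bounded)+
  \<comment> \<open>The index records the pair of points and the semi-axis.\<close>
  define G where "G j = (case j of (i, right) \<Rightarrow> if right then log_ratio (pp i) (pm i) else log_ratio (pm i) (pp i))"
    for j :: "nat \<times> bool"
  define \<epsilon> where "\<epsilon> = Min ((\<lambda>i. min (pp i) (- pm i)) ` {1..n})"
  define c where "c = (\<Sum>i=1..n. 2 * ln (1 + \<bar>pm i / pp i\<bar>) + 2 * ln (1 + \<bar>pp i / pm i\<bar>))"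
  have sgn: "pp i * pm i < 0" "pm i * pp i < 0" if "i \<in> {1..n}" for i
    using pp(1) pm(1) that by (auto simp: mult_pos_neg mult_neg_pos)
  have \<epsilon>_le: "\<epsilon> \<le> \<bar>pp i\<bar>" "\<epsilon> \<le> \<bar>pm i\<bar>" if "i \<in> {1..n}" for i
  proof -
    have "\<epsilon> \<le> min (pp i) (- pm i)" unfolding \<epsilon>_def using that by (intro Min_le) auto
    then show "\<epsilon> \<le> \<bar>pp i\<bar>" "\<epsilon> \<le> \<bar>pm i\<bar>" by auto
  qed
  have \<epsilon>: "0 < \<epsilon>" unfolding \<epsilon>_def using n pp(1) pm(1) by (subst Min_gr_iff) auto
  have c_ge: "2 * ln (1 + \<bar>pm i / pp i\<bar>) + 2 * ln (1 + \<bar>pp i / pm i\<bar>) \<le> c" if "i \<in> {1..n}" for i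
    unfolding c_def using that
    by (intro member_le_sum[of i "{1..n}" "\<lambda>i. 2 * ln (1 + \<bar>pm i / pp i\<bar>) + 2 * ln (1 + \<bar>pp i / pm i\<bar>)"]) auto
  have G_le: "G j x \<le> c" if j: "j \<in> {1..n} \<times> UNIV" for j x
  proof -
    obtain i r where ir: "j = (i, r)" "i \<in> {1..n}" using j by auto
    have "0 \<le> 2 * ln (1 + \<bar>pm i / pp i\<bar>)" "0 \<le> 2 * ln (1 + \<bar>pp i / pm i\<bar>)" by simp_all
    with log_ratio_le[OF sgn(1)[OF ir(2)], of x] log_ratio_le[OF sgn(2)[OF ir(2)], of x] c_ge[OF ir(2)]
    have "log_ratio (pp i) (pm i) x \<le> c" "log_ratio (pm i) (pp i) x \<le> c" by linarith+
    then show ?thesis by (simp add: G_def ir(1))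
  qed
  interpret stat: linear_statistic \<mu> K op.weight "{1..n} \<times> (UNIV :: bool set)" G \<epsilon> c
  proof unfold_locales
    show "finite ({1..n} \<times> (UNIV :: bool set))" by simp
    show "0 < \<epsilon>" by (rule \<epsilon>)
    show "0 \<le> c" unfolding c_def by (intro sum_nonneg) auto
    show "emeasure reg.\<nu> {x. \<epsilon> < \<bar>x\<bar>} < \<infinity>" by (rule reg.tail_mass_finite[OF \<epsilon>])
    fix j :: "nat \<times> bool" assume j: "j \<in> {1..n} \<times> UNIV"
    then obtain i r where ir: "j = (i, r)" "i \<in> {1..n}" by auto
    show "G j \<in> borel_measurable borel" by (simp add: G_def ir(1))
    show "(\<integral>\<^sup>+x. ennreal \<bar>G j x\<bar> \<partial>reg.\<nu>) < \<infinity>"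
      using reg.log_ratio_integrable[OF sgn(1)[OF ir(2)]] reg.log_ratio_integrable[OF sgn(2)[OF ir(2)]]
      by (simp add: G_def ir(1))
    fix x
    show "G j x \<le> c" by (rule G_le[OF j])
    assume "\<bar>x\<bar> \<le> \<epsilon>"
    then have "\<bar>x\<bar> \<le> \<bar>pp i\<bar>" "\<bar>x\<bar> \<le> \<bar>pm i\<bar>" using \<epsilon>_le[OF ir(2)] by linarith+
    then show "G j x \<le> 0"
      using log_ratio_nonpos[OF sgn(1)[OF ir(2)]] log_ratio_nonpos[OF sgn(2)[OF ir(2)]]
      by (simp add: G_def ir(1))
  qed
  have D: "D_sum n pp pm \<delta> X = stat.S X \<delta>" if "0 < \<delta>" for \<delta> X
    unfolding D_sum_eq[OF pp(1) pm(1) that] stat.S_def G_def ..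
  have DD: "D_sum n pp pm \<delta> = (\<lambda>X. stat.S X \<delta>)" if "0 < \<delta>" for \<delta>
    by (rule ext) (rule D[OF that])
  have cent: "centered_D_sum \<mu> n pp pm X \<delta> = stat.centered X \<delta>" if "0 < \<delta>" for X \<delta>
    unfolding centered_D_sum_def stat.centered_def DD[OF that] ..
  have lim: "(centered_D_sum \<mu> n pp pm X \<longlongrightarrow> l) (at_right 0) \<longleftrightarrow> (stat.centered X \<longlongrightarrow> l) (at_right 0)" for X l
    by (rule tendsto_cong) (auto simp: eventually_at_right_field cent intro: exI[of _ 1])
  have S: "S_bar \<mu> n pp pm X = stat.limit X" for X
    unfolding S_bar_def stat.limit_def t2_space_class.Lim_def lim ..
  have "integrable \<mu> (D_sum n pp pm \<delta>)" if "0 < \<delta>" for \<delta>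
    unfolding DD[OF that] by (rule stat.S_integrable)
  with stat.centered_converges_AE stat.exp_limit_integrable show ?thesis
    unfolding lim S by blast
qed

end
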